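(* For $n\ge1$ there is a homotopy equivalence $$\Sigma K_n\simeq S^2\vee\bigvee_{\text{even } i>0}\tbinom{n-1}{i}\bigl(S^{i+1}\vee S^{i+2}\bigr)\vee\bigvee_{\text{odd } i}\tbinom{n-1}{i}M^{i+2}(2),$$ where $M^{i+2}(2)=S^{i+1}\cup_2e^{i+2}$ is the mod-2 Moore space and $\binom{n-1}{i}Y$ denotes a wedge of $\binom{n-1}{i}$ copies of $Y$.
   Context: $\Sigma$ denotes (reduced) suspension. $K_n=(S^1)^n/\bigl((z_1,\ldots,z_{n-1},z_n)\sim(\overline{z}_1,\ldots,\overline{z}_{n-1},-z_n)\bigr)$, where $S^1\subset\mathbb{C}$ is the unit circle and $\overline{z}$ is complex conjugation. *)

theory Defs
  imports "HOL-Analysis.Analysis"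
begin

lemma istopology_quotient_top:
  "istopology (\<lambda>U. U \<subseteq> q ` topspace X \<and> openin X {x \<in> topspace X. q x \<in> U})"
  unfolding istopology_def
proof (rule conjI; intro allI impI)
  fix S T
  assume S: "S \<subseteq> q ` topspace X \<and> openin X {x \<in> topspace X. q x \<in> S}"
     and T: "T \<subseteq> q ` topspace X \<and> openin X {x \<in> topspace X. q x \<in> T}"
  have e: "{x \<in> topspace X. q x \<in> S \<inter> T} = {x \<in> topspace X. q x \<in> S} \<inter> {x \<in> topspace X. q x \<in> T}"
    by blast
  show "S \<inter> T \<subseteq> q ` topspace X \<and> openin X {x \<in> topspace X. q x \<in> S \<inter> T}"
    unfolding e using S T by (blast intro: openin_Int)
next
  fix K
  assume K: "\<forall>U\<in>K. U \<subseteq> q ` topspace X \<and> openin X {x \<in> topspace X. q x \<in> U}"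
  have e: "{x \<in> topspace X. q x \<in> \<Union>K} = \<Union>((\<lambda>U. {x \<in> topspace X. q x \<in> U}) ` K)"
    by blast
  show "\<Union>K \<subseteq> q ` topspace X \<and> openin X {x \<in> topspace X. q x \<in> \<Union>K}"
    unfolding e using K by (blast intro: openin_Union)
qed

definition quotient_top :: "'a topology \<Rightarrow> ('a \<Rightarrow> 'b) \<Rightarrow> 'b topology" where
  "quotient_top X q = topology (\<lambda>U. U \<subseteq> q ` topspace X \<and> openin X {x \<in> topspace X. q x \<in> U})"

definition reduced_suspension :: "'a topology \<Rightarrow> 'a \<Rightarrow> ('a \<times> real) option topology" where
  "reduced_suspension X x0 =
     quotient_top (prod_topology X (top_of_set {0..1}))
       (\<lambda>(x, t). if t = 0 \<or> t = 1 \<or> x = x0 then None else Some (x, t))"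

definition wedge :: "'i set \<Rightarrow> ('i \<Rightarrow> 'a topology) \<Rightarrow> ('i \<Rightarrow> 'a) \<Rightarrow> ('i \<times> 'a) option topology" where
  "wedge I Y b = quotient_top (sum_topology Y I)
       (\<lambda>(i, y). if y = b i then None else Some (i, y))"

text \<open>(S^1)^n as a product of unit circles in C, coordinates indexed 0..n-1
  (coordinate n-1 is z_n of the paper).\<close>
definition torus :: "nat \<Rightarrow> (nat \<Rightarrow> complex) topology" where
  "torus n = product_topology (\<lambda>i. top_of_set (sphere (0::complex) 1)) {..<n}"

definition Kinv :: "nat \<Rightarrow> (nat \<Rightarrow> complex) \<Rightarrow> (nat \<Rightarrow> complex)" where
  "Kinv n z = (\<lambda>i. if i < n - 1 then cnj (z i) else if i = n - 1 then - z i else z i)"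

definition Kspace :: "nat \<Rightarrow> (nat \<Rightarrow> complex) set topology" where
  "Kspace n = quotient_top (torus n) (\<lambda>z. {z, Kinv n z})"

definition Kbase :: "nat \<Rightarrow> (nat \<Rightarrow> complex) set" where
  "Kbase n = {restrict (\<lambda>i. 1) {..<n}, Kinv n (restrict (\<lambda>i. 1) {..<n})}"

definition ndisk :: "nat \<Rightarrow> (nat \<Rightarrow> real) topology" where
  "ndisk p = subtopology (Euclidean_space (Suc p)) {x. (\<Sum>i\<le>p. x i ^ 2) \<le> 1}"

definition e0 :: "nat \<Rightarrow> real" where
  "e0 = (\<lambda>i. if i = 0 then 1 else 0)"

text \<open>Degree 2 self-map of the unit sphere: doubles the angle in the (x_0,x_1)-plane,
  i.e. (x_0 + i x_1) \<mapsto> (x_0 + i x_1)^2 / |x_0 + i x_1|, other coordinates fixed.\<close>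
definition deg2 :: "(nat \<Rightarrow> real) \<Rightarrow> (nat \<Rightarrow> real)" where
  "deg2 x = (let r = sqrt (x 0 ^ 2 + x 1 ^ 2) in
             x(0 := (x 0 ^ 2 - x 1 ^ 2) / r, 1 := 2 * x 0 * x 1 / r))"

text \<open>The p-sphere, as a space on the common carrier type (tag False).\<close>
definition Sph :: "nat \<Rightarrow> (bool \<times> (nat \<Rightarrow> real)) topology" where
  "Sph p = quotient_top (nsphere p) (\<lambda>x. (False, x))"

text \<open>Moore space M^k(2) = S^(k-1) \<union>_2 e^k (k \<ge> 2): the k-disk with boundary points
  identified along the degree 2 map (boundary point x goes to (True, deg2 x)).\<close>
definition Moore2 :: "nat \<Rightarrow> (bool \<times> (nat \<Rightarrow> real)) topology" where
  "Moore2 k = quotient_top (ndisk (k - 1))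
      (\<lambda>x. if (\<Sum>i\<le>k - 1. x i ^ 2) = 1 then (True, deg2 x) else (False, x))"

text \<open>Index (kind, i, j): kind 0 = S^2; kind 1 = S^(i+1), kind 2 = S^(i+2) for even i > 0;
  kind 3 = M^(i+2)(2) for odd i; j counts the binom(n-1,i) copies.\<close>
definition RHS_index :: "nat \<Rightarrow> (nat \<times> nat \<times> nat) set" where
  "RHS_index n = {(0, 0, 0)}
     \<union> {(k, i, j). (k = 1 \<or> k = 2) \<and> even i \<and> i > 0 \<and> j < (n - 1) choose i}
     \<union> {(k, i, j). k = 3 \<and> odd i \<and> j < (n - 1) choose i}"

definition RHS_space :: "nat \<times> nat \<times> nat \<Rightarrow> (bool \<times> (nat \<Rightarrow> real)) topology" where
  "RHS_space = (\<lambda>(k, i, j). if k = 0 then Sph 2 else if k = 1 then Sph (i + 1)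
                 else if k = 2 then Sph (i + 2) else Moore2 (i + 2))"

definition RHS_base :: "nat \<times> nat \<times> nat \<Rightarrow> bool \<times> (nat \<Rightarrow> real)" where
  "RHS_base = (\<lambda>(k, i, j). if k = 3 then (True, e0) else (False, e0))"

end

(* The n-dimensional Klein bottle is the bundle over the circle with fibre (S^1)^(n-1) and monodromy
   complex conjugation. Conjugation makes each fibre circle the one-point compactification of the sign
   representation, and the section at 1 is fixed, so the circle factors can be split off one at a time after one
   suspension: in the square spanned by a circle coordinate and the suspension coordinate the attaching map runs
   along a path and back, hence contracts equivariantly, and "product with a circle" becomes the wedge of
   "forget the circle" and "smash with the circle". This leaves one summand for every set of i fibre circles,
   the suspended Thom space of i copies of the Moebius line bundle. It has a single cell of dimension i + 2
   attached to an (i+1)-sphere; the attaching map is the sum of the identity and the reflection of i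
   coordinates, up to sign. Rotating pairs of reflected coordinates back makes it null for even i and
   leaves a map of degree 2, never antipodal to the standard one, for odd i. All homotopy equivalences come from
   one principle, that homotopic attaching maps give equivalent spaces, applied to explicit homotopies. *)

theory Submission
  imports Defs
begin

text \<open>Adding one circle factor attaches not a cell but a whole family of squares, parametrized
  by the remaining coordinates, and the parameters are themselves subject to gluing and collapsing.
  Hence the principle on attaching maps is proved for families of cubes: \<open>E\<close> is the
  gluing of the base, \<open>R\<close> that of the open cubes, \<open>N\<close> the part collapsed
  to the base point, and a homotopy has to respect these only up to \<open>E\<close>. With equality
  for both relations and empty \<open>N\<close> the same principle handles the single top cells.
  Suspending first is essential: the contraction pushes the suspension coordinate to its lower end,
  where everything is one point. All spaces are presented as quotients of cubes, so homeomorphisms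
  reduce to comparing kernels. A circle is written as \<open>- cis (pi * t)\<close> with
  \<open>t\<close> between -1 and 1: its base point 1 sits at both ends and conjugation is negation
  of \<open>t\<close>. Of the last circle only a closed half is parametrized; the involution glues
  its two ends.\<close>

lemma quotient_map_quotient_top: "quotient_map X (quotient_top X q) q"
proof -
  have o: "openin (quotient_top X q) U \<longleftrightarrow> U \<subseteq> q ` topspace X \<and> openin X {x \<in> topspace X. q x \<in> U}" for U
    unfolding quotient_top_def using istopology_quotient_top[of q X] by (simp add: topology_inverse')
  have e: "{x \<in> topspace X. q x \<in> q ` topspace X} = topspace X" by blast
  have "topspace (quotient_top X q) = q ` topspace X"
    using o[of "q ` topspace X"] o[of "topspace (quotient_top X q)"]
    by (metis e openin_subset openin_topspace order_refl subset_antisym)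
  then show ?thesis
    unfolding quotient_map_def using o by auto
qed

subsection \<open>Pointed homotopy equivalence\<close>

text \<open>The homotopies, not only the maps, keep the base points: only then do equivalences of
  the summands glue to an equivalence of wedges.\<close>

definition ptd_equiv :: "'a topology \<Rightarrow> 'a \<Rightarrow> 'b topology \<Rightarrow> 'b \<Rightarrow> bool" where
  "ptd_equiv X x0 Y y0 \<longleftrightarrow> x0 \<in> topspace X \<and> y0 \<in> topspace Y \<and>
     (\<exists>f g. continuous_map X Y f \<and> continuous_map Y X g \<and> f x0 = y0 \<and> g y0 = x0 \<and>
        homotopic_with (\<lambda>h. h x0 = x0) X X (g \<circ> f) id \<and>
        homotopic_with (\<lambda>h. h y0 = y0) Y Y (f \<circ> g) id)"

lemma ptd_equiv_imp_homotopy_equivalent_space: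
  assumes "ptd_equiv X x0 Y y0"
  shows "X homotopy_equivalent_space Y"
proof -
  obtain f g where fg: "continuous_map X Y f" "continuous_map Y X g"
    "homotopic_with (\<lambda>h. h x0 = x0) X X (g \<circ> f) id" "homotopic_with (\<lambda>h. h y0 = y0) Y Y (f \<circ> g) id"
    using assms unfolding ptd_equiv_def by blast
  show ?thesis
    unfolding homotopy_equivalent_space_def
    by (intro exI[of _ f] exI[of _ g] conjI fg homotopic_with_mono[OF fg(3)] homotopic_with_mono[OF fg(4)] TrueI)
qed

lemma ptd_equiv_sym:
  assumes "ptd_equiv X x0 Y y0"
  shows "ptd_equiv Y y0 X x0"
proof -
  obtain f g where fg: "continuous_map X Y f" "continuous_map Y X g" "f x0 = y0" "g y0 = x0"
    "homotopic_with (\<lambda>h. h x0 = x0) X X (g \<circ> f) id" "homotopic_with (\<lambda>h. h y0 = y0) Y Y (f \<circ> g) id"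
    using assms unfolding ptd_equiv_def by blast
  show ?thesis
    unfolding ptd_equiv_def
    by (intro exI[of _ g] exI[of _ f] conjI fg) (use assms in \<open>simp_all add: ptd_equiv_def\<close>)
qed

lemma ptd_equiv_trans:
  assumes "ptd_equiv X x0 Y y0" "ptd_equiv Y y0 Z z0"
  shows "ptd_equiv X x0 Z z0"
proof -
  obtain f g where f: "continuous_map X Y f" and g: "continuous_map Y X g"
    and fg: "f x0 = y0" "g y0 = x0"
    and gf1: "homotopic_with (\<lambda>h. h x0 = x0) X X (g \<circ> f) id"
    and fg1: "homotopic_with (\<lambda>h. h y0 = y0) Y Y (f \<circ> g) id"
    using assms(1) unfolding ptd_equiv_def by blast
  obtain f' g' where f': "continuous_map Y Z f'" and g': "continuous_map Z Y g'"
    and fg': "f' y0 = z0" "g' z0 = y0"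
    and gf2: "homotopic_with (\<lambda>h. h y0 = y0) Y Y (g' \<circ> f') id"
    and fg2: "homotopic_with (\<lambda>h. h z0 = z0) Z Z (f' \<circ> g') id"
    using assms(2) unfolding ptd_equiv_def by blast
  have "homotopic_with (\<lambda>h. h x0 = y0) X Y (g' \<circ> f' \<circ> f) (id \<circ> f)"
    using homotopic_with_compose_continuous_map_right[OF gf2 f, where q = "\<lambda>h. h x0 = y0"]
    by (simp add: fg)
  then have "homotopic_with (\<lambda>h. h x0 = x0) X X (g \<circ> (g' \<circ> f' \<circ> f)) (g \<circ> (id \<circ> f))"
    using homotopic_with_compose_continuous_map_left[OF _ g, where q = "\<lambda>h. h x0 = x0" and p = "\<lambda>h. h x0 = y0"]
    by (simp add: fg)
  then have 1: "homotopic_with (\<lambda>h. h x0 = x0) X X ((g \<circ> g') \<circ> (f' \<circ> f)) id"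
    using homotopic_with_trans[OF _ gf1] by (metis comp_assoc id_comp)
  have "homotopic_with (\<lambda>h. h z0 = y0) Z Y (f \<circ> g \<circ> g') (id \<circ> g')"
    using homotopic_with_compose_continuous_map_right[OF fg1 g', where q = "\<lambda>h. h z0 = y0"]
    by (simp add: fg')
  then have "homotopic_with (\<lambda>h. h z0 = z0) Z Z (f' \<circ> (f \<circ> g \<circ> g')) (f' \<circ> (id \<circ> g'))"
    using homotopic_with_compose_continuous_map_left[OF _ f', where q = "\<lambda>h. h z0 = z0" and p = "\<lambda>h. h z0 = y0"]
    by (simp add: fg')
  then have 2: "homotopic_with (\<lambda>h. h z0 = z0) Z Z ((f' \<circ> f) \<circ> (g \<circ> g')) id"
    using homotopic_with_trans[OF _ fg2] by (metis comp_assoc id_comp)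
  show ?thesis
    using assms 1 2 continuous_map_compose[OF f f'] continuous_map_compose[OF g' g] fg fg'
    unfolding ptd_equiv_def
    by (intro conjI exI[of _ "f' \<circ> f"] exI[of _ "g \<circ> g'"]) simp_all
qed

text \<open>Each quotient map factors through the other. This is how differently built spaces are
  compared: present both as quotients of one cube and match the identifications.\<close>

lemma quotient_maps_same_kernel_ptd_equiv:
  assumes q: "quotient_map X Y q" and q': "quotient_map X Y' q'" and x0: "x0 \<in> topspace X"
    and ker: "\<And>x y. x \<in> topspace X \<Longrightarrow> y \<in> topspace X \<Longrightarrow> q x = q y \<longleftrightarrow> q' x = q' y"
  shows "ptd_equiv Y (q x0) Y' (q' x0)"
proof -
  obtain f where f: "continuous_map Y Y' f" "\<And>x. x \<in> topspace X \<Longrightarrow> f (q x) = q' x"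
    using quotient_map_lift_exists[OF q quotient_imp_continuous_map[OF q']] ker by metis
  obtain g where g: "continuous_map Y' Y g" "\<And>x. x \<in> topspace X \<Longrightarrow> g (q' x) = q x"
    using quotient_map_lift_exists[OF q' quotient_imp_continuous_map[OF q]] ker by metis
  have Y: "topspace Y = q ` topspace X" and Y': "topspace Y' = q' ` topspace X"
    using q q' by (simp_all add: quotient_imp_surjective_map)
  have "homotopic_with (\<lambda>h. h (q x0) = q x0) Y Y (g \<circ> f) id"
    using f g x0 Y continuous_map_compose[OF f(1) g(1)] by (intro homotopic_with_equal) auto
  moreover have "homotopic_with (\<lambda>h. h (q' x0) = q' x0) Y' Y' (f \<circ> g) id"
    using f g x0 Y' continuous_map_compose[OF g(1) f(1)] by (intro homotopic_with_equal) auto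
  ultimately show ?thesis
    using f g x0 Y Y' unfolding ptd_equiv_def by (metis imageI)
qed

lemma homotopic_with_fixI:
  assumes "continuous_map (prod_topology (top_of_set {0..1::real}) X) Y h" "x0 \<in> topspace X"
    and "\<And>x. x \<in> topspace X \<Longrightarrow> h (0, x) = p x" "\<And>x. x \<in> topspace X \<Longrightarrow> h (1, x) = q x"
    and "\<And>t. t \<in> {0..1} \<Longrightarrow> h (t, x0) = y0"
  shows "homotopic_with (\<lambda>h. h x0 = y0) X Y p q"
  using assms by (subst homotopic_with) auto

subsection \<open>Final topologies\<close>

text \<open>The common feature of wedges and of spaces with cells attached. Maps and homotopies out
  of either are assembled from pieces by the two lemmas that follow.\<close>

definition final_maps :: "'z topology \<Rightarrow> 'k set \<Rightarrow> ('k \<Rightarrow> 'a topology) \<Rightarrow> ('k \<Rightarrow> 'a \<Rightarrow> 'z) \<Rightarrow> bool" where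
  "final_maps Z K X g \<longleftrightarrow> (\<forall>k\<in>K. continuous_map (X k) Z (g k)) \<and>
     topspace Z = (\<Union>k\<in>K. g k ` topspace (X k)) \<and>
     (\<forall>U \<subseteq> topspace Z. (\<forall>k\<in>K. openin (X k) {x \<in> topspace (X k). g k x \<in> U}) \<longrightarrow> openin Z U)"

lemma final_maps_continuous:
  assumes f: "final_maps Z K X g" and c: "\<And>k. k \<in> K \<Longrightarrow> continuous_map (X k) Y (\<lambda>x. h (g k x))"
  shows "continuous_map Z Y h"
  unfolding continuous_map_def
proof (intro conjI allI impI)
  show "h \<in> topspace Z \<rightarrow> topspace Y"
  proof
    fix z assume "z \<in> topspace Z"
    then obtain k x where k: "k \<in> K" "x \<in> topspace (X k)" "z = g k x"
      using f unfolding final_maps_def by auto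
    then show "h z \<in> topspace Y"
      using continuous_map_image_subset_topspace[OF c[OF k(1)]] by blast
  qed
  fix V assume V: "openin Y V"
  have "openin (X k) {x \<in> topspace (X k). g k x \<in> {z \<in> topspace Z. h z \<in> V}}" if k: "k \<in> K" for k
  proof -
    have "{x \<in> topspace (X k). g k x \<in> {z \<in> topspace Z. h z \<in> V}} = {x \<in> topspace (X k). h (g k x) \<in> V}"
      using f k unfolding final_maps_def by blast
    then show ?thesis using c[OF k] V by (simp add: continuous_map_def)
  qed
  moreover have "{z \<in> topspace Z. h z \<in> V} \<subseteq> topspace Z" by blast
  ultimately show "openin Z {z \<in> topspace Z. h z \<in> V}"
    using f unfolding final_maps_def by blast
qed

text \<open>Products with the unit interval preserve final topologies because the interval is locally compact.\<close>

lemma final_maps_homotopy: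
  fixes Z :: "'z topology"
  assumes f: "final_maps Z K X g"
    and c: "\<And>k. k \<in> K \<Longrightarrow>
      continuous_map (prod_topology (top_of_set {0..1::real}) (X k)) Y (\<lambda>(s, x). h (s, g k x))"
  shows "continuous_map (prod_topology (top_of_set {0..1::real}) Z) Y h"
proof -
  let ?I = "top_of_set {0..1::real}"
  have top: "topspace Z = (\<Union>k\<in>K. g k ` topspace (X k))"
    using f by (simp add: final_maps_def)
  \<comment> \<open>For compact \<open>L\<close> the tube lemma makes this set open in each piece,
    hence in \<open>Z\<close>. Local compactness enters below, where a small closed interval around
    \<open>s\<close> serves as \<open>L\<close>.\<close>
  have tube: "openin Z {z \<in> topspace Z. \<forall>s\<in>L. h (s, z) \<in> V}"
    if L: "compactin ?I L" and V: "openin Y V" for L V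
  proof -
    have "openin (X k) {x \<in> topspace (X k). g k x \<in> {z \<in> topspace Z. \<forall>s\<in>L. h (s, z) \<in> V}}"
      if k: "k \<in> K" for k
    proof (subst openin_subopen, intro ballI)
      let ?S = "{x \<in> topspace (X k). g k x \<in> {z \<in> topspace Z. \<forall>s\<in>L. h (s, z) \<in> V}}"
      let ?W = "{p \<in> topspace (prod_topology ?I (X k)). (\<lambda>(s, x). h (s, g k x)) p \<in> V}"
      fix x assume x: "x \<in> ?S"
      have W: "openin (prod_topology ?I (X k)) ?W"
        using c[OF k] V by (rule openin_continuous_map_preimage)
      have "L \<times> {x} \<subseteq> ?W"
        using x compactin_subset_topspace[OF L] by auto
      then obtain A B where AB: "openin (X k) B" "L \<subseteq> A" "x \<in> B" "A \<times> B \<subseteq> ?W"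
        using tube_lemma_left[OF W L _, of x] x by auto
      have "B \<subseteq> ?S"
      proof
        fix y assume y: "y \<in> B"
        have "y \<in> topspace (X k)" using AB y openin_subset by blast
        moreover have "h (s, g k y) \<in> V" if "s \<in> L" for s
        proof -
          have "(s, y) \<in> A \<times> B" using AB(2) y that by blast
          then have "(s, y) \<in> ?W" by (rule subsetD[OF AB(4)])
          then show ?thesis by simp
        qed
        ultimately show "y \<in> ?S" using top k by blast
      qed
      then show "\<exists>T. openin (X k) T \<and> x \<in> T \<and> T \<subseteq> ?S" using AB by blast
    qed
    moreover have "{z \<in> topspace Z. \<forall>s\<in>L. h (s, z) \<in> V} \<subseteq> topspace Z" by blast
    ultimately show ?thesis
      using f unfolding final_maps_def by blast
  qed
  show ?thesis
    unfolding continuous_map_def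
  proof (intro conjI allI impI)
    show "h \<in> topspace (prod_topology ?I Z) \<rightarrow> topspace Y"
    proof
      fix p assume "p \<in> topspace (prod_topology ?I Z)"
      then obtain s k x where p: "p = (s, g k x)" "s \<in> {0..1}" "k \<in> K" "x \<in> topspace (X k)"
        using top by auto
      then show "h p \<in> topspace Y"
        using continuous_map_image_subset_topspace[OF c[OF p(3)]] p
        by (simp add: image_subset_iff)
    qed
    fix V assume V: "openin Y V"
    show "openin (prod_topology ?I Z) {p \<in> topspace (prod_topology ?I Z). h p \<in> V}"
      unfolding openin_prod_topology_alt
    proof (intro allI impI)
      fix s z assume "(s, z) \<in> {p \<in> topspace (prod_topology ?I Z). h p \<in> V}"
      then have s: "s \<in> {0..1}" and z: "z \<in> topspace Z" and hV: "h (s, z) \<in> V" by auto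
      obtain k x where k: "k \<in> K" "x \<in> topspace (X k)" "z = g k x"
        using z top by auto
      have "continuous_map ?I Y ((\<lambda>(s, x). h (s, g k x)) \<circ> (\<lambda>s. (s, x)))"
        by (rule continuous_map_compose[OF _ c[OF k(1)]]) (use k(2) in \<open>auto simp: continuous_map_pairwise o_def\<close>)
      from openin_continuous_map_preimage[OF this V]
      have "openin ?I {r \<in> topspace ?I. h (r, z) \<in> V}"
        by (simp add: o_def k(3))
      then obtain e where e: "e > 0" "cball s e \<inter> {0..1} \<subseteq> {r \<in> topspace ?I. h (r, z) \<in> V}"
        using s hV unfolding openin_contains_cball by (metis (no_types, lifting) mem_Collect_eq topspace_euclidean_subtopology)
      let ?L = "cball s e \<inter> {0..1::real}"
      have L: "compactin ?I ?L"
        by (simp add: compactin_subtopology compact_Int_closed)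
      let ?W = "{z \<in> topspace Z. \<forall>s\<in>?L. h (s, z) \<in> V}"
      show "\<exists>A B. openin ?I A \<and> openin Z B \<and> s \<in> A \<and> z \<in> B \<and>
              A \<times> B \<subseteq> {p \<in> topspace (prod_topology ?I Z). h p \<in> V}"
      proof (intro exI conjI)
        show "openin ?I (ball s e \<inter> {0..1})"
          using openin_open_Int[OF open_ball, of "{0..1}" s e] by (metis Int_commute)
        show "openin Z ?W" by (rule tube[OF L V])
        show "s \<in> ball s e \<inter> {0..1}" using e s by simp
        have "h (r, z) \<in> V" if "r \<in> ?L" for r
          using e(2) that by blast
        then show "z \<in> ?W" using z by blast
        show "(ball s e \<inter> {0..1}) \<times> ?W \<subseteq> {p \<in> topspace (prod_topology ?I Z). h p \<in> V}"
        proof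
          fix p assume "p \<in> (ball s e \<inter> {0..1}) \<times> ?W"
          then obtain r w where p: "p = (r, w)" "r \<in> ball s e \<inter> {0..1}" "w \<in> ?W" by blast
          moreover have "r \<in> ?L" using p(2) by (simp add: less_imp_le)
          ultimately have "h p \<in> V" by blast
          then show "p \<in> {p \<in> topspace (prod_topology ?I Z). h p \<in> V}" using p by simp
        qed
      qed
    qed
  qed
qed

subsection \<open>Wedges\<close>

definition wtag :: "('i \<Rightarrow> 'a) \<Rightarrow> 'i \<Rightarrow> 'a \<Rightarrow> ('i \<times> 'a) option" where
  "wtag b i y = (if y = b i then None else Some (i, y))"

lemma wtag_base [simp]: "wtag b i (b i) = None"
  by (simp add: wtag_def)

lemma wtag_eq_None [simp]: "wtag b i y = None \<longleftrightarrow> y = b i"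
  by (simp add: wtag_def)

lemma wtag_inject [simp]: "wtag b i x = wtag b i y \<longleftrightarrow> x = y"
  by (auto simp: wtag_def)

lemma wtag_eq_wtag: "i \<noteq> j \<Longrightarrow> wtag b i x = wtag b j y \<longleftrightarrow> x = b i \<and> y = b j"
  by (auto simp: wtag_def)

lemma quotient_map_wedge:
  "quotient_map (sum_topology Y I) (wedge I Y b) (\<lambda>(i, y). wtag b i y)"
  unfolding wedge_def wtag_def by (rule quotient_map_quotient_top)

lemma final_maps_wedge: "final_maps (wedge I Y b) I Y (wtag b)"
  unfolding final_maps_def
proof (intro conjI ballI allI impI)
  let ?q = "\<lambda>(i, y). wtag b i y"
  have q: "quotient_map (sum_topology Y I) (wedge I Y b) ?q" by (rule quotient_map_wedge)
  have "topspace (wedge I Y b) = ?q ` Sigma I (topspace \<circ> Y)"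
    using quotient_imp_surjective_map[OF q] by simp
  also have "\<dots> = (\<Union>k\<in>I. wtag b k ` topspace (Y k))"
    by (auto simp: image_iff)
  finally show top: "topspace (wedge I Y b) = (\<Union>k\<in>I. wtag b k ` topspace (Y k))" .
  have ope: "openin (wedge I Y b) U \<longleftrightarrow> (\<forall>k\<in>I. openin (Y k) {x \<in> topspace (Y k). wtag b k x \<in> U})"
    if U: "U \<subseteq> topspace (wedge I Y b)" for U
  proof -
    have "{x. (k, x) \<in> {p \<in> topspace (sum_topology Y I). ?q p \<in> U}} = {x \<in> topspace (Y k). wtag b k x \<in> U}"
      if "k \<in> I" for k
      using that by auto
    moreover have "openin (wedge I Y b) U \<longleftrightarrow>
        openin (sum_topology Y I) {p \<in> topspace (sum_topology Y I). ?q p \<in> U}"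
      using q U unfolding quotient_map_def by (metis (no_types, lifting))
    ultimately show ?thesis
      unfolding openin_sum_topology by auto
  qed
  show "continuous_map (Y k) (wedge I Y b) (wtag b k)" if k: "k \<in> I" for k
    unfolding continuous_map_def
  proof (intro conjI allI impI)
    show "wtag b k \<in> topspace (Y k) \<rightarrow> topspace (wedge I Y b)"
      unfolding top using k by (intro Pi_I UN_I[OF k] imageI)
    fix U assume U: "openin (wedge I Y b) U"
    show "openin (Y k) {x \<in> topspace (Y k). wtag b k x \<in> U}"
      using ope[OF openin_subset[OF U]] U k by simp
  qed
  show "openin (wedge I Y b) U" if "U \<subseteq> topspace (wedge I Y b)"
    "\<forall>k\<in>I. openin (Y k) {x \<in> topspace (Y k). wtag b k x \<in> U}" for U
    using ope that by simp
qed

lemma topspace_wedge: "topspace (wedge I Y b) = (\<Union>k\<in>I. wtag b k ` topspace (Y k))"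
  using final_maps_wedge[of I Y b] unfolding final_maps_def by blast

lemma continuous_map_wtag: "k \<in> I \<Longrightarrow> continuous_map (Y k) (wedge I Y b) (wtag b k)"
  using final_maps_wedge[of I Y b] unfolding final_maps_def by blast

lemma None_in_wedge: "k \<in> I \<Longrightarrow> b k \<in> topspace (Y k) \<Longrightarrow> None \<in> topspace (wedge I Y b)"
  unfolding topspace_wedge by (metis UN_I image_eqI wtag_base)

lemma ptd_equiv_wedge_singleton:
  assumes "b k \<in> topspace (Y k)"
  shows "ptd_equiv (Y k) (b k) (wedge {k} Y b) None"
proof -
  have q: "quotient_map (Y k) (wedge {k} Y b) (wtag b k)"
  proof (unfold quotient_map_def, intro conjI allI impI)
    have f: "final_maps (wedge {k} Y b) {k} Y (wtag b)" by (rule final_maps_wedge)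
    show "wtag b k ` topspace (Y k) = topspace (wedge {k} Y b)"
      by (simp add: topspace_wedge)
    fix U assume U: "U \<subseteq> topspace (wedge {k} Y b)"
    have "openin (Y k) {x \<in> topspace (Y k). wtag b k x \<in> U}" if "openin (wedge {k} Y b) U"
      using openin_continuous_map_preimage[OF continuous_map_wtag that] by simp
    moreover have "openin (wedge {k} Y b) U" if "openin (Y k) {x \<in> topspace (Y k). wtag b k x \<in> U}"
      using f U that unfolding final_maps_def by simp
    ultimately show "openin (Y k) {x \<in> topspace (Y k). wtag b k x \<in> U} = openin (wedge {k} Y b) U"
      by blast
  qed
  have "quotient_map (Y k) (Y k) id"
    unfolding quotient_map_def
  proof (intro conjI allI impI)
    fix U assume "U \<subseteq> topspace (Y k)"
    then have "{x \<in> topspace (Y k). id x \<in> U} = U" by auto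
    then show "openin (Y k) {x \<in> topspace (Y k). id x \<in> U} = openin (Y k) U" by simp
  qed simp
  from quotient_maps_same_kernel_ptd_equiv[OF this q assms] show ?thesis by simp
qed

text \<open>The pointed maps and homotopies of the summands agree at the common base point, so they
  glue, and a nested wedge flattens. Both the induction over the circle factors and the final
  regrouping rest on this.\<close>

lemma wedge_of_wedges:
  fixes X :: "'i \<Rightarrow> 'a topology" and Y :: "'k \<Rightarrow> 'b topology"
  assumes ne: "I \<noteq> {}"
    and eq: "\<And>i. i \<in> I \<Longrightarrow> ptd_equiv (X i) (x i) (wedge (J i) Y b) None"
    and disj: "\<And>i j k. i \<in> I \<Longrightarrow> j \<in> I \<Longrightarrow> k \<in> J i \<Longrightarrow> k \<in> J j \<Longrightarrow> i = j"
    and K: "K = (\<Union>i\<in>I. J i)"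
  shows "ptd_equiv (wedge I X x) None (wedge K Y b) None"
proof -
  let ?T = "top_of_set {0..1::real}"
  let ?W = "\<lambda>i. wedge (J i) Y b"
  \<comment> \<open>All data needed for one index in a single predicate, so that one choice provides
    maps and homotopies for all indices together.\<close>
  define R where "R i f g h h' \<longleftrightarrow> continuous_map (X i) (?W i) f \<and> continuous_map (?W i) (X i) g \<and>
      f (x i) = None \<and> g None = x i \<and>
      continuous_map (prod_topology ?T (X i)) (X i) h \<and> (\<forall>y. h (0, y) = g (f y)) \<and>
      (\<forall>y. h (1, y) = y) \<and> (\<forall>t\<in>{0..1}. h (t, x i) = x i) \<and>
      continuous_map (prod_topology ?T (?W i)) (?W i) h' \<and> (\<forall>y. h' (0, y) = f (g y)) \<and>
      (\<forall>y. h' (1, y) = y) \<and> (\<forall>t\<in>{0..1}. h' (t, None) = None)" for i f g h h'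
  have "\<exists>f g h h'. R i f g h h'" if i: "i \<in> I" for i
  proof -
    obtain f g where f: "continuous_map (X i) (?W i) f" and g: "continuous_map (?W i) (X i) g"
      and fg: "f (x i) = None" "g None = x i"
      and gf: "homotopic_with (\<lambda>h. h (x i) = x i) (X i) (X i) (g \<circ> f) id"
      and fg': "homotopic_with (\<lambda>h. h None = None) (?W i) (?W i) (f \<circ> g) id"
      using eq[OF i] unfolding ptd_equiv_def by blast
    obtain h where h: "continuous_map (prod_topology ?T (X i)) (X i) h" "\<forall>y. h (0, y) = (g \<circ> f) y"
        "\<forall>y. h (1, y) = id y" "\<forall>t\<in>{0..1}. h (t, x i) = x i"
      using gf unfolding homotopic_with_def by blast
    obtain h' where h': "continuous_map (prod_topology ?T (?W i)) (?W i) h'" "\<forall>y. h' (0, y) = (f \<circ> g) y"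
        "\<forall>y. h' (1, y) = id y" "\<forall>t\<in>{0..1}. h' (t, None) = None"
      using fg' unfolding homotopic_with_def by blast
    have "R i f g h h'" unfolding R_def using f g fg h h' by simp
    then show ?thesis by blast
  qed
  then obtain f g h h' where R: "\<And>i. i \<in> I \<Longrightarrow> R i (f i) (g i) (h i) (h' i)"
    by metis
  have
    f: "\<And>i. i \<in> I \<Longrightarrow> continuous_map (X i) (?W i) (f i)"
    and g: "\<And>i. i \<in> I \<Longrightarrow> continuous_map (?W i) (X i) (g i)"
    and f0: "\<And>i. i \<in> I \<Longrightarrow> f i (x i) = None" and g0: "\<And>i. i \<in> I \<Longrightarrow> g i None = x i"
    and h: "\<And>i. i \<in> I \<Longrightarrow> continuous_map (prod_topology ?T (X i)) (X i) (h i)"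
    and h0: "\<And>i y. i \<in> I \<Longrightarrow> h i (0, y) = g i (f i y)" and h1: "\<And>i y. i \<in> I \<Longrightarrow> h i (1, y) = y"
    and hx: "\<And>i t. i \<in> I \<Longrightarrow> t \<in> {0..1} \<Longrightarrow> h i (t, x i) = x i"
    and h': "\<And>i. i \<in> I \<Longrightarrow> continuous_map (prod_topology ?T (?W i)) (?W i) (h' i)"
    and h'0: "\<And>i y. i \<in> I \<Longrightarrow> h' i (0, y) = f i (g i y)" and h'1: "\<And>i y. i \<in> I \<Longrightarrow> h' i (1, y) = y"
    and h'x: "\<And>i t. i \<in> I \<Longrightarrow> t \<in> {0..1} \<Longrightarrow> h' i (t, None) = None"
    using R unfolding R_def by blast+
  define F where "F w = (case w of None \<Rightarrow> None | Some (i, y) \<Rightarrow> f i y)" for w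
  \<comment> \<open>The outer summand to which an inner index belongs, unique by
    disjointness.\<close>
  define \<iota> where "\<iota> k = (THE i. i \<in> I \<and> k \<in> J i)" for k
  have \<iota>: "\<iota> k = i" if "i \<in> I" "k \<in> J i" for i k
    unfolding \<iota>_def using that by (intro the_equality conjI) (auto intro: disj)
  have \<iota>K: "\<iota> k \<in> I" "k \<in> J (\<iota> k)" if k: "k \<in> K" for k
  proof -
    obtain i where "i \<in> I" "k \<in> J i" using k K by blast
    then show "\<iota> k \<in> I" "k \<in> J (\<iota> k)" using \<iota> by simp_all
  qed
  define G where "G w = (case w of None \<Rightarrow> None | Some (k, y) \<Rightarrow> wtag x (\<iota> k) (g (\<iota> k) (Some (k, y))))" for w
  define H where "H = (\<lambda>(t, w). case w of None \<Rightarrow> None | Some (i, y) \<Rightarrow> wtag x i (h i (t, y)))"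
  define H' where "H' = (\<lambda>(t, w). case w of None \<Rightarrow> None | Some (k, y) \<Rightarrow> h' (\<iota> k) (t, Some (k, y)))"
  \<comment> \<open>Both wedges tag a point by its inner index alone, so the inclusion is the
    identity on carriers.\<close>
  have incl: "continuous_map (?W i) (wedge K Y b) (\<lambda>w. w)" if "i \<in> I" for i
  proof (rule final_maps_continuous[OF final_maps_wedge])
    fix k assume "k \<in> J i"
    then have "k \<in> K" using that K by blast
    then show "continuous_map (Y k) (wedge K Y b) (wtag b k)" by (rule continuous_map_wtag)
  qed
  have Ft: "F (wtag x i y) = f i y" if "i \<in> I" for i y
    using that f0 by (auto simp: F_def wtag_def)
  have Gt: "G (wtag b k y) = wtag x (\<iota> k) (g (\<iota> k) (wtag b k y))" if "k \<in> K" for k y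
    using g0[OF \<iota>K(1)[OF that]] by (auto simp: G_def wtag_def)
  have Ht: "H (t, wtag x i y) = wtag x i (h i (t, y))" if "i \<in> I" "t \<in> {0..1}" for t i y
    using that hx by (auto simp: H_def wtag_def)
  have H't: "H' (t, wtag b k y) = h' (\<iota> k) (t, wtag b k y)" if "k \<in> K" "t \<in> {0..1}" for t k y
    using that h'x \<iota>K by (auto simp: H'_def wtag_def)
  have F: "continuous_map (wedge I X x) (wedge K Y b) F"
  proof (rule final_maps_continuous[OF final_maps_wedge])
    fix i assume i: "i \<in> I"
    show "continuous_map (X i) (wedge K Y b) (\<lambda>y. F (wtag x i y))"
      using continuous_map_compose[OF f[OF i] incl[OF i]] i by (simp add: Ft o_def)
  qed
  have G: "continuous_map (wedge K Y b) (wedge I X x) G"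
  proof (rule final_maps_continuous[OF final_maps_wedge])
    fix k assume k: "k \<in> K"
    note i = \<iota>K[OF k]
    show "continuous_map (Y k) (wedge I X x) (\<lambda>y. G (wtag b k y))"
      using continuous_map_compose[OF continuous_map_compose[OF continuous_map_wtag[OF i(2), of Y b] g[OF i(1)]]
         continuous_map_wtag[OF i(1), of X x]] k by (simp add: Gt o_def)
  qed
  have H: "continuous_map (prod_topology ?T (wedge I X x)) (wedge I X x) H"
  proof (rule final_maps_homotopy[OF final_maps_wedge])
    fix i assume i: "i \<in> I"
    show "continuous_map (prod_topology ?T (X i)) (wedge I X x) (\<lambda>(s, y). H (s, wtag x i y))"
      by (rule continuous_map_eq[OF continuous_map_compose[OF h[OF i] continuous_map_wtag[OF i, of X x]]])
         (use i in \<open>auto simp: Ht\<close>)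
  qed
  have H': "continuous_map (prod_topology ?T (wedge K Y b)) (wedge K Y b) H'"
  proof (rule final_maps_homotopy[OF final_maps_wedge])
    fix k assume k: "k \<in> K"
    note i = \<iota>K[OF k]
    have "continuous_map (prod_topology ?T (Y k)) (prod_topology ?T (?W (\<iota> k))) (\<lambda>(s, y). (s, wtag b k y))"
      unfolding continuous_map_pairwise o_def case_prod_unfold fst_conv snd_conv
      by (intro conjI continuous_map_fst continuous_map_compose[OF continuous_map_snd continuous_map_wtag[OF i(2), of Y b], unfolded o_def])
    then show "continuous_map (prod_topology ?T (Y k)) (wedge K Y b) (\<lambda>(s, y). H' (s, wtag b k y))"
      by (rule continuous_map_eq[OF continuous_map_compose[OF continuous_map_compose[OF _ h'[OF i(1)]] incl[OF i(1)]]])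
         (use k in \<open>auto simp: H't\<close>)
  qed
  have NX: "None \<in> topspace (wedge I X x)"
  proof -
    obtain i where i: "i \<in> I" using ne by blast
    then have "x i \<in> topspace (X i)" using eq[OF i] by (simp add: ptd_equiv_def)
    then show ?thesis by (rule None_in_wedge[OF i])
  qed
  have NY: "None \<in> topspace (wedge K Y b)"
    using imageI[OF NX, of F] continuous_map_image_subset_topspace[OF F] by (auto simp: F_def)
  have "homotopic_with (\<lambda>h. h None = None) (wedge I X x) (wedge I X x) (G \<circ> F) id"
  proof (rule homotopic_with_fixI[OF H NX])
    fix w assume "w \<in> topspace (wedge I X x)"
    then obtain i y where w: "i \<in> I" "y \<in> topspace (X i)" "w = wtag x i y"
      by (auto simp: topspace_wedge)
    show "H (1, w) = id w" using w by (simp add: Ht h1)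
    have "f i y \<in> topspace (?W i)"
      using continuous_map_image_subset_topspace[OF f[OF w(1)]] w by blast
    then obtain k y' where k: "k \<in> J i" "f i y = wtag b k y'"
      by (auto simp: topspace_wedge)
    then have "k \<in> K" using w K by blast
    then show "H (0, w) = (G \<circ> F) w" using w k \<iota> by (simp add: Ht Ft Gt h0)
  qed (auto simp: H_def)
  moreover have "homotopic_with (\<lambda>h. h None = None) (wedge K Y b) (wedge K Y b) (F \<circ> G) id"
  proof (rule homotopic_with_fixI[OF H' NY])
    fix w assume "w \<in> topspace (wedge K Y b)"
    then obtain k y where w: "k \<in> K" "y \<in> topspace (Y k)" "w = wtag b k y"
      by (auto simp: topspace_wedge)
    show "H' (1, w) = id w" using w \<iota>K by (simp add: H't h'1)
    show "H' (0, w) = (F \<circ> G) w" using w \<iota>K by (simp add: H't Ft Gt h'0)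
  qed (auto simp: H'_def)
  ultimately show ?thesis
    using F G NX NY unfolding ptd_equiv_def
    by (intro conjI exI[of _ F] exI[of _ G]) (auto simp: F_def G_def)
qed

subsection \<open>Homotopic attaching maps\<close>

lemma continuous_on_coord:
  fixes f :: "'a::topological_space \<Rightarrow> nat \<Rightarrow> real"
  shows "continuous_on S f \<Longrightarrow> continuous_on S (\<lambda>x. f x i)"
  by (rule continuous_on_product_then_coordinatewise)

lemma continuous_map_comp_on:
  assumes "continuous_map (top_of_set A) Z i" "continuous_on S g" "\<And>p. p \<in> S \<Longrightarrow> g p \<in> A"
  shows "continuous_map (top_of_set S) Z (\<lambda>p. i (g p))"
proof -
  have "continuous_map (top_of_set S) (top_of_set A) g"
    using assms by (simp add: image_subset_iff_funcset Pi_I)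
  from continuous_map_compose[OF this assms(1)] show ?thesis by (simp add: o_def)
qed

lemma continuous_map_cases_le_on:
  fixes p q :: "'a::topological_space \<Rightarrow> real"
  assumes p: "continuous_on S p" and q: "continuous_on S q"
    and f: "continuous_map (top_of_set {x \<in> S. p x \<le> q x}) Y f"
    and g: "continuous_map (top_of_set {x \<in> S. q x \<le> p x}) Y g"
    and fg: "\<And>x. x \<in> S \<Longrightarrow> p x = q x \<Longrightarrow> f x = g x"
  shows "continuous_map (top_of_set S) Y (\<lambda>x. if p x \<le> q x then f x else g x)"
proof (rule continuous_map_cases_le)
  show "continuous_map (top_of_set S) euclideanreal p" "continuous_map (top_of_set S) euclideanreal q"
    using p q by simp_all
  have "S \<inter> {x \<in> S. P x} = {x \<in> S. P x}" for P by blast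
  then show "continuous_map (subtopology (top_of_set S) {x \<in> topspace (top_of_set S). p x \<le> q x}) Y f"
    "continuous_map (subtopology (top_of_set S) {x \<in> topspace (top_of_set S). q x \<le> p x}) Y g"
    using f g by (simp_all add: subtopology_subtopology)
qed (use fg in simp)

section \<open>Polar coordinates on cubes: radius and radial scaling\<close>

definition maxabs :: "nat set \<Rightarrow> (nat \<Rightarrow> real) \<Rightarrow> real" where
  "maxabs G z = Max ((\<lambda>i. \<bar>z i\<bar>) ` G)"

text \<open>Only the cube directions are scaled; the other coordinates are parameters of the family
  and stay fixed.\<close>

definition dilate :: "nat set \<Rightarrow> real \<Rightarrow> (nat \<Rightarrow> real) \<Rightarrow> nat \<Rightarrow> real" where
  "dilate G r z = (\<lambda>i. if i \<in> G then r * z i else z i)"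

lemma maxabs_le_iff: "finite G \<Longrightarrow> G \<noteq> {} \<Longrightarrow> maxabs G z \<le> c \<longleftrightarrow> (\<forall>i\<in>G. \<bar>z i\<bar> \<le> c)"
  by (simp add: maxabs_def)

lemma maxabs_less_iff: "finite G \<Longrightarrow> G \<noteq> {} \<Longrightarrow> maxabs G z < c \<longleftrightarrow> (\<forall>i\<in>G. \<bar>z i\<bar> < c)"
  by (simp add: maxabs_def)

lemma abs_le_maxabs: "finite G \<Longrightarrow> i \<in> G \<Longrightarrow> \<bar>z i\<bar> \<le> maxabs G z"
  by (simp add: maxabs_def)

lemma maxabs_attained: "finite G \<Longrightarrow> G \<noteq> {} \<Longrightarrow> \<exists>i\<in>G. maxabs G z = \<bar>z i\<bar>"
  unfolding maxabs_def by (metis (no_types, lifting) Max_in finite_imageI image_iff image_is_empty)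

lemma maxabs_nonneg: "finite G \<Longrightarrow> G \<noteq> {} \<Longrightarrow> 0 \<le> maxabs G z"
  by (metis maxabs_attained abs_ge_zero)

lemma maxabs_insert: "finite G \<Longrightarrow> G \<noteq> {} \<Longrightarrow> maxabs (insert i G) z = max \<bar>z i\<bar> (maxabs G z)"
  by (simp add: maxabs_def)

lemma maxabs_dilate:
  assumes "finite G" "G \<noteq> {}" "0 \<le> r"
  shows "maxabs G (dilate G r z) = r * maxabs G z"
proof (rule antisym)
  show "maxabs G (dilate G r z) \<le> r * maxabs G z"
    using assms by (simp add: maxabs_le_iff dilate_def abs_mult abs_le_maxabs mult_left_mono)
  obtain i where "i \<in> G" "maxabs G z = \<bar>z i\<bar>" using maxabs_attained assms by blast
  then have "r * maxabs G z = \<bar>dilate G r z i\<bar>" using assms by (simp add: dilate_def abs_mult)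
  then show "r * maxabs G z \<le> maxabs G (dilate G r z)"
    using abs_le_maxabs[OF assms(1) \<open>i \<in> G\<close>] by metis
qed

lemma dilate_dilate: "dilate G r (dilate G s z) = dilate G (r * s) z"
  by (auto simp: dilate_def)

lemma dilate_1 [simp]: "dilate G 1 z = z"
  by (auto simp: dilate_def)

lemma continuous_on_maxabs [continuous_intros]:
  assumes "finite G" "G \<noteq> {}" "continuous_on S f"
  shows "continuous_on S (\<lambda>x. maxabs G (f x))"
  using assms(1,2)
proof (induction G rule: finite_ne_induct)
  case (singleton i)
  then show ?case using assms(3) by (simp add: maxabs_def continuous_on_coord continuous_on_rabs)
next
  case (insert i G)
  then show ?case using assms(3) by (simp add: maxabs_insert continuous_on_coord continuous_on_rabs continuous_on_max)
qed

lemma continuous_on_dilate [continuous_intros]: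
  assumes "continuous_on S r" "continuous_on S f"
  shows "continuous_on S (\<lambda>x. dilate G (r x) (f x))"
proof (rule continuous_on_coordinatewise_then_product)
  fix i show "continuous_on S (\<lambda>x. dilate G (r x) (f x) i)"
    using assms by (cases "i \<in> G") (simp_all add: dilate_def continuous_on_coord continuous_on_mult)
qed

text \<open>A space obtained from \<open>A\<close> (modulo \<open>E\<close>) by attaching the family \<open>C\<close> of cubes in the coordinates \<open>G\<close>
  along its boundary \<open>rim\<close>: points off the rim are identified through \<open>R\<close>, except that \<open>N\<close> is collapsed to
  the base point \<open>b0\<close>.\<close>

locale cubes =
  fixes C A :: "(nat \<Rightarrow> real) set" and G :: "nat set"
    and E R :: "(nat \<Rightarrow> real) \<Rightarrow> (nat \<Rightarrow> real) \<Rightarrow> bool" and N :: "(nat \<Rightarrow> real) set" and b0 :: "nat \<Rightarrow> real"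
  assumes finite_G: "finite G" and G_ne: "G \<noteq> {}"
    and C_le: "z \<in> C \<Longrightarrow> maxabs G z \<le> 1"
    and dilate_C: "z \<in> C \<Longrightarrow> 0 \<le> r \<Longrightarrow> r * maxabs G z \<le> 1 \<Longrightarrow> dilate G r z \<in> C"
    and b0_A: "b0 \<in> A"
    and R_maxabs: "z \<in> C \<Longrightarrow> z' \<in> C \<Longrightarrow> maxabs G z < 1 \<Longrightarrow> maxabs G z' < 1 \<Longrightarrow> R z z' \<Longrightarrow> maxabs G z = maxabs G z'"
    and R_dilate: "z \<in> C \<Longrightarrow> z' \<in> C \<Longrightarrow> maxabs G z < 1 \<Longrightarrow> maxabs G z' < 1 \<Longrightarrow> R z z' \<Longrightarrow> 0 < r \<Longrightarrow>
          r * maxabs G z < 1 \<Longrightarrow> R (dilate G r z) (dilate G r z')"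
    and N_dilate: "z \<in> C \<Longrightarrow> maxabs G z < 1 \<Longrightarrow> z \<in> N \<Longrightarrow> 0 < r \<Longrightarrow> r * maxabs G z < 1 \<Longrightarrow> dilate G r z \<in> N"
begin

abbreviation \<mu> where "\<mu> \<equiv> maxabs G"

definition rim where "rim = {z \<in> C. \<mu> z = 1}"

abbreviation \<pi> where "\<pi> z \<equiv> dilate G (1 / \<mu> z) z"

text \<open>\<open>j\<close> is the characteristic map of the cubes, \<open>i\<close> the inclusion
  of the base, \<open>f\<close> the attaching map. The last three clauses give the kernel on the
  base and on the open cubes; on the rim it follows from \<open>f\<close>. So \<open>f\<close>
  determines the space up to homeomorphism.\<close>

definition attached :: "'z topology \<Rightarrow> ((nat \<Rightarrow> real) \<Rightarrow> 'z) \<Rightarrow> ((nat \<Rightarrow> real) \<Rightarrow> 'z) \<Rightarrow> ((nat \<Rightarrow> real) \<Rightarrow> nat \<Rightarrow> real) \<Rightarrow> bool" where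
  "attached Z j i f \<longleftrightarrow>
     final_maps Z UNIV (\<lambda>k. if k then top_of_set C else top_of_set A) (\<lambda>k. if k then j else i) \<and>
     (\<forall>d\<in>rim. f d \<in> A \<and> j d = i (f d)) \<and>
     (\<forall>x\<in>A. \<forall>y\<in>A. i x = i y \<longleftrightarrow> E x y) \<and>
     (\<forall>z\<in>C. \<forall>z'\<in>C. \<mu> z < 1 \<longrightarrow> \<mu> z' < 1 \<longrightarrow> (j z = j z' \<longleftrightarrow> R z z' \<or> z \<in> N \<and> z' \<in> N)) \<and>
     (\<forall>z\<in>C. \<forall>x\<in>A. \<mu> z < 1 \<longrightarrow> (j z = i x \<longleftrightarrow> z \<in> N \<and> E x b0))"

text \<open>Compatibility is asked for the radial projections of interior points, because
  \<open>R\<close> and \<open>N\<close> are controlled only in the open cubes.\<close>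

definition rim_homotopy :: "(real \<Rightarrow> (nat \<Rightarrow> real) \<Rightarrow> nat \<Rightarrow> real) \<Rightarrow> bool" where
  "rim_homotopy F \<longleftrightarrow> continuous_on ({0..1} \<times> rim) (\<lambda>(l, d). F l d) \<and>
     (\<forall>l\<in>{0..1}. \<forall>d\<in>rim. F l d \<in> A) \<and>
     (\<forall>l\<in>{0..1}. \<forall>z\<in>C. \<forall>z'\<in>C. 0 < \<mu> z \<longrightarrow> \<mu> z < 1 \<longrightarrow> \<mu> z' < 1 \<longrightarrow> R z z' \<longrightarrow> E (F l (\<pi> z)) (F l (\<pi> z'))) \<and>
     (\<forall>l\<in>{0..1}. \<forall>z\<in>C. 0 < \<mu> z \<longrightarrow> \<mu> z < 1 \<longrightarrow> z \<in> N \<longrightarrow> E (F l (\<pi> z)) b0)"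

lemma
  assumes "rim_homotopy F" and "l \<in> {0..1}"
  shows rim_homotopy_mem: "d \<in> rim \<Longrightarrow> F l d \<in> A"
    and rim_homotopy_R: "z \<in> C \<Longrightarrow> z' \<in> C \<Longrightarrow> 0 < \<mu> z \<Longrightarrow> \<mu> z < 1 \<Longrightarrow> \<mu> z' < 1 \<Longrightarrow> R z z' \<Longrightarrow>
      E (F l (\<pi> z)) (F l (\<pi> z'))"
    and rim_homotopy_N: "z \<in> C \<Longrightarrow> 0 < \<mu> z \<Longrightarrow> \<mu> z < 1 \<Longrightarrow> z \<in> N \<Longrightarrow> E (F l (\<pi> z)) b0"
  using assms unfolding rim_homotopy_def by meson+

lemma maxabs_cases: "z \<in> C \<Longrightarrow> z \<in> rim \<or> \<mu> z < 1"
  using C_le[of z] by (auto simp: rim_def)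

lemma \<mu>_dilate: "0 \<le> r \<Longrightarrow> \<mu> (dilate G r z) = r * \<mu> z"
  by (rule maxabs_dilate[OF finite_G G_ne])

lemma \<pi>_rim: "z \<in> C \<Longrightarrow> 0 < \<mu> z \<Longrightarrow> \<pi> z \<in> rim"
  by (simp add: rim_def dilate_C \<mu>_dilate)

lemma
  assumes "attached Z j i f"
  shows attached_final: "final_maps Z UNIV (\<lambda>k. if k then top_of_set C else top_of_set A) (\<lambda>k. if k then j else i)"
    and attached_j: "continuous_map (top_of_set C) Z j"
    and attached_i: "continuous_map (top_of_set A) Z i"
    and attached_rim: "\<And>d. d \<in> rim \<Longrightarrow> f d \<in> A" "\<And>d. d \<in> rim \<Longrightarrow> j d = i (f d)"
    and attached_E: "\<And>x y. x \<in> A \<Longrightarrow> y \<in> A \<Longrightarrow> i x = i y \<longleftrightarrow> E x y"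
    and attached_R: "\<And>z z'. z \<in> C \<Longrightarrow> z' \<in> C \<Longrightarrow> \<mu> z < 1 \<Longrightarrow> \<mu> z' < 1 \<Longrightarrow> j z = j z' \<longleftrightarrow> R z z' \<or> z \<in> N \<and> z' \<in> N"
    and attached_N: "\<And>z x. z \<in> C \<Longrightarrow> \<mu> z < 1 \<Longrightarrow> x \<in> A \<Longrightarrow> j z = i x \<longleftrightarrow> z \<in> N \<and> E x b0"
proof -
  show f: "final_maps Z UNIV (\<lambda>k. if k then top_of_set C else top_of_set A) (\<lambda>k. if k then j else i)"
    using assms by (simp add: attached_def)
  have "\<forall>k. continuous_map (if k then top_of_set C else top_of_set A) Z (if k then j else i)"
    using f unfolding final_maps_def by simp
  from this[rule_format, of True] this[rule_format, of False]
  show "continuous_map (top_of_set C) Z j" "continuous_map (top_of_set A) Z i" by simp_all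
qed (use assms in \<open>simp_all add: attached_def\<close>)

lemma attached_topspace:
  assumes "attached Z j i f"
  shows "topspace Z = j ` C \<union> i ` A"
proof -
  have "topspace Z = (\<Union>k. (if k then j else i) ` topspace (if k then top_of_set C else top_of_set A))"
    using attached_final[OF assms] by (simp add: final_maps_def)
  also have "\<dots> = j ` C \<union> i ` A" by (simp add: UNIV_bool Un_commute)
  finally show ?thesis .
qed

text \<open>The universal property in families over the interval: the hypotheses run through the
  kernel described by \<open>attached\<close>, and the final topology survives the product with the
  interval.\<close>

lemma attached_lift:
  assumes att: "attached Z j i f"
    and u: "continuous_map (top_of_set ({0..1::real} \<times> C)) Y u"
    and v: "continuous_map (top_of_set ({0..1::real} \<times> A)) Y v"
    and uv: "\<And>s d. s \<in> {0..1} \<Longrightarrow> d \<in> rim \<Longrightarrow> u (s, d) = v (s, f d)"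
    and vE: "\<And>s x y. s \<in> {0..1} \<Longrightarrow> x \<in> A \<Longrightarrow> y \<in> A \<Longrightarrow> E x y \<Longrightarrow> v (s, x) = v (s, y)"
    and uR: "\<And>s z z'. s \<in> {0..1} \<Longrightarrow> z \<in> C \<Longrightarrow> z' \<in> C \<Longrightarrow> \<mu> z < 1 \<Longrightarrow> \<mu> z' < 1 \<Longrightarrow> R z z' \<Longrightarrow> u (s, z) = u (s, z')"
    and uN: "\<And>s z. s \<in> {0..1} \<Longrightarrow> z \<in> C \<Longrightarrow> \<mu> z < 1 \<Longrightarrow> z \<in> N \<Longrightarrow> u (s, z) = v (s, b0)"
  obtains h where "continuous_map (prod_topology (top_of_set {0..1::real}) Z) Y h"
    "\<And>s z. s \<in> {0..1} \<Longrightarrow> z \<in> C \<Longrightarrow> h (s, j z) = u (s, z)"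
    "\<And>s x. s \<in> {0..1} \<Longrightarrow> x \<in> A \<Longrightarrow> h (s, i x) = v (s, x)"
proof -
  \<comment> \<open>Any preimage may be chosen; preimages in the base are preferred so that the rim
    is governed by \<open>v\<close>.\<close>
  define h where "h = (\<lambda>(s, z). if \<exists>x\<in>A. i x = z then v (s, SOME x. x \<in> A \<and> i x = z)
    else u (s, SOME p. p \<in> C \<and> j p = z))"
  have hi: "h (s, i x) = v (s, x)" if s: "s \<in> {0..1}" and x: "x \<in> A" for s x
  proof -
    define x' where "x' = (SOME x'. x' \<in> A \<and> i x' = i x)"
    have x': "x' \<in> A \<and> i x' = i x" unfolding x'_def by (rule someI[of _ x]) (use x in simp)
    then have "E x' x" using attached_E[OF att] x by blast
    then have "v (s, x') = v (s, x)" using vE s x x' by blast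
    moreover have "\<exists>xa\<in>A. i xa = i x" using x by blast
    ultimately show ?thesis by (simp add: h_def x'_def)
  qed
  have hj: "h (s, j z) = u (s, z)" if s: "s \<in> {0..1}" and z: "z \<in> C" for s z
  proof (cases "\<exists>x\<in>A. i x = j z")
    case True
    then obtain x where x: "x \<in> A" "i x = j z" by blast
    have "h (s, j z) = v (s, x)" using hi[OF s x(1)] x by simp
    also have "\<dots> = u (s, z)"
    proof (cases "z \<in> rim")
      case True
      then have "i x = i (f z)" "f z \<in> A" using attached_rim[OF att] x by simp_all
      then have "E x (f z)" using attached_E[OF att] x(1) by blast
      then have "v (s, x) = v (s, f z)" using vE[OF s x(1)] \<open>f z \<in> A\<close> by blast
      then show ?thesis using uv[OF s True] by simp
    next
      case False
      then have m: "\<mu> z < 1" using maxabs_cases z by blast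
      then have zN: "z \<in> N" "E x b0" using attached_N[OF att z m x(1)] x(2) by simp_all
      then show ?thesis using vE[OF s x(1) b0_A] uN[OF s z m] by simp
    qed
    finally show ?thesis .
  next
    case False
    \<comment> \<open>With no preimage in the base, \<open>z\<close> and \<open>p\<close> lie off
      the rim and \<open>z\<close> is outside \<open>N\<close>, so only \<open>R\<close> can
      identify them.\<close>
    define p where "p = (SOME p. p \<in> C \<and> j p = j z)"
    have p: "p \<in> C \<and> j p = j z" unfolding p_def by (rule someI[of _ z]) (use z in simp)
    have nr: "w \<notin> rim" if "j w = j z" for w
    proof
      assume w: "w \<in> rim"
      then have "i (f w) = j z" "f w \<in> A" using attached_rim[OF att w] that by simp_all
      then show False using False by blast
    qed
    then have m: "\<mu> z < 1" "\<mu> p < 1" using maxabs_cases z p by blast+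
    have "E b0 b0" using attached_E[OF att b0_A b0_A] by simp
    then have "z \<notin> N" using attached_N[OF att z m(1) b0_A] False b0_A by metis
    then have "R p z" using attached_R[OF att _ z m(2) m(1)] p by blast
    then have "u (s, p) = u (s, z)" using uR[OF s _ z m(2) m(1)] p by blast
    then show ?thesis using False by (simp add: h_def p_def)
  qed
  have "continuous_map (prod_topology (top_of_set {0..1}) Z) Y h"
  proof (rule final_maps_homotopy[OF attached_final[OF att]])
    fix k :: bool
    have 1: "continuous_map (top_of_set ({0..1} \<times> C)) Y (\<lambda>(s, x). h (s, j x))"
      by (rule continuous_map_eq[OF u]) (use hj in auto)
    have 2: "continuous_map (top_of_set ({0..1} \<times> A)) Y (\<lambda>(s, x). h (s, i x))"
      by (rule continuous_map_eq[OF v]) (use hi in auto)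
    show "continuous_map (prod_topology (top_of_set {0..1}) (if k then top_of_set C else top_of_set A)) Y
        (\<lambda>(s, x). h (s, (if k then j else i) x))"
      using 1 2 by (cases k) simp_all
  qed
  then show thesis using that hi hj by blast
qed

text \<open>Near the rim the map runs through the homotopy \<open>F\<close> (reparametrized by \<open>\<phi>\<close>), and the remaining inner cube
  is stretched to the full one.\<close>

lemma radial_map:
  assumes att0: "attached Z0 j0 i0 (F 0)" and att1: "attached Z1 j1 i1 (F k)"
    and F: "rim_homotopy F"
    and c: "0 < c" "c < 1"
    and \<phi>: "continuous_on ({0..1} \<times> {c..1}) (\<lambda>(s, m). \<phi> s m)"
      "\<And>s m. s \<in> {0..1} \<Longrightarrow> m \<in> {c..1} \<Longrightarrow> \<phi> s m \<in> {0..1}"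
      "\<And>s. s \<in> {0..1} \<Longrightarrow> \<phi> s 1 = 0" "\<And>s. s \<in> {0..1} \<Longrightarrow> \<phi> s c = k"
  obtains h where "continuous_map (prod_topology (top_of_set {0..1::real}) Z0) Z1 h"
    "\<And>s z. s \<in> {0..1} \<Longrightarrow> z \<in> C \<Longrightarrow> c \<le> \<mu> z \<Longrightarrow> h (s, j0 z) = i1 (F (\<phi> s (\<mu> z)) (\<pi> z))"
    "\<And>s z. s \<in> {0..1} \<Longrightarrow> z \<in> C \<Longrightarrow> \<mu> z < c \<Longrightarrow> h (s, j0 z) = j1 (dilate G (1 / c) z)"
    "\<And>s x. s \<in> {0..1} \<Longrightarrow> x \<in> A \<Longrightarrow> h (s, i0 x) = i1 x"
proof -
  let ?T = "{0..1::real}"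
  define u where "u = (\<lambda>(s, z). if c \<le> \<mu> z then i1 (F (\<phi> s (\<mu> z)) (\<pi> z)) else j1 (dilate G (1 / c) z))"
  note FA = rim_homotopy_mem[OF F] and FR = rim_homotopy_R[OF F] and FN = rim_homotopy_N[OF F]
  have Fc: "continuous_on (?T \<times> rim) (\<lambda>(l, d). F l d)"
    using F by (simp add: rim_homotopy_def)
  have inner: "z \<in> C \<Longrightarrow> \<mu> z < c \<Longrightarrow> dilate G (1 / c) z \<in> C \<and> \<mu> (dilate G (1 / c) z) < 1" for z
    using c by (simp add: dilate_C \<mu>_dilate)
  have \<mu>_cont: "continuous_on S (\<lambda>p. \<mu> (snd p))" for S :: "(real \<times> (nat \<Rightarrow> real)) set"
    by (intro continuous_intros finite_G G_ne)
  have "continuous_map (top_of_set (?T \<times> C)) Z1 (\<lambda>p. if c \<le> \<mu> (snd p)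
        then i1 (F (\<phi> (fst p) (\<mu> (snd p))) (\<pi> (snd p))) else j1 (dilate G (1 / c) (snd p)))"
  proof (rule continuous_map_cases_le_on)
    show "continuous_on (?T \<times> C) (\<lambda>p. c)" "continuous_on (?T \<times> C) (\<lambda>p. \<mu> (snd p))"
      using \<mu>_cont by simp_all
    let ?S = "{p \<in> ?T \<times> C. c \<le> \<mu> (snd p)}"
    have "continuous_on ?S ((\<lambda>(s, m). \<phi> s m) \<circ> (\<lambda>p. (fst p, \<mu> (snd p))))"
      by (intro continuous_on_compose continuous_on_subset[OF \<phi>(1)] continuous_on_Pair \<mu>_cont continuous_on_fst continuous_on_id)
         (use C_le in auto)
    then have \<phi>c: "continuous_on ?S (\<lambda>p. \<phi> (fst p) (\<mu> (snd p)))" by (simp add: o_def)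
    have \<pi>c: "continuous_on ?S (\<lambda>p. \<pi> (snd p))"
      by (intro continuous_intros \<mu>_cont) (use c in auto)
    have mem: "\<phi> (fst p) (\<mu> (snd p)) \<in> ?T \<and> \<pi> (snd p) \<in> rim" if "p \<in> ?S" for p
      using that \<phi>(2)[of "fst p" "\<mu> (snd p)"] \<pi>_rim[of "snd p"] C_le[of "snd p"] c by auto
    have "continuous_on ?S ((\<lambda>(l, d). F l d) \<circ> (\<lambda>p. (\<phi> (fst p) (\<mu> (snd p)), \<pi> (snd p))))"
      by (intro continuous_on_compose continuous_on_subset[OF Fc] continuous_on_Pair \<phi>c \<pi>c)
         (use mem in \<open>auto simp del: atLeastAtMost_iff\<close>)
    then have "continuous_on ?S (\<lambda>p. F (\<phi> (fst p) (\<mu> (snd p))) (\<pi> (snd p)))" by (simp add: o_def)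
    then show "continuous_map (top_of_set ?S) Z1 (\<lambda>p. i1 (F (\<phi> (fst p) (\<mu> (snd p))) (\<pi> (snd p))))"
      by (rule continuous_map_comp_on[OF attached_i[OF att1]]) (use mem FA in \<open>simp del: atLeastAtMost_iff\<close>)
    show "continuous_map (top_of_set {p \<in> ?T \<times> C. \<mu> (snd p) \<le> c}) Z1 (\<lambda>p. j1 (dilate G (1 / c) (snd p)))"
    proof (rule continuous_map_comp_on[OF attached_j[OF att1]])
      show "continuous_on {p \<in> ?T \<times> C. \<mu> (snd p) \<le> c} (\<lambda>p. dilate G (1 / c) (snd p))"
        by (intro continuous_intros)
      fix p assume "p \<in> {p \<in> ?T \<times> C. \<mu> (snd p) \<le> c}"
      then show "dilate G (1 / c) (snd p) \<in> C" using c by (intro dilate_C) auto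
    qed
    \<comment> \<open>The two formulas meet at radius \<open>c\<close>: there \<open>F\<close> has
      reached time \<open>k\<close>, the attaching map of the target.\<close>
    fix p assume p: "p \<in> ?T \<times> C" "c = \<mu> (snd p)"
    have "\<phi> (fst p) (\<mu> (snd p)) = k" using p \<phi>(4)[of "fst p"] by auto
    moreover have "\<pi> (snd p) \<in> rim" using p c by (intro \<pi>_rim) auto
    ultimately show "i1 (F (\<phi> (fst p) (\<mu> (snd p))) (\<pi> (snd p))) = j1 (dilate G (1 / c) (snd p))"
      using attached_rim(2)[OF att1, of "\<pi> (snd p)"] p by simp
  qed
  then have u: "continuous_map (top_of_set (?T \<times> C)) Z1 u"
    by (simp add: u_def case_prod_unfold)
  have v: "continuous_map (top_of_set (?T \<times> A)) Z1 (\<lambda>p. i1 (snd p))"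
    by (rule continuous_map_comp_on[OF attached_i[OF att1]]) (auto intro: continuous_intros)
  show thesis
  proof (rule attached_lift[OF att0 u v])
    fix s d assume s: "s \<in> ?T" and d: "d \<in> rim"
    then have "\<mu> d = 1" by (simp add: rim_def)
    then show "u (s, d) = i1 (snd (s, F 0 d))"
      using c \<phi>(3)[OF s] by (simp add: u_def)
  next
    fix s x y assume "x \<in> A" "y \<in> A" "E x y"
    then show "i1 (snd (s, x)) = i1 (snd (s, y))" using attached_E[OF att1] by simp
  next
    fix s z z' assume s: "s \<in> ?T" and z: "z \<in> C" "z' \<in> C" "\<mu> z < 1" "\<mu> z' < 1" "R z z'"
    have m: "\<mu> z = \<mu> z'" using R_maxabs z by blast
    show "u (s, z) = u (s, z')"
    proof (cases "c \<le> \<mu> z")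
      case True
      have l: "\<phi> s (\<mu> z) \<in> ?T" using \<phi>(2) s True z by simp
      have "E (F (\<phi> s (\<mu> z)) (\<pi> z)) (F (\<phi> s (\<mu> z)) (\<pi> z'))"
        using FR[OF l z(1,2) _ z(3-5)] True c by simp
      moreover have "\<pi> z \<in> rim" "\<pi> z' \<in> rim"
        using \<pi>_rim[OF z(1)] \<pi>_rim[OF z(2)] True m c by linarith+
      ultimately show ?thesis
        using attached_E[OF att1] FA[OF l] True m by (simp add: u_def)
    next
      case False
      have "R (dilate G (1 / c) z) (dilate G (1 / c) z')"
        using R_dilate z False c by simp
      then show ?thesis
        using attached_R[OF att1] inner False z m by (simp add: u_def)
    qed
  next
    fix s z assume s: "s \<in> ?T" and z: "z \<in> C" "\<mu> z < 1" "z \<in> N"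
    show "u (s, z) = i1 (snd (s, b0))"
    proof (cases "c \<le> \<mu> z")
      case True
      have l: "\<phi> s (\<mu> z) \<in> ?T" using \<phi>(2) s True z by simp
      have "E (F (\<phi> s (\<mu> z)) (\<pi> z)) b0" using FN[OF l z(1) _ z(2,3)] True c by simp
      moreover have "\<pi> z \<in> rim" using \<pi>_rim z True c by simp
      ultimately show ?thesis
        using attached_E[OF att1] FA[OF l] True b0_A by (simp add: u_def)
    next
      case False
      have "dilate G (1 / c) z \<in> N" using N_dilate z False c by simp
      moreover have "E b0 b0" using attached_E[OF att1 b0_A b0_A] by simp
      ultimately show ?thesis
        using attached_N[OF att1 _ _ b0_A] inner False z by (simp add: u_def)
    qed
  next
    fix h assume h: "continuous_map (prod_topology (top_of_set ?T) Z0) Z1 h"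
      "\<And>s z. s \<in> ?T \<Longrightarrow> z \<in> C \<Longrightarrow> h (s, j0 z) = u (s, z)"
      "\<And>s x. s \<in> ?T \<Longrightarrow> x \<in> A \<Longrightarrow> h (s, i0 x) = i1 (snd (s, x))"
    show thesis
    proof (rule that[OF h(1)])
      fix s z assume s: "s \<in> ?T" and z: "z \<in> C"
      show "h (s, j0 z) = i1 (F (\<phi> s (\<mu> z)) (\<pi> z))" if "c \<le> \<mu> z"
        using h(2)[OF s z] that by (simp add: u_def)
      show "h (s, j0 z) = j1 (dilate G (1 / c) z)" if "\<mu> z < c"
        using h(2)[OF s z] that by (simp add: u_def)
    qed (use h(3) in simp)
  qed
qed

text \<open>Shrinks the stretching to nothing: the inner cube blown up to the full one has radius
  1/4 at time 0 and radius 1 at time 1, where the map is the identity. Points outside it are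
  projected to the rim.\<close>

lemma stretch_homotopy:
  assumes att: "attached Z j i (F 0)" and F: "rim_homotopy F"
  obtains h where "continuous_map (prod_topology (top_of_set {0..1::real}) Z) Z h"
    "\<And>s z. s \<in> {0..1} \<Longrightarrow> z \<in> C \<Longrightarrow> h (s, j z) = j (dilate G (1 / max (1/4 + 3/4 * s) (\<mu> z)) z)"
    "\<And>s x. s \<in> {0..1} \<Longrightarrow> x \<in> A \<Longrightarrow> h (s, i x) = i x"
proof -
  let ?T = "{0..1::real}"
  define \<rho> where "\<rho> s = 1/4 + 3/4 * s" for s :: real
  have \<rho>: "0 < \<rho> s" "\<rho> s \<le> 1" if "s \<in> ?T" for s using that by (simp_all add: \<rho>_def)
  define u where "u = (\<lambda>(s, z). j (dilate G (1 / max (\<rho> s) (\<mu> z)) z))"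
  have FA: "\<And>d. d \<in> rim \<Longrightarrow> F 0 d \<in> A"
    by (rule rim_homotopy_mem[OF F]) simp
  have jE: "j (\<pi> z) = i (F 0 (\<pi> z))" "F 0 (\<pi> z) \<in> A" if "z \<in> C" "0 < \<mu> z" for z
    using attached_rim(2)[OF att] FA \<pi>_rim[OF that] by simp_all
  have Cin: "dilate G (1 / max (\<rho> s) (\<mu> z)) z \<in> C" if "s \<in> ?T" "z \<in> C" for s z
    using that \<rho>[OF that(1)] by (intro dilate_C) (auto simp: divide_simps)
  have "continuous_on (?T \<times> C) (\<lambda>p. dilate G (1 / max (\<rho> (fst p)) (\<mu> (snd p))) (snd p))"
    unfolding \<rho>_def
    by (intro continuous_intros finite_G G_ne) (auto simp: max_def)
  then have "continuous_map (top_of_set (?T \<times> C)) Z (\<lambda>p. j (dilate G (1 / max (\<rho> (fst p)) (\<mu> (snd p))) (snd p)))"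
    by (rule continuous_map_comp_on[OF attached_j[OF att]]) (use Cin in auto)
  then have u: "continuous_map (top_of_set (?T \<times> C)) Z u"
    by (simp add: u_def case_prod_unfold)
  have v: "continuous_map (top_of_set (?T \<times> A)) Z (\<lambda>p. i (snd p))"
    by (rule continuous_map_comp_on[OF attached_i[OF att]]) (auto intro: continuous_intros)
  show thesis
  proof (rule attached_lift[OF att u v])
    fix s d assume s: "s \<in> ?T" and d: "d \<in> rim"
    then have "\<mu> d = 1" by (simp add: rim_def)
    then have "max (\<rho> s) (\<mu> d) = 1" using \<rho>[OF s] by simp
    then show "u (s, d) = i (snd (s, F 0 d))"
      using attached_rim(2)[OF att d] by (simp add: u_def)
  next
    fix s x y assume "x \<in> A" "y \<in> A" "E x y"
    then show "i (snd (s, x)) = i (snd (s, y))" using attached_E[OF att] by simp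
  next
    fix s z z' assume s: "s \<in> ?T" and z: "z \<in> C" "z' \<in> C" "\<mu> z < 1" "\<mu> z' < 1" "R z z'"
    have m: "\<mu> z = \<mu> z'" using R_maxabs z by blast
    show "u (s, z) = u (s, z')"
    proof (cases "\<rho> s \<le> \<mu> z")
      \<comment> \<open>The projections lie on the rim, where \<open>R\<close> says nothing; their
        images are compared through the attaching map \<open>F 0\<close> and
        \<open>E\<close>.\<close>
      case True
      then have "0 < \<mu> z" using \<rho>[OF s] by simp
      then have "E (F 0 (\<pi> z)) (F 0 (\<pi> z'))"
        using rim_homotopy_R[OF F] z by simp
      then have "i (F 0 (\<pi> z)) = i (F 0 (\<pi> z'))"
        using attached_E[OF att jE(2)[OF z(1)] jE(2)[OF z(2)]] m \<open>0 < \<mu> z\<close> by simp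
      then have "j (\<pi> z) = j (\<pi> z')" using jE(1)[OF z(1)] jE(1)[OF z(2)] m \<open>0 < \<mu> z\<close> by simp
      then show ?thesis using True m by (simp add: u_def max_def)
    next
      case False
      let ?r = "1 / \<rho> s"
      have r: "0 < ?r" "?r * \<mu> z < 1" using False \<rho>[OF s] by (simp_all add: divide_simps)
      then have "R (dilate G ?r z) (dilate G ?r z')" using R_dilate z by simp
      moreover have "dilate G ?r z \<in> C" "dilate G ?r z' \<in> C" using r z m by (simp_all add: dilate_C)
      moreover have "\<mu> (dilate G ?r z) < 1" "\<mu> (dilate G ?r z') < 1" using r m by (simp_all add: \<mu>_dilate)
      ultimately have "j (dilate G ?r z) = j (dilate G ?r z')" using attached_R[OF att] by simp
      then show ?thesis using False m by (simp add: u_def max_def)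
    qed
  next
    fix s z assume s: "s \<in> ?T" and z: "z \<in> C" "\<mu> z < 1" "z \<in> N"
    have E0: "E b0 b0" using attached_E[OF att b0_A b0_A] by simp
    show "u (s, z) = i (snd (s, b0))"
    proof (cases "\<rho> s \<le> \<mu> z")
      case True
      then have m: "0 < \<mu> z" using \<rho>[OF s] by simp
      then have "E (F 0 (\<pi> z)) b0" using rim_homotopy_N[OF F] z by simp
      then have "i (F 0 (\<pi> z)) = i b0" using attached_E[OF att] jE(2) z m b0_A by simp
      then show ?thesis using True jE(1) z m by (simp add: u_def max_def)
    next
      case False
      let ?r = "1 / \<rho> s"
      have r: "0 < ?r" "?r * \<mu> z < 1" using False \<rho>[OF s] by (simp_all add: divide_simps)
      then have "dilate G ?r z \<in> N" using N_dilate z by simp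
      moreover have "dilate G ?r z \<in> C" "\<mu> (dilate G ?r z) < 1" using r z by (simp_all add: dilate_C \<mu>_dilate)
      ultimately have "j (dilate G ?r z) = i b0" using attached_N[OF att _ _ b0_A] E0 by simp
      then show ?thesis using False by (simp add: u_def max_def)
    qed
  next
    fix h assume "continuous_map (prod_topology (top_of_set ?T) Z) Z h"
      "\<And>s z. s \<in> ?T \<Longrightarrow> z \<in> C \<Longrightarrow> h (s, j z) = u (s, z)"
      "\<And>s x. s \<in> ?T \<Longrightarrow> x \<in> A \<Longrightarrow> h (s, i x) = i (snd (s, x))"
    then show thesis by (intro that) (simp_all add: u_def \<rho>_def)
  qed
qed

lemma rim_homotopy_reverse:
  assumes "rim_homotopy F"
  shows "rim_homotopy (\<lambda>l. F (1 - l))"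
proof -
  have "continuous_on ({0..1} \<times> rim) ((\<lambda>(l, d). F l d) \<circ> (\<lambda>p. (1 - fst p, snd p)))"
  proof (intro continuous_on_compose)
    show "continuous_on ({0..1} \<times> rim) (\<lambda>p :: real \<times> (nat \<Rightarrow> real). (1 - fst p, snd p))"
      by (intro continuous_on_Pair continuous_on_diff continuous_on_const continuous_on_fst continuous_on_snd continuous_on_id)
    show "continuous_on ((\<lambda>p. (1 - fst p, snd p)) ` ({0..1} \<times> rim)) (\<lambda>(l, d). F l d)"
      by (rule continuous_on_subset[of "{0..1} \<times> rim"]) (use assms in \<open>auto simp: rim_homotopy_def\<close>)
  qed
  then have "continuous_on ({0..1} \<times> rim) (\<lambda>(l, d). F (1 - l) d)"
    by (simp add: o_def case_prod_unfold)
  then show ?thesis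
    unfolding rim_homotopy_def using rim_homotopy_mem[OF assms] rim_homotopy_R[OF assms] rim_homotopy_N[OF assms]
    by simp
qed

text \<open>The round trip runs through \<open>F\<close> forth and back in the collar \<open>1/4 \<le> \<mu>\<close>: first cut this detour short,
  then undo the stretching.\<close>

lemma attached_roundtrip:
  assumes att0: "attached Z0 j0 i0 (F 0)" and att1: "attached Z1 j1 i1 (F 1)" and F: "rim_homotopy F"
    and f: "\<And>z. z \<in> C \<Longrightarrow> 1/2 \<le> \<mu> z \<Longrightarrow> f (j0 z) = i1 (F (2 - 2 * \<mu> z) (\<pi> z))"
      "\<And>z. z \<in> C \<Longrightarrow> \<mu> z < 1/2 \<Longrightarrow> f (j0 z) = j1 (dilate G 2 z)" "\<And>x. x \<in> A \<Longrightarrow> f (i0 x) = i1 x"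
    and g: "\<And>z. z \<in> C \<Longrightarrow> 1/2 \<le> \<mu> z \<Longrightarrow> g (j1 z) = i0 (F (1 - (2 - 2 * \<mu> z)) (\<pi> z))"
      "\<And>z. z \<in> C \<Longrightarrow> \<mu> z < 1/2 \<Longrightarrow> g (j1 z) = j0 (dilate G 2 z)" "\<And>x. x \<in> A \<Longrightarrow> g (i1 x) = i0 x"
  shows "homotopic_with (\<lambda>h. h (i0 b0) = i0 b0) Z0 Z0 (g \<circ> f) id"
proof -
  let ?T = "{0..1::real}"
  have FA: "\<And>l d. l \<in> ?T \<Longrightarrow> d \<in> rim \<Longrightarrow> F l d \<in> A"
    by (rule rim_homotopy_mem[OF F])
  have top: "topspace Z0 = j0 ` C \<union> i0 ` A" using attached_topspace[OF att0] .
  have b: "i0 b0 \<in> topspace Z0" using top b0_A by blast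
  \<comment> \<open>The first map runs through \<open>F\<close> at time \<open>2 - 2 * m\<close> on
    radii above 1/2 and doubles the rest; the second then returns at time
    \<open>1 - (2 - 2 * (2 * m)) = 4 * m - 1\<close> on radii from 1/4 to 1/2. The minimum of the
    two is this tent, and capping it at height \<open>s\<close> shortens the detour.\<close>
  define \<phi> where "\<phi> s m = min s (min (2 - 2 * m) (4 * m - 1))" for s m :: real
  have \<phi>c: "continuous_on (?T \<times> {1/4..1}) (\<lambda>(s, m). \<phi> s m)"
    unfolding \<phi>_def case_prod_unfold by (intro continuous_intros)
  obtain h1 where h1: "continuous_map (prod_topology (top_of_set ?T) Z0) Z0 h1"
    "\<And>s z. s \<in> ?T \<Longrightarrow> z \<in> C \<Longrightarrow> 1/4 \<le> \<mu> z \<Longrightarrow> h1 (s, j0 z) = i0 (F (\<phi> s (\<mu> z)) (\<pi> z))"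
    "\<And>s z. s \<in> ?T \<Longrightarrow> z \<in> C \<Longrightarrow> \<mu> z < 1/4 \<Longrightarrow> h1 (s, j0 z) = j0 (dilate G 4 z)"
    "\<And>s x. s \<in> ?T \<Longrightarrow> x \<in> A \<Longrightarrow> h1 (s, i0 x) = i0 x"
  proof (rule radial_map[OF att0 att0 F _ _ \<phi>c])
    show "\<phi> s m \<in> ?T" if "s \<in> ?T" "m \<in> {1/4..1}" for s m using that by (auto simp: \<phi>_def min_def)
    show "\<phi> s 1 = 0" "\<phi> s (1/4) = 0" if "s \<in> ?T" for s using that by (auto simp: \<phi>_def min_def)
  qed auto
  obtain h2 where h2: "continuous_map (prod_topology (top_of_set ?T) Z0) Z0 h2"
    "\<And>s z. s \<in> ?T \<Longrightarrow> z \<in> C \<Longrightarrow> h2 (s, j0 z) = j0 (dilate G (1 / max (1/4 + 3/4 * s) (\<mu> z)) z)"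
    "\<And>s x. s \<in> ?T \<Longrightarrow> x \<in> A \<Longrightarrow> h2 (s, i0 x) = i0 x"
    using stretch_homotopy[OF att0 F] by blast
  have 1: "homotopic_with (\<lambda>h. h (i0 b0) = i0 b0) Z0 Z0 (\<lambda>z. h1 (0, z)) (g \<circ> f)"
  proof (rule homotopic_with_fixI[OF h1(1) b])
    fix x assume "x \<in> topspace Z0"
    then consider y where "y \<in> A" "x = i0 y" | z where "z \<in> C" "x = j0 z" using top by blast
    then show "h1 (1, x) = (g \<circ> f) x"
    proof cases
      case 1
      then show ?thesis using h1(4) f(3) g(3) by simp
    next
      case (2 z)
      consider "1/2 \<le> \<mu> z" | "1/4 \<le> \<mu> z" "\<mu> z < 1/2" | "\<mu> z < 1/4" by linarith
      then show ?thesis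
      proof cases
        case 1
        have m: "\<mu> z \<le> 1" using C_le 2 by blast
        have "F (2 - 2 * \<mu> z) (\<pi> z) \<in> A" using m 1 2 by (intro FA \<pi>_rim) auto
        moreover have "\<phi> 1 (\<mu> z) = 2 - 2 * \<mu> z" using 1 m by (simp add: \<phi>_def min_def)
        ultimately show ?thesis using 1 2 f(1) g(3) h1(2) by simp
      next
        case b: 2
        have C2: "dilate G 2 z \<in> C" "\<mu> (dilate G 2 z) = 2 * \<mu> z" using b 2 by (simp_all add: dilate_C \<mu>_dilate)
        have "\<pi> (dilate G 2 z) = \<pi> z" using b C2 by (simp add: dilate_dilate)
        moreover have "\<phi> 1 (\<mu> z) = 1 - (2 - 2 * (2 * \<mu> z))" using b by (simp add: \<phi>_def min_def)
        ultimately show ?thesis using b 2 f(2) g(1)[OF C2(1)] C2 h1(2) by simp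
      next
        case 3
        have C2: "dilate G 2 z \<in> C" "\<mu> (dilate G 2 z) = 2 * \<mu> z" using 3 2 by (simp_all add: dilate_C \<mu>_dilate)
        then show ?thesis using 3 2 f(2) g(2)[OF C2(1)] h1(3) by (simp add: dilate_dilate)
      qed
    qed
  qed (use h1(4) b0_A in auto)
  \<comment> \<open>With the tent capped at 0 only the projection of the collar and the stretching
    by 4 remain, which is where \<open>h2\<close> starts.\<close>
  have 2: "homotopic_with (\<lambda>h. h (i0 b0) = i0 b0) Z0 Z0 (\<lambda>z. h1 (0, z)) id"
  proof (rule homotopic_with_fixI[OF h2(1) b])
    fix x assume "x \<in> topspace Z0"
    then consider y where "y \<in> A" "x = i0 y" | z where "z \<in> C" "x = j0 z" using top by blast
    note cs = this
    then show "h2 (1, x) = id x"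
    proof cases
      case (2 z)
      then have "max 1 (\<mu> z) = 1" using C_le by (simp add: max_absorb1)
      then show ?thesis using h2(2) 2 by simp
    qed (use h2(3) in simp)
    from cs show "h2 (0, x) = h1 (0, x)"
    proof cases
      case (2 z)
      show ?thesis
      proof (cases "1/4 \<le> \<mu> z")
        case True
        have "\<phi> 0 (\<mu> z) = 0" using True C_le[OF 2(1)] by (auto simp: \<phi>_def min_def)
        moreover have "\<pi> z \<in> rim" using \<pi>_rim 2 True by simp
        ultimately show ?thesis
          using h2(2)[of 0 z] h1(2)[of 0 z] 2 True attached_rim(2)[OF att0] by (simp add: max_def)
      next
        case False
        then show ?thesis using h2(2)[of 0 z] h1(3)[of 0 z] 2 by (simp add: max_def)
      qed
    qed (use h2(3) h1(4) in simp)
  qed (use h2(3) b0_A in auto)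
  show ?thesis
    using homotopic_with_trans[OF homotopic_with_symD[OF 1] 2] .
qed

text \<open>The inverse is built in the same way from the reversed homotopy, so the round-trip lemma
  applies to both composites.\<close>

theorem attached_ptd_equiv:
  assumes att0: "attached Z0 j0 i0 (F 0)" and att1: "attached Z1 j1 i1 (F 1)" and F: "rim_homotopy F"
  shows "ptd_equiv Z0 (i0 b0) Z1 (i1 b0)"
proof -
  let ?T = "{0..1::real}"
  let ?F' = "\<lambda>l. F (1 - l)"
  have att1': "attached Z1 j1 i1 (?F' 0)" and att0': "attached Z0 j0 i0 (?F' 1)"
    using att0 att1 by simp_all
  note F' = rim_homotopy_reverse[OF F]
  \<comment> \<open>Time runs from 0 on the rim to 1 at radius 1/2. It does not depend on
    \<open>s\<close>, and only the slice \<open>s = 0\<close> is used as a map.\<close>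
  have c: "continuous_on (?T \<times> {1/2..1::real}) (\<lambda>(s, m). 2 - 2 * m)"
    unfolding case_prod_unfold by (intro continuous_intros)
  have slice: "continuous_map Z Z' (\<lambda>z. h (0, z))"
    if "continuous_map (prod_topology (top_of_set ?T) Z) Z' h" for Z :: "'x topology" and Z' :: "'y topology" and h
    using continuous_map_o_Pair[OF that, of 0] by (simp add: o_def)
  obtain h where h: "continuous_map (prod_topology (top_of_set ?T) Z0) Z1 h"
    "\<And>s z. s \<in> ?T \<Longrightarrow> z \<in> C \<Longrightarrow> 1/2 \<le> \<mu> z \<Longrightarrow> h (s, j0 z) = i1 (F (2 - 2 * \<mu> z) (\<pi> z))"
    "\<And>s z. s \<in> ?T \<Longrightarrow> z \<in> C \<Longrightarrow> \<mu> z < 1/2 \<Longrightarrow> h (s, j0 z) = j1 (dilate G (1 / (1/2)) z)"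
    "\<And>s x. s \<in> ?T \<Longrightarrow> x \<in> A \<Longrightarrow> h (s, i0 x) = i1 x"
    by (rule radial_map[OF att0 att1 F _ _ c]) auto
  obtain k where k: "continuous_map (prod_topology (top_of_set ?T) Z1) Z0 k"
    "\<And>s z. s \<in> ?T \<Longrightarrow> z \<in> C \<Longrightarrow> 1/2 \<le> \<mu> z \<Longrightarrow> k (s, j1 z) = i0 (F (1 - (2 - 2 * \<mu> z)) (\<pi> z))"
    "\<And>s z. s \<in> ?T \<Longrightarrow> z \<in> C \<Longrightarrow> \<mu> z < 1/2 \<Longrightarrow> k (s, j1 z) = j0 (dilate G (1 / (1/2)) z)"
    "\<And>s x. s \<in> ?T \<Longrightarrow> x \<in> A \<Longrightarrow> k (s, i1 x) = i0 x"
    by (rule radial_map[OF att1' att0' F' _ _ c]) auto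
  have 1: "homotopic_with (\<lambda>h. h (i0 b0) = i0 b0) Z0 Z0 ((\<lambda>z. k (0, z)) \<circ> (\<lambda>z. h (0, z))) id"
    by (rule attached_roundtrip[OF att0 att1 F]) (use h k in simp_all)
  have 2: "homotopic_with (\<lambda>h. h (i1 b0) = i1 b0) Z1 Z1 ((\<lambda>z. h (0, z)) \<circ> (\<lambda>z. k (0, z))) id"
    by (rule attached_roundtrip[OF att1' att0' F']) (use h k in simp_all)
  show ?thesis
    unfolding ptd_equiv_def
  proof (intro conjI exI)
    show "i0 b0 \<in> topspace Z0" "i1 b0 \<in> topspace Z1"
      using attached_topspace[OF att0] attached_topspace[OF att1] b0_A by simp_all
    show "h (0, i0 b0) = i1 b0" "k (0, i1 b0) = i0 b0" using h(4) k(4) b0_A by simp_all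
  qed (use 1 2 slice[OF h(1)] slice[OF k(1)] in simp_all)
qed

end

subsection \<open>Splitting off a circle factor\<close>

text \<open>When the cubes alone already cover the space as a quotient, the map from the base adds
  no open sets and only has to be continuous.\<close>

lemma final_maps_quotient:
  assumes "quotient_map (top_of_set C) Z j" "continuous_map (top_of_set A) Z i"
  shows "final_maps Z UNIV (\<lambda>k. if k then top_of_set C else top_of_set A) (\<lambda>k. if k then j else i)"
  unfolding final_maps_def
proof (intro conjI ballI allI impI)
  show "continuous_map (if k then top_of_set C else top_of_set A) Z (if k then j else i)" for k
    using assms by (simp add: quotient_imp_continuous_map)
  have "i ` A \<subseteq> topspace Z" using continuous_map_image_subset_topspace[OF assms(2)] by simp
  moreover have "j ` C = topspace Z" using quotient_imp_surjective_map[OF assms(1)] by simp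
  ultimately show "topspace Z = (\<Union>k. (if k then j else i) ` topspace (if k then top_of_set C else top_of_set A))"
    by (auto simp: UNIV_bool)
  fix U assume U: "U \<subseteq> topspace Z"
    and o: "\<forall>k\<in>UNIV. openin (if k then top_of_set C else top_of_set A)
      {x \<in> topspace (if k then top_of_set C else top_of_set A). (if k then j else i) x \<in> U}"
  show "openin Z U"
    using o[rule_format, of True] assms(1) U by (simp add: quotient_map_def)
qed

lemma quotient_map_openin:
  "quotient_map X Y q \<Longrightarrow> V \<subseteq> topspace Y \<Longrightarrow> openin X {x \<in> topspace X. q x \<in> V} \<Longrightarrow> openin Y V"
  unfolding quotient_map_def by blast

text \<open>An attaching map that is constant up to \<open>E\<close> collapses the rim to the base
  point, so the space is the wedge of the base modulo \<open>E\<close> and the cubes modulo their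
  rim.\<close>

lemma (in cubes) attached_wedge:
  assumes k: "k1 \<noteq> k2"
    and q1: "quotient_map (top_of_set A) (Y k1) q1" and q2: "quotient_map (top_of_set C) (Y k2) q2"
    and b1: "b k1 = q1 b0" and b2: "\<And>d. d \<in> rim \<Longrightarrow> q2 d = b k2"
    and f: "\<And>d. d \<in> rim \<Longrightarrow> f d \<in> A \<and> E (f d) b0"
    and E: "\<And>x y. x \<in> A \<Longrightarrow> y \<in> A \<Longrightarrow> q1 x = q1 y \<longleftrightarrow> E x y"
    and R: "\<And>z z'. z \<in> C \<Longrightarrow> z' \<in> C \<Longrightarrow> \<mu> z < 1 \<Longrightarrow> \<mu> z' < 1 \<Longrightarrow> q2 z = q2 z' \<longleftrightarrow> R z z' \<or> z \<in> N \<and> z' \<in> N"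
    and N: "\<And>z. z \<in> C \<Longrightarrow> \<mu> z < 1 \<Longrightarrow> q2 z = b k2 \<longleftrightarrow> z \<in> N"
  shows "attached (wedge {k1, k2} Y b) (\<lambda>z. wtag b k2 (q2 z)) (\<lambda>x. wtag b k1 (q1 x)) f"
  unfolding attached_def
proof (intro conjI ballI impI)
  let ?W = "wedge {k1, k2} Y b"
  note fin = final_maps_wedge[of "{k1, k2}" Y b]
  have c1: "continuous_map (top_of_set A) ?W (\<lambda>x. wtag b k1 (q1 x))"
    using continuous_map_compose[OF quotient_imp_continuous_map[OF q1] continuous_map_wtag[of k1 "{k1, k2}" Y b]]
    by (simp add: o_def)
  have c2: "continuous_map (top_of_set C) ?W (\<lambda>z. wtag b k2 (q2 z))"
    using continuous_map_compose[OF quotient_imp_continuous_map[OF q2] continuous_map_wtag[of k2 "{k1, k2}" Y b]]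
    by (simp add: o_def)
  have s1: "q1 ` A = topspace (Y k1)" and s2: "q2 ` C = topspace (Y k2)"
    using quotient_imp_surjective_map[OF q1] quotient_imp_surjective_map[OF q2] by simp_all
  show "final_maps ?W UNIV (\<lambda>k. if k then top_of_set C else top_of_set A)
    (\<lambda>k. if k then \<lambda>z. wtag b k2 (q2 z) else (\<lambda>x. wtag b k1 (q1 x)))"
    unfolding final_maps_def
  proof (intro conjI ballI allI impI)
    show "continuous_map (if k then top_of_set C else top_of_set A) ?W
      (if k then \<lambda>z. wtag b k2 (q2 z) else (\<lambda>x. wtag b k1 (q1 x)))" for k
      using c1 c2 by simp
    show "topspace ?W = (\<Union>k. (if k then \<lambda>z. wtag b k2 (q2 z) else (\<lambda>x. wtag b k1 (q1 x))) `
        topspace (if k then top_of_set C else top_of_set A))"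
      unfolding topspace_wedge UNIV_bool by (simp add: s1[symmetric] s2[symmetric] image_image)
    fix U assume U: "U \<subseteq> topspace ?W"
      and o: "\<forall>k\<in>UNIV. openin (if k then top_of_set C else top_of_set A)
        {x \<in> topspace (if k then top_of_set C else top_of_set A).
          (if k then \<lambda>z. wtag b k2 (q2 z) else (\<lambda>x. wtag b k1 (q1 x))) x \<in> U}"
    have "openin (Y k1) {y \<in> topspace (Y k1). wtag b k1 y \<in> U}"
    proof -
      have "{x \<in> A. q1 x \<in> {y \<in> topspace (Y k1). wtag b k1 y \<in> U}} = {x \<in> A. wtag b k1 (q1 x) \<in> U}"
        using s1 by blast
      then show ?thesis
        using o[rule_format, of False] by (intro quotient_map_openin[OF q1]) auto
    qed
    moreover have "openin (Y k2) {y \<in> topspace (Y k2). wtag b k2 y \<in> U}"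
    proof -
      have "{x \<in> C. q2 x \<in> {y \<in> topspace (Y k2). wtag b k2 y \<in> U}} = {x \<in> C. wtag b k2 (q2 x) \<in> U}"
        using s2 by blast
      then show ?thesis
        using o[rule_format, of True] by (intro quotient_map_openin[OF q2]) auto
    qed
    ultimately show "openin ?W U"
      using fin U unfolding final_maps_def by simp
  qed
  fix d assume d: "d \<in> rim"
  have "q1 (f d) = q1 b0" using f[OF d] E b0_A by blast
  then show "wtag b k2 (q2 d) = wtag b k1 (q1 (f d))" using b1[symmetric] b2[OF d] by simp
  show "f d \<in> A" using f[OF d] by blast
next
  fix x y assume "x \<in> A" "y \<in> A"
  then show "wtag b k1 (q1 x) = wtag b k1 (q1 y) \<longleftrightarrow> E x y" using E by simp
next
  fix z z' assume "z \<in> C" "z' \<in> C" "\<mu> z < 1" "\<mu> z' < 1"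
  then show "wtag b k2 (q2 z) = wtag b k2 (q2 z') \<longleftrightarrow> R z z' \<or> z \<in> N \<and> z' \<in> N" using R by simp
next
  fix z x assume z: "z \<in> C" "x \<in> A" "\<mu> z < 1"
  have "q1 x = b k1 \<longleftrightarrow> E x b0" using E[OF z(2) b0_A] b1 by simp
  then show "wtag b k2 (q2 z) = wtag b k1 (q1 x) \<longleftrightarrow> z \<in> N \<and> E x b0"
    using N[OF z(1,3)] k by (simp add: wtag_eq_wtag)
qed

section \<open>Cubical models of the suspended bundles\<close>

definition hcube :: "(nat \<Rightarrow> real) set" where
  "hcube = {z. \<forall>i. \<bar>z i\<bar> \<le> 1}"

text \<open>Equality of points of the circle in the coordinate between -1 and 1; both end points
  represent the base point.\<close>

definition circ :: "real \<Rightarrow> real \<Rightarrow> bool" where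
  "circ a b \<longleftrightarrow> a = b \<or> \<bar>a\<bar> = 1 \<and> \<bar>b\<bar> = 1"

text \<open>Coordinates on the suspended bundles over the circle with fibre a product of circles: \<open>z 1\<close> is the
  suspension coordinate, \<open>z 0\<close> parametrizes the half circle \<open>\<i> cis (\<pi> z 0 / 2)\<close> whose end points are
  identified by the involution, and \<open>z i\<close> for \<open>i \<ge> 2\<close> is the circle coordinate \<open>- cis (\<pi> z i)\<close>.
  Fibre coordinates in \<open>S\<close> are smashed, those in \<open>P\<close> are multiplied, all others are ignored.\<close>

definition based :: "nat set \<Rightarrow> nat set \<Rightarrow> (nat \<Rightarrow> real) \<Rightarrow> bool" where
  "based S P z \<longleftrightarrow> \<bar>z 1\<bar> = 1 \<or> (\<exists>i\<in>S. \<bar>z i\<bar> = 1) \<or> S = {} \<and> \<bar>z 0\<bar> = 1 \<and> (\<forall>i\<in>P. \<bar>z i\<bar> = 1)"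

text \<open>The mapping torus relation: the second alternative joins the two ends of the half circle
  through conjugation of the fibres, which is negation of the circle coordinates. The suspension
  coordinate is untouched.\<close>

definition glued :: "nat set \<Rightarrow> (nat \<Rightarrow> real) \<Rightarrow> (nat \<Rightarrow> real) \<Rightarrow> bool" where
  "glued U z w \<longleftrightarrow> z 1 = w 1 \<and>
     (z 0 = w 0 \<and> (\<forall>i\<in>U. circ (z i) (w i)) \<or> \<bar>z 0\<bar> = 1 \<and> w 0 = - z 0 \<and> (\<forall>i\<in>U. circ (z i) (- w i)))"

definition same :: "nat set \<Rightarrow> nat set \<Rightarrow> (nat \<Rightarrow> real) \<Rightarrow> (nat \<Rightarrow> real) \<Rightarrow> bool" where
  "same S P z w \<longleftrightarrow> based S P z \<and> based S P w \<or> glued (S \<union> P) z w"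

definition pt :: "nat set \<Rightarrow> nat set \<Rightarrow> (nat \<Rightarrow> real) \<Rightarrow> (nat \<Rightarrow> real) set" where
  "pt S P z = {w \<in> hcube. same S P z w}"

definition Zsp :: "nat set \<Rightarrow> nat set \<Rightarrow> (nat \<Rightarrow> real) set topology" where
  "Zsp S P = quotient_top (top_of_set hcube) (pt S P)"

definition Zbase :: "nat set \<Rightarrow> nat set \<Rightarrow> (nat \<Rightarrow> real) set" where
  "Zbase S P = {w \<in> hcube. based S P w}"

lemma circ_refl [simp]: "circ a a" and circ_sym: "circ a b \<Longrightarrow> circ b a"
  and circ_trans: "circ a b \<Longrightarrow> circ b c \<Longrightarrow> circ a c" and circ_abs: "circ a b \<Longrightarrow> \<bar>a\<bar> = 1 \<longleftrightarrow> \<bar>b\<bar> = 1"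
  and circ_uminus: "circ a (- b) \<longleftrightarrow> circ (- a) b" and circ_uminus_uminus [simp]: "circ (- a) (- b) \<longleftrightarrow> circ a b"
  by (auto simp: circ_def)

lemma glued_refl: "glued U z z"
  by (simp add: glued_def)

lemma glued_sym:
  assumes "glued U z w"
  shows "glued U w z"
  using assms by (auto simp: glued_def circ_uminus intro: circ_sym)

text \<open>The two alternatives compose like the elements of the group of order two; two flips
  cancel.\<close>

lemma glued_trans:
  assumes zw: "glued U z w" and wv: "glued U w v"
  shows "glued U z v"
proof -
  have t: "\<And>i. i \<in> U \<Longrightarrow> circ (z i) (w i) \<Longrightarrow> circ (w i) (v i) \<Longrightarrow> circ (z i) (v i)"
    "\<And>i. i \<in> U \<Longrightarrow> circ (z i) (w i) \<Longrightarrow> circ (w i) (- v i) \<Longrightarrow> circ (z i) (- v i)"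
    "\<And>i. i \<in> U \<Longrightarrow> circ (z i) (- w i) \<Longrightarrow> circ (w i) (v i) \<Longrightarrow> circ (z i) (- v i)"
    "\<And>i. i \<in> U \<Longrightarrow> circ (z i) (- w i) \<Longrightarrow> circ (w i) (- v i) \<Longrightarrow> circ (z i) (v i)"
    by (metis circ_trans circ_uminus_uminus minus_minus)+
  consider "z 0 = w 0 \<and> (\<forall>i\<in>U. circ (z i) (w i))" | "\<bar>z 0\<bar> = 1 \<and> w 0 = - z 0 \<and> (\<forall>i\<in>U. circ (z i) (- w i))"
    using zw by (auto simp: glued_def)
  note a = this
  consider "w 0 = v 0 \<and> (\<forall>i\<in>U. circ (w i) (v i))" | "\<bar>w 0\<bar> = 1 \<and> v 0 = - w 0 \<and> (\<forall>i\<in>U. circ (w i) (- v i))"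
    using wv by (auto simp: glued_def)
  note b = this
  have e: "z 1 = v 1" using zw wv by (simp add: glued_def)
  from a show ?thesis
  proof cases
    case 1
    from b show ?thesis by cases (use e t 1 in \<open>auto simp: glued_def\<close>)
  next
    case 2
    from b show ?thesis by cases (use e t 2 in \<open>auto simp: glued_def\<close>)
  qed
qed

lemma glued_abs:
  assumes "glued U z w"
  shows "\<bar>z 0\<bar> = 1 \<longleftrightarrow> \<bar>w 0\<bar> = 1" "z 1 = w 1" "i \<in> U \<Longrightarrow> \<bar>z i\<bar> = 1 \<longleftrightarrow> \<bar>w i\<bar> = 1"
  using assms circ_abs[of "z i" "w i"] circ_abs[of "z i" "- w i"] by (auto simp: glued_def)

lemma based_glued:
  assumes "glued (S \<union> P) z w"
  shows "based S P z \<longleftrightarrow> based S P w"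
  using glued_abs[OF assms] by (simp add: based_def)

lemma same_refl: "same S P z z"
  by (simp add: same_def glued_refl)

lemma same_sym: "same S P z w \<Longrightarrow> same S P w z"
  by (auto simp: same_def intro: glued_sym)

lemma same_trans: "same S P z w \<Longrightarrow> same S P w v \<Longrightarrow> same S P z v"
  using glued_trans[of "S \<union> P" z w v] based_glued[of S P z w] based_glued[of S P w v]
  unfolding same_def by blast

lemma pt_eq_iff: "w \<in> hcube \<Longrightarrow> pt S P z = pt S P w \<longleftrightarrow> same S P z w"
  using same_refl[of S P w] same_sym[of S P z w] same_trans[of S P] unfolding pt_def by blast

lemma same_based: "based S P w \<Longrightarrow> same S P z w \<longleftrightarrow> based S P z"
  using based_glued[of S P z w] unfolding same_def by blast

lemma pt_based: "based S P z \<Longrightarrow> pt S P z = Zbase S P"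
  unfolding pt_def Zbase_def using same_based[of S P z] same_sym[of S P z] same_sym[of S P _ z] by blast

lemma one_hcube: "(\<lambda>_. 1) \<in> hcube"
  by (simp add: hcube_def)

lemma based_one: "based S P (\<lambda>_. 1)"
  by (simp add: based_def)

lemma pt_eq_Zbase: "pt S P z = Zbase S P \<longleftrightarrow> based S P z"
  using pt_eq_iff[OF one_hcube, of S P z] pt_based[OF based_one] same_based[OF based_one] by simp

lemma quotient_map_pt: "quotient_map (top_of_set hcube) (Zsp S P) (pt S P)"
  unfolding Zsp_def by (rule quotient_map_quotient_top)

lemma Zbase_in_Zsp: "Zbase S P \<in> topspace (Zsp S P)"
  using quotient_imp_surjective_map[OF quotient_map_pt, of S P] one_hcube pt_based[OF based_one] by force

lemma continuous_on_fun_upd: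
  fixes f :: "'a::topological_space \<Rightarrow> nat \<Rightarrow> real"
  assumes "continuous_on X f" "continuous_on X g"
  shows "continuous_on X (\<lambda>x. (f x)(i := g x))"
proof (rule continuous_on_coordinatewise_then_product)
  fix k show "continuous_on X (\<lambda>x. ((f x)(i := g x)) k)"
    using assms by (cases "k = i") (simp_all add: continuous_on_coord)
qed

text \<open>Over the part where circle \<open>p\<close> is at its base point lies a copy of
  \<open>Zsp S P\<close>, and the whole space arises from it by attaching squares in the directions
  \<open>p\<close> and \<open>1\<close>. On the sides of the square only the suspension coordinate
  matters for the image; contracting it downwards makes the attaching map trivial, and the squares
  with collapsed rim form \<open>Zsp (insert p S) P\<close>.\<close>

lemma smash_split:
  assumes S: "S \<subseteq> {2..}" and P: "P \<subseteq> {2..}" and p: "2 \<le> p" "p \<notin> S" "p \<notin> P"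
  shows "ptd_equiv (Zsp S (insert p P)) (Zbase S (insert p P))
    (wedge {S, insert p S} (\<lambda>U. Zsp U P) (\<lambda>U. Zbase U P)) None"
proof -
  note [simp del] = One_nat_def
  \<comment> \<open>Squares over a smashed coordinate at its base point are collapsed
    entirely.\<close>
  define N where "N = {z :: nat \<Rightarrow> real. \<exists>i\<in>S. \<bar>z i\<bar> = 1}"
  define R where "R = glued (insert p (S \<union> P))"
  let ?G = "{p, 1}" and ?b = "\<lambda>_::nat. 1::real"
  have mx: "maxabs ?G z = max \<bar>z p\<bar> \<bar>z 1\<bar>" for z :: "nat \<Rightarrow> real"
    using maxabs_insert[of "{1}" p z] by (simp add: maxabs_def)
  have ne: "\<And>i. i \<in> S \<union> P \<Longrightarrow> i \<noteq> p \<and> i \<noteq> 1 \<and> i \<noteq> 0" "p \<noteq> 0" "p \<noteq> 1"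
    using S P p by auto
  have dil: "dilate ?G r z 0 = z 0" "dilate ?G r z 1 = r * z 1" "dilate ?G r z p = r * z p"
    "i \<in> S \<union> P \<Longrightarrow> dilate ?G r z i = z i" for r z i
    using ne by (auto simp: dilate_def)
  \<comment> \<open>Inside the square \<open>z p\<close> is never an end point, so
    \<open>circ\<close> means equality there, up to the common sign.\<close>
  have pR: "z p = z' p \<and> z 0 = z' 0 \<and> (\<forall>i\<in>S\<union>P. circ (z i) (z' i)) \<or>
      z p = - z' p \<and> \<bar>z 0\<bar> = 1 \<and> z' 0 = - z 0 \<and> (\<forall>i\<in>S\<union>P. circ (z i) (- z' i))"
    if "R z z'" "maxabs ?G z < 1" for z z'
  proof -
    have "\<bar>z p\<bar> < 1" using that(2) unfolding mx by simp
    then show ?thesis using that(1) by (auto simp: R_def glued_def circ_def)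
  qed
  have R1: "z 1 = z' 1" if "R z z'" for z z' using that by (simp add: R_def glued_def)
  interpret cubes hcube hcube ?G "same S P" R N ?b
  proof
    fix z z' :: "nat \<Rightarrow> real" and r :: real
    show "maxabs ?G z \<le> 1" if "z \<in> hcube" using that by (simp add: mx hcube_def)
    show "dilate ?G r z \<in> hcube" if "z \<in> hcube" "0 \<le> r" "r * maxabs ?G z \<le> 1"
    proof -
      have "r * \<bar>z p\<bar> \<le> r * maxabs ?G z" "r * \<bar>z 1\<bar> \<le> r * maxabs ?G z"
        using that(2) by (simp_all add: mx mult_left_mono)
      then show ?thesis using that by (auto simp: hcube_def dilate_def abs_mult)
    qed
    assume z: "z \<in> hcube" "maxabs ?G z < 1"
    show "maxabs ?G z = maxabs ?G z'" if "R z z'"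
      using pR[OF that z(2)] R1[OF that] by (auto simp: mx)
    show "R (dilate ?G r z) (dilate ?G r z')" if "R z z'"
      using pR[OF that z(2)] R1[OF that] unfolding R_def glued_def
      by (auto simp: dil)
    show "dilate ?G r z \<in> N" if "z \<in> N"
      using that dil(4) by (auto simp: N_def)
  qed (simp_all add: one_hcube)
  \<comment> \<open>Retract the paths in the suspension direction to the lower base point; at \<open>d 1 = 1\<close>, where \<open>z p\<close> varies,
    this does not stay at the base point but ignores \<open>z p\<close>.\<close>
  define F where "F l d = d(1 := - 1 + l * (1 + d 1))" for l :: real and d :: "nat \<Rightarrow> real"
  have F_hc: "F l d \<in> hcube" if "l \<in> {0..1}" "d \<in> hcube" for l d
  proof -
    have "\<bar>d 1\<bar> \<le> 1" using that by (simp add: hcube_def)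
    then have "0 \<le> l * (1 + d 1)" "l * (1 + d 1) \<le> 1 * 2"
      using that mult_mono[of l 1 "1 + d 1" 2] by simp_all
    then show ?thesis using that by (auto simp: hcube_def F_def)
  qed
  have rim_hc: "d \<in> hcube" "\<bar>d p\<bar> = 1 \<or> \<bar>d 1\<bar> = 1" if "d \<in> rim" for d
    using that by (auto simp: rim_def mx max_def split: if_splits)
  have F: "rim_homotopy F"
    unfolding rim_homotopy_def
  proof (intro conjI ballI impI)
    show "continuous_on ({0..1} \<times> rim) (\<lambda>(l, d). F l d)"
      unfolding F_def case_prod_unfold
      by (intro continuous_on_fun_upd continuous_on_add continuous_on_mult continuous_on_const
          continuous_on_fst continuous_on_snd continuous_on_id continuous_on_coord)
    fix l :: real assume l: "l \<in> {0..1}"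
    show "F l d \<in> hcube" if "d \<in> rim" for d using F_hc l rim_hc that by blast
    fix z assume z: "z \<in> hcube" "0 < \<mu> z" "\<mu> z < 1"
    show "same S P (F l (\<pi> z)) ?b" if "z \<in> N"
      using that ne by (auto simp: same_based[OF based_one] based_def F_def N_def dil)
    fix z' assume z': "z' \<in> hcube" "\<mu> z' < 1" and r: "R z z'"
    have "\<mu> z = \<mu> z'" using R_maxabs z z' r by blast
    then have "glued (S \<union> P) (F l (\<pi> z)) (F l (\<pi> z'))"
      using pR[OF r z(3)] R1[OF r] ne unfolding glued_def F_def
      by (auto simp: dil)
    then show "same S P (F l (\<pi> z)) (F l (\<pi> z'))" by (simp add: same_def)
  qed
  have int: "\<bar>z p\<bar> < 1" "\<bar>z 1\<bar> < 1" if "\<mu> z < 1" for z using that by (simp_all add: mx)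
  \<comment> \<open>The base sits where circle \<open>p\<close> is at its base point, represented by
    the end point 1.\<close>
  let ?j1 = "pt S (insert p P)" and ?i1 = "\<lambda>x. pt S (insert p P) (x(p := 1))"
  have upd_hc: "x(p := 1) \<in> hcube" if "x \<in> hcube" for x using that by (simp add: hcube_def)
  have att1: "attached (Zsp S (insert p P)) ?j1 ?i1 (F 1)"
    unfolding attached_def
  proof (intro conjI ballI impI)
    show "final_maps (Zsp S (insert p P)) UNIV (\<lambda>k. if k then top_of_set hcube else top_of_set hcube) (\<lambda>k. if k then ?j1 else ?i1)"
    proof (rule final_maps_quotient[OF quotient_map_pt])
      show "continuous_map (top_of_set hcube) (Zsp S (insert p P)) ?i1"
        by (rule continuous_map_comp_on[OF quotient_imp_continuous_map[OF quotient_map_pt]])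
           (auto intro: upd_hc continuous_on_fun_upd)
    qed
  next
    fix d assume d: "d \<in> rim"
    show "F 1 d \<in> hcube" using F_hc rim_hc[OF d] by simp
    \<comment> \<open>On the sides where \<open>d p\<close> is an end point this is
      \<open>circ\<close>; on the sides where \<open>d 1\<close> is one, both points are
      based.\<close>
    have "same S (insert p P) d (d(p := 1))"
      using rim_hc(2)[OF d] ne by (auto simp: same_def based_def glued_def circ_def)
    then show "?j1 d = ?i1 (F 1 d)"
      using pt_eq_iff[OF upd_hc] rim_hc(1)[OF d] by (simp add: F_def)
  next
    fix x y :: "nat \<Rightarrow> real" assume "x \<in> hcube" "y \<in> hcube"
    have b: "based S (insert p P) (x(p := 1)) \<longleftrightarrow> based S P x" for x
      using ne p unfolding based_def by auto
    have "glued (S \<union> insert p P) (x(p := 1)) (y(p := 1)) \<longleftrightarrow> glued (S \<union> P) x y"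
      using ne p unfolding glued_def by (auto simp: circ_def)
    then show "?i1 x = ?i1 y \<longleftrightarrow> same S P x y"
      using pt_eq_iff[OF upd_hc] \<open>y \<in> hcube\<close> by (simp add: same_def b)
  next
    fix z z' :: "nat \<Rightarrow> real" assume z: "z \<in> hcube" "z' \<in> hcube" "\<mu> z < 1" "\<mu> z' < 1"
    \<comment> \<open>The open square excludes the first clause of \<open>based\<close> through
      \<open>z 1\<close> and the last one through \<open>z p\<close>.\<close>
    have "based S (insert p P) z \<longleftrightarrow> z \<in> N" if "\<mu> z < 1" for z
      using int[OF that] by (auto simp: based_def N_def)
    then show "?j1 z = ?j1 z' \<longleftrightarrow> R z z' \<or> z \<in> N \<and> z' \<in> N"
      using z by (simp add: pt_eq_iff same_def R_def) blast
  next
    fix z x :: "nat \<Rightarrow> real" assume z: "z \<in> hcube" "x \<in> hcube" "\<mu> z < 1"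
    have "based S (insert p P) z \<longleftrightarrow> z \<in> N"
      using int[OF z(3)] by (auto simp: based_def N_def)
    moreover have "based S (insert p P) (x(p := 1)) \<longleftrightarrow> based S P x"
      using ne p unfolding based_def by auto
    moreover have "\<not> glued (S \<union> insert p P) z (x(p := 1))"
      using int[OF z(3)] by (auto simp: glued_def circ_def)
    ultimately show "?j1 z = ?i1 x \<longleftrightarrow> z \<in> N \<and> same S P x ?b"
      using z by (simp add: pt_eq_iff[OF upd_hc] same_def[of S "insert p P"] same_based[OF based_one])
  qed
  let ?W = "wedge {S, insert p S} (\<lambda>U. Zsp U P) (\<lambda>U. Zbase U P)"
  let ?t = "wtag (\<lambda>U. Zbase U P)"
  have att0: "attached ?W (\<lambda>z. ?t (insert p S) (pt (insert p S) P z)) (\<lambda>x. ?t S (pt S P x)) (F 0)"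
  proof (rule attached_wedge)
    show "S \<noteq> insert p S" using p by blast
    show "quotient_map (top_of_set hcube) (Zsp S P) (pt S P)"
      "quotient_map (top_of_set hcube) (Zsp (insert p S) P) (pt (insert p S) P)"
      by (rule quotient_map_pt)+
    show "Zbase S P = pt S P ?b" using pt_based[OF based_one] by simp
    fix d assume d: "d \<in> rim"
    show "pt (insert p S) P d = Zbase (insert p S) P"
      using rim_hc(2)[OF d] by (auto simp: pt_eq_Zbase based_def)
    have "F 0 d \<in> hcube" using F_hc rim_hc(1)[OF d] by simp
    moreover have "based S P (F 0 d)" by (simp add: based_def F_def)
    ultimately show "F 0 d \<in> hcube \<and> same S P (F 0 d) ?b" by (simp add: same_based[OF based_one])
  next
    fix x y :: "nat \<Rightarrow> real" assume "x \<in> hcube" "y \<in> hcube"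
    then show "pt S P x = pt S P y \<longleftrightarrow> same S P x y" by (simp add: pt_eq_iff)
  next
    have b: "based (insert p S) P z \<longleftrightarrow> z \<in> N" if "\<mu> z < 1" for z
      using int[OF that] by (auto simp: based_def N_def)
    show "pt (insert p S) P z = Zbase (insert p S) P \<longleftrightarrow> z \<in> N" if "\<mu> z < 1" for z
      using b[OF that] by (simp add: pt_eq_Zbase)
    show "pt (insert p S) P z = pt (insert p S) P z' \<longleftrightarrow> R z z' \<or> z \<in> N \<and> z' \<in> N"
      if "z' \<in> hcube" "\<mu> z < 1" "\<mu> z' < 1" for z z'
      using that b by (simp add: pt_eq_iff same_def R_def) blast
  qed
  have "ptd_equiv ?W (?t S (pt S P ?b)) (Zsp S (insert p P)) (pt S (insert p P) (?b(p := 1)))"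
    by (rule attached_ptd_equiv[OF att0 att1 F])
  moreover have "?b(p := 1) = ?b" "?t S (Zbase S P) = None" by (auto simp: wtag_def)
  ultimately show ?thesis
    by (simp add: pt_based[OF based_one] ptd_equiv_sym[of ?W])
qed

text \<open>Each split decides whether one more circle is smashed or forgotten. The summands
  therefore correspond to the sets between \<open>S\<close> and \<open>S \<union> P\<close>, and
  \<open>p\<close> tells the two branches of the induction apart.\<close>

lemma smash_decomposition:
  assumes "finite P" "S \<subseteq> {2..}" "P \<subseteq> {2..}" "S \<inter> P = {}"
  shows "ptd_equiv (Zsp S P) (Zbase S P)
    (wedge ((\<union>) S ` Pow P) (\<lambda>U. Zsp U {}) (\<lambda>U. Zbase U {})) None"
  using assms
proof (induction P arbitrary: S rule: finite_induct)
  case empty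
  then show ?case
    using ptd_equiv_wedge_singleton[of "\<lambda>U. Zbase U {}" S "\<lambda>U. Zsp U {}"] by (simp add: Zbase_in_Zsp)
next
  case (insert p P)
  have p: "2 \<le> p" "p \<notin> S" "p \<notin> P" "S \<subseteq> {2..}" "P \<subseteq> {2..}" "S \<inter> P = {}"
    using insert by auto
  have "ptd_equiv (wedge {S, insert p S} (\<lambda>U. Zsp U P) (\<lambda>U. Zbase U P)) None
    (wedge ((\<union>) S ` Pow (insert p P)) (\<lambda>U. Zsp U {}) (\<lambda>U. Zbase U {})) None"
  proof (rule wedge_of_wedges[where J = "\<lambda>U. (\<union>) U ` Pow P"])
    fix U assume "U \<in> {S, insert p S}"
    then have "U \<subseteq> {2..}" "U \<inter> P = {}" using p by auto
    then show "ptd_equiv (Zsp U P) (Zbase U P) (wedge ((\<union>) U ` Pow P) (\<lambda>U. Zsp U {}) (\<lambda>U. Zbase U {})) None"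
      using insert.IH p by simp
  next
    fix U V W assume "U \<in> {S, insert p S}" "V \<in> {S, insert p S}" "W \<in> (\<union>) U ` Pow P" "W \<in> (\<union>) V ` Pow P"
    then have "U \<in> {S, insert p S}" "V \<in> {S, insert p S}" "p \<in> U \<longleftrightarrow> p \<in> W" "p \<in> V \<longleftrightarrow> p \<in> W"
      using p(3) by blast+
    then show "U = V" using p(2) by blast
  next
    have "(\<union>) S ` insert p ` Pow P = (\<union>) (insert p S) ` Pow P"
      by (simp add: image_image)
    then show "(\<union>) S ` Pow (insert p P) = (\<Union>U\<in>{S, insert p S}. (\<union>) U ` Pow P)"
      by (simp add: Pow_insert image_Un)
  qed simp
  then show ?case
    by (rule ptd_equiv_trans[OF smash_split[OF p(4,5,1,2,3)]])
qed

subsection \<open>Collapsing the boundary of a cube\<close>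

text \<open>Unlike in \<open>hcube\<close> the remaining coordinates are pinned to 0, so that
  equality of points can serve as the relation inside a single cell.\<close>

definition fcube :: "nat \<Rightarrow> (nat \<Rightarrow> real) set" where
  "fcube N = {z. (\<forall>i<N. \<bar>z i\<bar> \<le> 1) \<and> (\<forall>i\<ge>N. z i = 0)}"

definition nsph :: "nat \<Rightarrow> (nat \<Rightarrow> real) set" where
  "nsph n = {x. (\<Sum>i\<le>n. x i ^ 2) = 1 \<and> (\<forall>i>n. x i = 0)}"

lemma nsphere_nsph: "nsphere n = top_of_set (nsph n)"
  by (simp add: nsphere nsph_def euclidean_product_topology)

lemma compact_box:
  fixes K :: "nat \<Rightarrow> real set"
  assumes "\<And>i. compact (K i)"
  shows "compact {z. \<forall>i. z i \<in> K i}"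
proof -
  have "compactin (product_topology (\<lambda>i::nat. euclideanreal) UNIV) (PiE UNIV K)"
    using assms by (subst compactin_PiE) auto
  moreover have "PiE UNIV K = {z. \<forall>i. z i \<in> K i}"
    by (auto simp: PiE_def)
  ultimately show ?thesis by (simp add: euclidean_product_topology)
qed

lemma compact_hcube: "compact hcube"
proof -
  have "hcube = {z. \<forall>i. z i \<in> {-1..1}}" by (auto simp: hcube_def abs_le_iff)
  then show ?thesis using compact_box[of "\<lambda>_. {-1..1}"] by simp
qed

lemma compact_fcube: "compact (fcube N)"
proof -
  have "fcube N = {z. \<forall>i. z i \<in> (if i < N then {-1..1} else {0})}"
  proof (unfold fcube_def, rule Collect_cong)
    fix z :: "nat \<Rightarrow> real"
    have "(\<forall>i. z i \<in> (if i < N then {-1..1} else {0})) \<longleftrightarrow> (\<forall>i. (i < N \<longrightarrow> \<bar>z i\<bar> \<le> 1) \<and> (N \<le> i \<longrightarrow> z i = 0))"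
      by (rule all_cong1) (simp add: abs_le_iff not_less, linarith)
    then show "(\<forall>i<N. \<bar>z i\<bar> \<le> 1) \<and> (\<forall>i\<ge>N. z i = 0) \<longleftrightarrow> (\<forall>i. z i \<in> (if i < N then {-1..1} else {0}))"
      by blast
  qed
  moreover have "compact {z. \<forall>i. z i \<in> (if i < N then {-1..1} else {0::real})}"
    by (rule compact_box) simp
  ultimately show ?thesis by simp
qed

lemma quotient_map_compact:
  fixes f :: "'a::t2_space \<Rightarrow> 'b::metric_space"
  assumes "compact S" "continuous_on S f" "f ` S = T"
  shows "quotient_map (top_of_set S) (top_of_set T) f"
proof (rule continuous_imp_quotient_map)
  show "continuous_map (top_of_set S) (top_of_set T) f" using assms by auto
  show "compact_space (top_of_set S)" using assms(1) by (simp add: compact_space_subtopology)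
  show "Hausdorff_space (top_of_set T)" by (rule Hausdorff_space_subtopology) simp
qed (use assms in simp)

text \<open>With \<open>m = 1 - maxabs {1..n} z\<close> this is \<open>m\<^sup>2\<close> times the
  usual denominator \<open>1 + |z / m|\<^sup>2\<close> of inverse stereographic projection. Cleared
  in this way it stays positive on the boundary of the cube.\<close>

definition cden :: "nat \<Rightarrow> (nat \<Rightarrow> real) \<Rightarrow> real" where
  "cden n z = (\<Sum>i=1..n. (z i)\<^sup>2) + (1 - maxabs {1..n} z)\<^sup>2"

text \<open>Stereographic coordinates (centred at \<open>e0\<close>) of the point \<open>z / (1 - maxabs z)\<close>, with denominators cleared.\<close>

definition collapse :: "nat \<Rightarrow> (nat \<Rightarrow> real) \<Rightarrow> nat \<Rightarrow> real" where
  "collapse n z i = (if i = 0 then ((\<Sum>i=1..n. (z i)\<^sup>2) - (1 - maxabs {1..n} z)\<^sup>2) / cden n z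
     else if i \<le> n then 2 * (1 - maxabs {1..n} z) * z i / cden n z else 0)"

context
  fixes n :: nat
  assumes n: "1 \<le> n"
begin

lemma fin_ne: "finite {1..n}" "{1..n} \<noteq> {}"
  using n by auto

lemma cden_pos: "0 < cden n z"
proof (rule ccontr)
  assume "\<not> 0 < cden n z"
  moreover have "0 \<le> (\<Sum>i=1..n. (z i)\<^sup>2)" by (simp add: sum_nonneg)
  moreover have "0 \<le> (1 - maxabs {1..n} z)\<^sup>2" by simp
  ultimately have "(\<Sum>i=1..n. (z i)\<^sup>2) = 0" and m: "(1 - maxabs {1..n} z)\<^sup>2 = 0"
    unfolding cden_def by linarith+
  then have "\<forall>i\<in>{1..n}. z i = 0" by (simp add: sum_nonneg_eq_0_iff)
  then have "maxabs {1..n} z \<le> 0" using maxabs_le_iff[OF fin_ne] by simp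
  then show False using m by simp
qed

lemma sum_atMost_0: "(\<Sum>i\<le>n. g i) = g 0 + (\<Sum>i=1..n. g i :: real)"
proof -
  have "{..n} = insert 0 {1..n}" by auto
  then show ?thesis by simp
qed

lemma collapse_nsph: "collapse n z \<in> nsph n"
proof -
  define Q m D where "Q = (\<Sum>i=1..n. (z i)\<^sup>2)" and "m = 1 - maxabs {1..n} z" and "D = cden n z"
  have D: "D > 0" "D = Q + m\<^sup>2" using cden_pos by (simp_all add: D_def cden_def Q_def m_def)
  have "(\<Sum>i=1..n. (collapse n z i)\<^sup>2) = (\<Sum>i=1..n. (2 * m / D)\<^sup>2 * (z i)\<^sup>2)"
    by (rule sum.cong) (auto simp: collapse_def m_def D_def power_mult_distrib power_divide)
  also have "\<dots> = (2 * m / D)\<^sup>2 * Q" by (simp add: Q_def sum_distrib_left)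
  finally have "(\<Sum>i\<le>n. (collapse n z i)\<^sup>2) = ((Q - m\<^sup>2) / D)\<^sup>2 + (2 * m / D)\<^sup>2 * Q"
    unfolding sum_atMost_0 by (simp add: collapse_def Q_def m_def D_def)
  also have "\<dots> = ((Q - m\<^sup>2)\<^sup>2 + 4 * m\<^sup>2 * Q) / D\<^sup>2"
    by (simp add: power_divide power_mult_distrib add_divide_distrib)
  also have "(Q - m\<^sup>2)\<^sup>2 + 4 * m\<^sup>2 * Q = D\<^sup>2"
    unfolding D(2) by (simp add: power2_eq_square algebra_simps)
  finally show ?thesis using D(1) n by (simp add: nsph_def collapse_def)
qed

lemma e0_nsph: "e0 \<in> nsph n"
  unfolding nsph_def mem_Collect_eq sum_atMost_0 by (simp add: e0_def)

lemma collapse_e0_iff: "collapse n z = e0 \<longleftrightarrow> maxabs {1..n} z = 1"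
proof
  assume "collapse n z = e0"
  then have "collapse n z 0 = 1" by (simp add: e0_def)
  then have "(\<Sum>i=1..n. (z i)\<^sup>2) - (1 - maxabs {1..n} z)\<^sup>2 = cden n z"
    using cden_pos[of z] by (simp add: collapse_def)
  then show "maxabs {1..n} z = 1" by (simp add: cden_def)
next
  assume "maxabs {1..n} z = 1"
  then show "collapse n z = e0"
    using cden_pos[of z] by (auto simp: collapse_def e0_def cden_def fun_eq_iff)
qed

lemma collapse_cong: "(\<And>i. i \<in> {1..n} \<Longrightarrow> z i = w i) \<Longrightarrow> collapse n z = collapse n w"
proof -
  assume eq: "\<And>i. i \<in> {1..n} \<Longrightarrow> z i = w i"
  then have "maxabs {1..n} z = maxabs {1..n} w" "(\<Sum>i=1..n. (z i)\<^sup>2) = (\<Sum>i=1..n. (w i)\<^sup>2)"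
    by (auto simp: maxabs_def intro: arg_cong[where f = Max] image_cong)
  then show ?thesis using eq by (auto simp: collapse_def cden_def fun_eq_iff)
qed

text \<open>Write \<open>m\<close> for \<open>1 - maxabs {1..n} z\<close> and \<open>D\<close> for
  \<open>cden n z\<close>. The image coordinates are \<open>2 * m / D\<close> times those of
  \<open>z\<close>, their maximum is the same factor times \<open>1 - m\<close>, and one minus the
  coordinate 0 is the factor times \<open>m\<close>. The last two sum to the factor itself.\<close>

lemma collapse_inverse:
  assumes "maxabs {1..n} z < 1" "i \<in> {1..n}"
  shows "z i = collapse n z i / (1 - collapse n z 0 + maxabs {1..n} (collapse n z))"
proof -
  note [simp del] = One_nat_def
  define m D where "m = 1 - maxabs {1..n} z" and "D = cden n z"
  have D: "D > 0" "(\<Sum>i=1..n. (z i)\<^sup>2) = D - m\<^sup>2" using cden_pos by (simp_all add: D_def cden_def m_def)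
  have m: "m > 0" using assms by (simp add: m_def)
  have c: "collapse n z i = (2 * m / D) * z i" if "i \<in> {1..n}" for i
    using that by (auto simp: collapse_def m_def D_def)
  have "maxabs {1..n} (collapse n z) = maxabs {1..n} (dilate {1..n} (2 * m / D) z)"
    unfolding maxabs_def by (intro arg_cong[where f = Max] image_cong) (auto simp: c dilate_def)
  also have "\<dots> = (2 * m / D) * (1 - m)"
    using D m maxabs_dilate[OF fin_ne] by (simp add: m_def)
  finally have "maxabs {1..n} (collapse n z) = (2 * m / D) * (1 - m)" .
  moreover have "collapse n z 0 = (D - m\<^sup>2 - m\<^sup>2) / D"
    unfolding collapse_def using D(2) by (simp add: m_def D_def)
  then have "1 - collapse n z 0 = (2 * m / D) * m"
    using D(1) by (simp add: field_simps power2_eq_square)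
  ultimately have "1 - collapse n z 0 + maxabs {1..n} (collapse n z) = (2 * m / D) * m + (2 * m / D) * (1 - m)"
    by (rule arg_cong2[where f = "(+)", rotated])
  also have "\<dots> = 2 * m / D" by (simp add: right_diff_distrib)
  finally have "1 - collapse n z 0 + maxabs {1..n} (collapse n z) = 2 * m / D" .
  then show ?thesis using c[OF assms(2)] m D by simp
qed

lemma collapse_eq_iff:
  assumes "maxabs {1..n} z \<le> 1" "maxabs {1..n} w \<le> 1"
  shows "collapse n z = collapse n w \<longleftrightarrow>
     maxabs {1..n} z = 1 \<and> maxabs {1..n} w = 1 \<or> (\<forall>i\<in>{1..n}. z i = w i)"
proof
  assume eq: "collapse n z = collapse n w"
  show "maxabs {1..n} z = 1 \<and> maxabs {1..n} w = 1 \<or> (\<forall>i\<in>{1..n}. z i = w i)"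
  proof (cases "maxabs {1..n} z = 1")
    case True
    then show ?thesis using eq collapse_e0_iff[of z] collapse_e0_iff[of w] by simp
  next
    case False
    then have "maxabs {1..n} z < 1" "maxabs {1..n} w < 1"
      using eq assms collapse_e0_iff[of z] collapse_e0_iff[of w] by simp_all
    then show ?thesis using collapse_inverse[of z] collapse_inverse[of w] eq by metis
  qed
next
  assume "maxabs {1..n} z = 1 \<and> maxabs {1..n} w = 1 \<or> (\<forall>i\<in>{1..n}. z i = w i)"
  then show "collapse n z = collapse n w"
    using collapse_e0_iff[of z] collapse_e0_iff[of w] collapse_cong[of z w] by auto
qed

lemma collapse_surj:
  assumes x: "x \<in> nsph n"
  obtains z where "\<forall>i\<in>{1..n}. \<bar>z i\<bar> \<le> 1" "\<forall>i. i \<notin> {1..n} \<longrightarrow> z i = 0" "collapse n z = x"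
proof (cases "x 0 = 1")
  case True
  have sum: "(x 0)\<^sup>2 + (\<Sum>i=1..n. (x i)\<^sup>2) = 1" using x unfolding nsph_def sum_atMost_0 by simp
  then have "\<forall>i\<in>{1..n}. x i = 0" using True by (simp add: sum_nonneg_eq_0_iff)
  then have "x i = e0 i" for i
  proof -
    consider "i = 0" | "i \<in> {1..n}" | "i > n" by fastforce
    then show ?thesis
      by cases (use True x \<open>\<forall>i\<in>{1..n}. x i = 0\<close> in \<open>auto simp: e0_def nsph_def\<close>)
  qed
  then have e: "x = e0" by auto
  \<comment> \<open>Every boundary point goes to \<open>e0\<close>; this corner is the
    simplest.\<close>
  let ?z = "\<lambda>i. if i \<in> {1..n} then 1 else 0 :: real"
  have "maxabs {1..n} ?z = Max ((\<lambda>_. 1) ` {1..n})"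
    unfolding maxabs_def by (intro arg_cong[where f = Max] image_cong) auto
  also have "\<dots> = 1" using fin_ne by (simp add: image_constant_conv)
  finally have "collapse n ?z = x" using collapse_e0_iff[of ?z] e by simp
  then show thesis by (intro that[of ?z]) auto
next
  case False
  have sum: "(x 0)\<^sup>2 + (\<Sum>i=1..n. (x i)\<^sup>2) = 1" using x unfolding nsph_def sum_atMost_0 by simp
  then have "(x 0)\<^sup>2 \<le> 1" using sum_nonneg[of "{1..n}" "\<lambda>i. (x i)\<^sup>2"] by simp
  then have x0: "x 0 < 1" using False by (simp add: abs_square_le_1)
  define a where "a = 1 - x 0"
  have a: "a > 0" using x0 by (simp add: a_def)
  \<comment> \<open>The scale factor read off from \<open>collapse_inverse\<close>.\<close>
  define k where "k = a + maxabs {1..n} x"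
  have k: "k > 0" "a \<le> k" using a maxabs_nonneg[OF fin_ne, of x] by (simp_all add: k_def)
  define z where "z i = (if i \<in> {1..n} then x i / k else 0)" for i
  have zi: "z i = x i / k" if "i \<in> {1..n}" for i using that by (simp add: z_def)
  have "maxabs {1..n} z = maxabs {1..n} (dilate {1..n} (1 / k) x)"
    unfolding maxabs_def by (intro arg_cong[where f = Max] image_cong) (auto simp: zi dilate_def)
  then have M: "maxabs {1..n} z = maxabs {1..n} x / k"
    using k maxabs_dilate[OF fin_ne] by simp
  then have m: "1 - maxabs {1..n} z = a / k" using k by (simp add: k_def field_simps)
  have "(\<Sum>i=1..n. (z i)\<^sup>2) = (\<Sum>i=1..n. (x i)\<^sup>2) / k\<^sup>2"
    unfolding sum_divide_distrib by (rule sum.cong) (auto simp: zi power_divide)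
  then have Q: "(\<Sum>i=1..n. (z i)\<^sup>2) = a * (2 - a) / k\<^sup>2"
    using sum by (simp add: a_def power2_eq_square algebra_simps)
  have D: "cden n z = 2 * a / k\<^sup>2"
    unfolding cden_def m Q by (simp add: power_divide power2_eq_square right_diff_distrib flip: add_divide_distrib)
  have "collapse n z i = x i" for i
  proof -
    consider "i = 0" | "i \<in> {1..n}" | "i > n" by fastforce
    then show ?thesis
    proof cases
      case 1
      have "collapse n z 0 = (a * (2 - a) / k\<^sup>2 - (a / k)\<^sup>2) / (2 * a / k\<^sup>2)"
        unfolding collapse_def m Q D by simp
      also have "\<dots> = (a * (2 - a) - a\<^sup>2) / (2 * a)"
        using a k by (simp add: power_divide flip: diff_divide_distrib)
      also have "\<dots> = 1 - a" using a by (simp add: field_simps power2_eq_square)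
      finally show ?thesis using 1 by (simp add: a_def)
    next
      case 2
      then have "collapse n z i = 2 * (a / k) * (x i / k) / (2 * a / k\<^sup>2)"
        unfolding collapse_def m D using zi[OF 2] by simp
      also have "\<dots> = x i" using a k by (simp add: power2_eq_square)
      finally show ?thesis .
    next
      case 3
      then show ?thesis using x by (simp add: collapse_def nsph_def)
    qed
  qed
  then have "collapse n z = x" by auto
  moreover have "maxabs {1..n} z \<le> 1" using m divide_nonneg_pos[of a k] a k by linarith
  ultimately show thesis
    using maxabs_le_iff[OF fin_ne, of z 1] by (intro that[of z]) (auto simp: z_def)
qed

lemma continuous_on_collapse:
  fixes f :: "'a::topological_space \<Rightarrow> nat \<Rightarrow> real"
  assumes f: "continuous_on X f"
  shows "continuous_on X (\<lambda>x. collapse n (f x))"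
proof (rule continuous_on_coordinatewise_then_product)
  fix i
  have M: "continuous_on X (\<lambda>x. maxabs {1..n} (f x))" by (rule continuous_on_maxabs[OF fin_ne f])
  have c: "\<And>i. continuous_on X (\<lambda>x. f x i)" using f by (rule continuous_on_coord)
  have Q: "continuous_on X (\<lambda>x. \<Sum>i=1..n. (f x i)\<^sup>2)" by (intro continuous_on_sum continuous_on_power c)
  have D: "continuous_on X (\<lambda>x. cden n (f x))"
    unfolding cden_def by (intro continuous_on_add continuous_on_power continuous_on_diff continuous_on_const M Q)
  have nz: "\<forall>x\<in>X. cden n (f x) \<noteq> 0" using cden_pos by (metis less_irrefl)
  consider "i = 0" | "0 < i" "i \<le> n" | "i > n" by linarith
  then show "continuous_on X (\<lambda>x. collapse n (f x) i)"
  proof cases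
    case 1
    then show ?thesis unfolding collapse_def
      using D nz by (simp only: simp_thms if_True) (intro continuous_on_divide continuous_on_diff continuous_on_power continuous_on_const M Q)
  next
    case 2
    then show ?thesis unfolding collapse_def
      using D nz by simp (intro continuous_on_divide continuous_on_mult continuous_on_diff continuous_on_const M[simplified] c)
  qed (simp add: collapse_def)
qed

end

lemma continuous_on_eval: "continuous_on S (\<lambda>x::nat \<Rightarrow> real. x i)"
  by (rule continuous_on_coord) (rule continuous_on_id)

text \<open>\<open>collapse n\<close> reads the coordinates 1 to \<open>n\<close> only, so it also
  applies to larger cubes. This matters for \<open>N = Suc n\<close>, where coordinate 0 is the half
  circle.\<close>

lemma collapse_fcube_surj:
  assumes "1 \<le> n" "n < N" "x \<in> nsph n"
  shows "x \<in> collapse n ` fcube N"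
proof -
  obtain z where z: "\<forall>i\<in>{1..n}. \<bar>z i\<bar> \<le> 1" "\<forall>i. i \<notin> {1..n} \<longrightarrow> z i = 0" "collapse n z = x"
    using collapse_surj[OF assms(1,3)] .
  have "z \<in> fcube N"
    unfolding fcube_def
  proof (intro CollectI conjI allI impI)
    show "\<bar>z i\<bar> \<le> 1" if "i < N" for i using z(1,2) by (cases "i \<in> {1..n}") simp_all
    show "z i = 0" if "N \<le> i" for i using z(2) assms(2) that by simp
  qed
  then show ?thesis using z(3) by blast
qed

lemma quotient_map_collapse:
  assumes "1 \<le> n" "n < N"
  shows "quotient_map (top_of_set (fcube N)) (top_of_set (nsph n)) (collapse n)"
proof (rule quotient_map_compact[OF compact_fcube])
  show "continuous_on (fcube N) (collapse n)"
    using continuous_on_collapse[OF assms(1) continuous_on_id] by simp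
  show "collapse n ` fcube N = nsph n"
    using collapse_nsph[OF assms(1)] collapse_fcube_surj[OF assms] by blast
qed

lemma fcube_maxabs: "z \<in> fcube N \<Longrightarrow> G \<subseteq> {..<N} \<Longrightarrow> G \<noteq> {} \<Longrightarrow> maxabs G z \<le> 1"
  using finite_subset[of G "{..<N}"] by (auto simp: maxabs_le_iff fcube_def)

text \<open>Only the dimension of the smashed sphere matters, so the coordinates can be renumbered consecutively.\<close>

lemma cube_model:
  assumes U: "finite U" "U \<subseteq> {2..}" and N: "N = card U + 2"
  obtains q where "quotient_map (top_of_set (fcube N)) (Zsp U {}) q"
    "\<And>z z'. z \<in> fcube N \<Longrightarrow> z' \<in> fcube N \<Longrightarrow> q z = q z' \<longleftrightarrow> same {2..<N} {} z z'"
    "\<And>z. z \<in> fcube N \<Longrightarrow> q z = Zbase U {} \<longleftrightarrow> based {2..<N} {} z"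
proof -
  note [simp del] = One_nat_def
  obtain h where h: "bij_betw h {0..<card U} U"
    using ex_bij_betw_nat_finite[OF U(1)] by blast
  \<comment> \<open>Fixes the special coordinates 0 and 1 and enumerates \<open>U\<close> from 2 on.
    Below, \<open>r\<close> and \<open>s\<close> carry points across this renumbering.\<close>
  define d where "d k = (if k < 2 then k else h (k - 2))" for k
  have img: "d ` {2..<N} = U"
  proof -
    have "(\<lambda>k. k - 2) ` {2..<N} = {0..<card U}"
    proof (intro equalityI subsetI)
      fix k assume "k \<in> {0..<card U}"
      then show "k \<in> (\<lambda>k. k - 2) ` {2..<N}"
        by (intro image_eqI[of _ _ "k + 2"]) (auto simp: N)
    qed (auto simp: N)
    moreover have "d ` {2..<N} = h ` (\<lambda>k. k - 2) ` {2..<N}"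
      unfolding image_image by (rule image_cong) (auto simp: d_def)
    ultimately show ?thesis using h by (simp add: bij_betw_def)
  qed
  have d01: "d 0 = 0" "d 1 = 1" by (simp_all add: d_def)
  have injd: "inj_on d {..<N}"
  proof (rule inj_onI)
    fix k l assume kl: "k \<in> {..<N}" "l \<in> {..<N}" "d k = d l"
    have ge: "2 \<le> d m" if "2 \<le> m" "m < N" for m
    proof -
      have "d m \<in> U" unfolding img[symmetric] using that by (intro imageI) simp
      then show ?thesis using U(2) by auto
    qed
    show "k = l"
    proof (cases "k < 2 \<or> l < 2")
      case True
      then show ?thesis using kl ge[of k] ge[of l] by (cases "k < 2"; cases "l < 2") (auto simp: d_def)
    next
      case False
      then have "h (k - 2) = h (l - 2)" "k - 2 \<in> {0..<card U}" "l - 2 \<in> {0..<card U}"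
        using kl N by (auto simp: d_def)
      then have "k - 2 = l - 2" using h unfolding bij_betw_def inj_on_def by blast
      then show ?thesis using False by linarith
    qed
  qed
  define g where "g = inv_into {..<N} d"
  have gd: "g (d k) = k" if "k < N" for k
    unfolding g_def using inv_into_f_f[OF injd, of k] that by simp
  have ball: "(\<forall>i\<in>U. Q (g i) i) \<longleftrightarrow> (\<forall>k\<in>{2..<N}. Q k (d k))"
    and bex: "(\<exists>i\<in>U. Q (g i) i) \<longleftrightarrow> (\<exists>k\<in>{2..<N}. Q k (d k))" for Q
    unfolding img[symmetric] by (simp_all add: gd)
  have g01: "g 0 = 0" "g 1 = 1" using gd[of 0] gd[of 1] d01 N by simp_all
  define r where "r z = (\<lambda>i. if i \<in> insert 0 (insert 1 U) then z (g i) else 0)" for z :: "nat \<Rightarrow> real"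
  have r: "r z 0 = z 0" "r z 1 = z 1" "i \<in> U \<Longrightarrow> r z i = z (g i)" for z i
    using g01 by (auto simp: r_def)
  define s where "s w = (\<lambda>k. if k < N then w (d k) else 0)" for w :: "nat \<Rightarrow> real"
  have glt: "g i < N" if "i \<in> insert 0 (insert 1 U)" for i
  proof (cases "i \<in> U")
    case True
    then obtain k where "k \<in> {2..<N}" "i = d k" unfolding img[symmetric] by blast
    then show ?thesis by (simp add: gd)
  next
    case False
    then show ?thesis using that g01 N by auto
  qed
  have r_hc: "r z \<in> hcube" if "z \<in> fcube N" for z
    using that glt by (auto simp: hcube_def fcube_def r_def)
  have s_fc: "s w \<in> fcube N" if "w \<in> hcube" for w
    using that by (auto simp: hcube_def fcube_def s_def)
  have rs: "pt U {} (r (s w)) = pt U {} w" if "w \<in> hcube" for w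
  proof -
    have "\<forall>i\<in>U. r (s w) i = w i" using r(3) ball[of "\<lambda>k i. s w k = w i"] by (simp add: s_def)
    moreover have "r (s w) 0 = w 0" "r (s w) 1 = w 1" using r(1,2)[of "s w"] N by (simp_all add: s_def d01)
    ultimately have "glued U (r (s w)) w" by (simp add: glued_def)
    then show ?thesis using pt_eq_iff[OF that] by (simp add: same_def)
  qed
  have ne: "U = {} \<longleftrightarrow> {2..<N} = {}" using img by (metis image_is_empty)
  have based: "based U {} (r z) \<longleftrightarrow> based {2..<N} {} z" for z
    using bex[of "\<lambda>k i. \<bar>z k\<bar> = 1"] ne r by (simp add: based_def)
  have glued: "glued U (r z) (r z') \<longleftrightarrow> glued {2..<N} z z'" for z z'
    using ball[of "\<lambda>k i. circ (z k) (z' k)"] ball[of "\<lambda>k i. circ (z k) (- z' k)"] r by (simp add: glued_def)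
  \<comment> \<open>\<open>r (s w)\<close> and \<open>w\<close> have the same class, so the
    composite is \<open>pt\<close> on the Hilbert cube. The last factor of a composite that is a
    quotient map is one too.\<close>
  have q: "quotient_map (top_of_set hcube) (Zsp U {}) ((\<lambda>z. pt U {} (r z)) \<circ> s)"
    by (rule quotient_map_eq[OF quotient_map_pt]) (simp add: rs)
  show thesis
  proof (rule that)
    show "quotient_map (top_of_set (fcube N)) (Zsp U {}) (\<lambda>z. pt U {} (r z))"
    proof (rule quotient_map_from_composition[OF _ _ q])
      have "continuous_on hcube s"
      proof (rule continuous_on_coordinatewise_then_product)
        fix k show "continuous_on hcube (\<lambda>w. s w k)"
          by (cases "k < N") (simp_all add: s_def continuous_on_eval)
      qed
      then show "continuous_map (top_of_set hcube) (top_of_set (fcube N)) s"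
        using s_fc by auto
      have rc: "continuous_on (fcube N) r"
      proof (rule continuous_on_coordinatewise_then_product)
        fix k show "continuous_on (fcube N) (\<lambda>w. r w k)"
          by (cases "k \<in> insert 0 (insert 1 U)") (simp_all add: r_def continuous_on_eval)
      qed
      show "continuous_map (top_of_set (fcube N)) (Zsp U {}) (\<lambda>z. pt U {} (r z))"
        by (rule continuous_map_comp_on[OF quotient_imp_continuous_map[OF quotient_map_pt] rc]) (rule r_hc)
    qed
    fix z z' assume z: "z \<in> fcube N" "z' \<in> fcube N"
    show "pt U {} (r z) = pt U {} (r z') \<longleftrightarrow> same {2..<N} {} z z'"
      using pt_eq_iff[OF r_hc[OF z(2)]] by (simp add: same_def based glued)
    show "pt U {} (r z) = Zbase U {} \<longleftrightarrow> based {2..<N} {} z"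
      by (simp add: pt_eq_Zbase based)
  qed
qed

subsection \<open>Attaching maps of the top cells\<close>

definition cube_rim :: "nat \<Rightarrow> (nat \<Rightarrow> real) set" where
  "cube_rim n = {z \<in> fcube (Suc n). maxabs {..n} z = 1}"

text \<open>On the two faces \<open>d 0 = \<plusminus> 1\<close> of the rim this is \<open>collapse\<close>, with the coordinates in \<open>S\<close> negated on the face
  \<open>d 0 = 1\<close>; on the other faces both formulas give \<open>e0\<close>.\<close>

definition flipped :: "nat \<Rightarrow> nat set \<Rightarrow> (nat \<Rightarrow> real) \<Rightarrow> nat \<Rightarrow> real" where
  "flipped n S d i = (if i \<in> S then - d 0 * collapse n d i else collapse n d i)"

definition rot :: "nat \<Rightarrow> nat \<Rightarrow> real \<Rightarrow> (nat \<Rightarrow> real) \<Rightarrow> nat \<Rightarrow> real" where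
  "rot i j \<theta> x = x(i := cos \<theta> * x i - sin \<theta> * x j, j := sin \<theta> * x i + cos \<theta> * x j)"

lemma maxabs_atMost: "1 \<le> n \<Longrightarrow> maxabs {..n} z = max \<bar>z 0\<bar> (maxabs {1..n} z)"
proof -
  assume n: "1 \<le> n"
  have "{..n} = insert 0 {1..n}" by auto
  then show ?thesis using maxabs_insert[of "{1..n}" 0 z] n by simp
qed

lemma sum_remove2:
  fixes g :: "nat \<Rightarrow> real"
  assumes "finite A" "i \<in> A" "j \<in> A" "i \<noteq> j"
  shows "sum g A = g i + g j + sum g (A - {i, j})"
proof -
  have "sum g A = g i + sum g (A - {i})" using assms by (simp add: sum.remove)
  also have "sum g (A - {i}) = g j + sum g (A - {i} - {j})" using assms by (intro sum.remove) auto
  also have "A - {i} - {j} = A - {i, j}" by blast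
  finally show ?thesis by simp
qed

lemma rot_nsph:
  assumes x: "x \<in> nsph n" and ij: "i \<noteq> j" "i \<le> n" "j \<le> n"
  shows "rot i j \<theta> x \<in> nsph n"
proof -
  define c s where "c = cos \<theta>" and "s = sin \<theta>"
  have cs: "c * c + s * s = 1" unfolding c_def s_def by (metis sin_cos_squared_add3)
  have "(c * x i - s * x j)\<^sup>2 + (s * x i + c * x j)\<^sup>2 = (c * c + s * s) * ((x i)\<^sup>2 + (x j)\<^sup>2)"
    by (simp add: power2_eq_square algebra_simps)
  then have e: "(rot i j \<theta> x i)\<^sup>2 + (rot i j \<theta> x j)\<^sup>2 = (x i)\<^sup>2 + (x j)\<^sup>2"
    using ij cs by (simp add: rot_def c_def s_def)
  have "(\<Sum>k\<le>n. (rot i j \<theta> x k)\<^sup>2) = (rot i j \<theta> x i)\<^sup>2 + (rot i j \<theta> x j)\<^sup>2 + (\<Sum>k\<in>{..n}-{i,j}. (rot i j \<theta> x k)\<^sup>2)"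
    by (rule sum_remove2) (use ij in auto)
  also have "(\<Sum>k\<in>{..n}-{i,j}. (rot i j \<theta> x k)\<^sup>2) = (\<Sum>k\<in>{..n}-{i,j}. (x k)\<^sup>2)"
    by (rule sum.cong) (auto simp: rot_def)
  also have "(rot i j \<theta> x i)\<^sup>2 + (rot i j \<theta> x j)\<^sup>2 + (\<Sum>k\<in>{..n}-{i,j}. (x k)\<^sup>2) = (\<Sum>k\<le>n. (x k)\<^sup>2)"
    unfolding e by (rule sum_remove2[symmetric]) (use ij in auto)
  also have "\<dots> = 1" using x by (simp add: nsph_def)
  finally show ?thesis using x ij by (simp add: nsph_def rot_def)
qed

lemma continuous_on_rot:
  fixes f :: "'a::metric_space \<Rightarrow> nat \<Rightarrow> real"
  assumes t: "continuous_on X t" and f: "continuous_on X f"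
  shows "continuous_on X (\<lambda>x. rot i j (t x) (f x))"
  unfolding rot_def
  by (intro continuous_on_fun_upd f continuous_on_add continuous_on_diff continuous_on_mult
      continuous_on_cos[OF t] continuous_on_sin[OF t] continuous_on_coord[OF f])

context
  fixes n :: nat
  assumes n: "1 \<le> n"
begin

lemma cube_rim_cases:
  assumes "d \<in> cube_rim n"
  obtains "d 0 = 1" | "d 0 = - 1" | "collapse n d = e0"
proof -
  have "max \<bar>d 0\<bar> (maxabs {1..n} d) = 1"
    using assms maxabs_atMost[OF n, of d] by (simp add: cube_rim_def)
  then have "\<bar>d 0\<bar> = 1 \<or> maxabs {1..n} d = 1" by (auto simp: max_def split: if_splits)
  then show thesis using collapse_e0_iff[OF n, of d] that by (cases "0 \<le> d 0") (auto simp: abs_if)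
qed

lemma fcube_maxabs_tail: "maxabs {1..n} z \<le> 1" if "z \<in> fcube (Suc n)"
  using that n by (intro fcube_maxabs) auto

text \<open>The factor \<open>- d 0\<close> is a sign on the two faces
  \<open>d 0 = \<plusminus> 1\<close>. Elsewhere on the rim it is not, but there
  \<open>collapse\<close> gives \<open>e0\<close>, whose coordinates in \<open>S\<close>
  vanish.\<close>

lemma flipped_nsph:
  assumes d: "d \<in> cube_rim n" and S: "S \<subseteq> {1..n}"
  shows "flipped n S d \<in> nsph n"
proof -
  have "(flipped n S d i)\<^sup>2 = (collapse n d i)\<^sup>2" for i
    using d
  proof (cases rule: cube_rim_cases)
    case 3
    then show ?thesis using S by (auto simp: flipped_def e0_def)
  qed (auto simp: flipped_def)
  moreover have "flipped n S d i = 0" if "i > n" for i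
    using that by (simp add: flipped_def collapse_def)
  ultimately show ?thesis
    using collapse_nsph[OF n, of d] by (simp add: nsph_def)
qed

lemma continuous_on_flipped:
  assumes "continuous_on X f"
  shows "continuous_on X (\<lambda>x. flipped n S (f x))"
proof (rule continuous_on_coordinatewise_then_product)
  fix i show "continuous_on X (\<lambda>x. flipped n S (f x) i)"
    using continuous_on_coord[OF assms, of 0] continuous_on_coord[OF continuous_on_collapse[OF n assms], of i]
    unfolding flipped_def by (cases "i \<in> S") (auto intro!: continuous_on_mult continuous_on_minus)
qed

lemma homotopic_rimI:
  assumes "continuous_on ({0..1} \<times> cube_rim n) (\<lambda>(l, d). F l d)"
    and "\<And>l d. l \<in> {0..1::real} \<Longrightarrow> d \<in> cube_rim n \<Longrightarrow> F l d \<in> nsph n"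
    and "\<And>d. d \<in> cube_rim n \<Longrightarrow> F 0 d = f d" "\<And>d. d \<in> cube_rim n \<Longrightarrow> F 1 d = g d"
  shows "homotopic_with_canon (\<lambda>_. True) (cube_rim n) (nsph n) f g"
proof (subst homotopic_with, simp, intro exI conjI)
  show "continuous_map (prod_topology (top_of_set {0..1}) (top_of_set (cube_rim n))) (top_of_set (nsph n)) (\<lambda>(l, d). F l d)"
    using assms(1,2) by auto
qed (use assms(3,4) in auto)

text \<open>A pair of sign changes on the upper face is undone by rotating that face.\<close>

lemma flipped_pair:
  assumes S: "S \<subseteq> {1..n}" and ij: "i \<noteq> j" "i \<in> {1..n}" "j \<in> {1..n}"
    and T: "T = (S - {i, j}) \<union> ({i, j} - S)"
  shows "homotopic_with_canon (\<lambda>_. True) (cube_rim n) (nsph n) (flipped n S) (flipped n T)"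
\<comment> \<open>The angle is 0 on the face \<open>d 0 = - 1\<close> and grows to \<open>pi\<close>
  on the face \<open>d 0 = 1\<close>, where the half turn negates coordinates \<open>i\<close> and
  \<open>j\<close>. On the other faces the point is \<open>e0\<close>, which these rotations
  fix.\<close>
proof (rule homotopic_rimI[where F = "\<lambda>l d. rot i j (l * (pi * ((d 0 + 1) / 2))) (flipped n S d)"])
  have "continuous_on ({0..1} \<times> cube_rim n) (\<lambda>p. rot i j (fst p * (pi * ((snd p 0 + 1) / 2))) (flipped n S (snd p)))"
    by (intro continuous_on_rot continuous_on_flipped continuous_on_mult continuous_on_divide continuous_on_add
        continuous_on_const continuous_on_fst continuous_on_snd continuous_on_id continuous_on_coord) auto
  then show "continuous_on ({0..1} \<times> cube_rim n) (\<lambda>(l, d). rot i j (l * (pi * ((d 0 + 1) / 2))) (flipped n S d))"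
    by (simp add: case_prod_unfold)
  fix d assume d: "d \<in> cube_rim n"
  show "rot i j (l * (pi * ((d 0 + 1) / 2))) (flipped n S d) \<in> nsph n" for l
    using rot_nsph[OF flipped_nsph[OF d S] ij(1)] ij by simp
  show "rot i j (0 * (pi * ((d 0 + 1) / 2))) (flipped n S d) = flipped n S d"
    by (simp add: rot_def)
  show "rot i j (1 * (pi * ((d 0 + 1) / 2))) (flipped n S d) = flipped n T d"
    using d
  proof (cases rule: cube_rim_cases)
    case 1
    then show ?thesis using ij T by (auto simp: rot_def flipped_def fun_eq_iff)
  next
    case 2
    then show ?thesis by (auto simp: rot_def flipped_def fun_eq_iff)
  next
    case 3
    then have "flipped n S d = e0" "flipped n T d = e0"
      using S ij T by (auto simp: flipped_def fun_eq_iff e0_def)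
    then show ?thesis using ij by (auto simp: rot_def e0_def fun_eq_iff)
  qed
qed

lemma flipped_refl:
  "S \<subseteq> {1..n} \<Longrightarrow> homotopic_with_canon (\<lambda>_. True) (cube_rim n) (nsph n) (flipped n S) (flipped n S)"
  using flipped_nsph continuous_on_flipped[OF continuous_on_id] by auto

text \<open>Flips cancel in pairs. A single remaining flip at \<open>k\<close> moves to coordinate 1
  by changing both \<open>k\<close> and 1.\<close>

lemma flipped_parity:
  assumes "S \<subseteq> {1..n}"
  shows "homotopic_with_canon (\<lambda>_. True) (cube_rim n) (nsph n) (flipped n S) (flipped n (if even (card S) then {} else {1}))"
  using assms
proof (induction "card S" arbitrary: S rule: less_induct)
  case (less S)
  have fin: "finite S" using less.prems finite_subset by blast
  consider "card S = 0" | "card S = 1" | "card S \<ge> 2" by linarith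
  then show ?case
  proof cases
    case 1
    then show ?thesis using flipped_refl[of S] less.prems fin by simp
  next
    case 2
    then obtain k where k: "S = {k}" using card_1_singletonE by blast
    show ?thesis
    proof (cases "k = 1")
      case True
      then show ?thesis using flipped_refl[of S] less.prems k by simp
    next
      case False
      then show ?thesis
        using flipped_pair[of S k 1 "{1}"] less.prems k n by auto
    qed
  next
    case 3
    then obtain i j where ij: "i \<in> S" "j \<in> S" "i \<noteq> j"
      by (metis card_le_Suc0_iff_eq fin not_less_eq_eq numeral_2_eq_2)
    define T where "T = S - {i, j}"
    have cT: "card T = card S - 2" "card T < card S" "even (card T) \<longleftrightarrow> even (card S)"
      using ij fin 3 by (simp_all add: T_def card_Diff_subset)
    have T: "T \<subseteq> {1..n}" using less.prems by (auto simp: T_def)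
    have "homotopic_with_canon (\<lambda>_. True) (cube_rim n) (nsph n) (flipped n S) (flipped n T)"
      by (rule flipped_pair[of S i j]) (use ij less.prems in \<open>auto simp: T_def\<close>)
    moreover have "homotopic_with_canon (\<lambda>_. True) (cube_rim n) (nsph n) (flipped n T)
        (flipped n (if even (card S) then {} else {1}))"
      using less.hyps[OF cT(2) T] cT(3) by simp
    ultimately show ?thesis by (rule homotopic_with_trans)
  qed
qed

text \<open>Without flips the map does not see \<open>d 0\<close>, so it extends over the
  contractible cube; the coordinates are pushed to the corner of ones, which is collapsed to
  \<open>e0\<close>.\<close>

lemma flipped_null:
  "homotopic_with_canon (\<lambda>_. True) (cube_rim n) (nsph n) (flipped n {}) (\<lambda>_. e0)"
proof (rule homotopic_rimI[where F = "\<lambda>l d. collapse n (\<lambda>i. (1 - l) * d i + l)"])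
  have "continuous_on ({0..1} \<times> cube_rim n) (\<lambda>p i. (1 - fst p) * snd p i + fst p)"
  proof (rule continuous_on_coordinatewise_then_product)
    fix i show "continuous_on ({0..1} \<times> cube_rim n) (\<lambda>p. (1 - fst p) * snd p i + fst p)"
      by (intro continuous_on_add continuous_on_mult continuous_on_diff continuous_on_const continuous_on_fst
          continuous_on_id continuous_on_coord[OF continuous_on_snd[OF continuous_on_id]])
  qed
  then show "continuous_on ({0..1} \<times> cube_rim n) (\<lambda>(l, d). collapse n (\<lambda>i. (1 - l) * d i + l))"
    unfolding case_prod_unfold by (rule continuous_on_collapse[OF n])
  have "maxabs {1..n} (\<lambda>_. 1) = 1" using n by (simp add: maxabs_def image_constant_conv)
  then show "collapse n (\<lambda>i. (1 - 1) * d i + 1) = e0" for d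
    using collapse_e0_iff[OF n, of "\<lambda>_. 1"] by simp
qed (use collapse_nsph[OF n] in \<open>auto simp: flipped_def fun_eq_iff\<close>)

text \<open>The special case of one cell attached to a sphere, with no identifications in
  either.\<close>

lemma cubes_sphere: "cubes (fcube (Suc n)) (nsph n) {..n} (=) {} e0"
proof
  fix z :: "nat \<Rightarrow> real" and r :: real
  assume z: "z \<in> fcube (Suc n)"
  show "maxabs {..n} z \<le> 1" using z by (intro fcube_maxabs[OF z]) auto
  assume r: "0 \<le> r" "r * maxabs {..n} z \<le> 1"
  have "r * \<bar>z i\<bar> \<le> 1" if "i \<le> n" for i
    using mult_left_mono[OF abs_le_maxabs[of "{..n}" i z] r(1)] that r(2) by simp
  then show "dilate {..n} r z \<in> fcube (Suc n)"
    using z r by (auto simp: fcube_def dilate_def abs_mult)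
qed (use e0_nsph[OF n] in auto)

interpretation cubes "fcube (Suc n)" "nsph n" "{..n}" "(=)" "(=)" "{}" e0
  by (rule cubes_sphere)

lemma rim_eq: "rim = cube_rim n"
  by (simp add: rim_def cube_rim_def)

lemma attached_sphere_ptd_equiv:
  assumes fg: "homotopic_with_canon (\<lambda>_. True) (cube_rim n) (nsph n) f g"
    and att: "attached Z0 j0 i0 f" "attached Z1 j1 i1 g"
  shows "ptd_equiv Z0 (i0 e0) Z1 (i1 e0)"
proof -
  obtain h where h: "continuous_map (prod_topology (top_of_set {0..1::real}) (top_of_set (cube_rim n))) (top_of_set (nsph n)) h"
    "\<forall>x. h (0, x) = f x" "\<forall>x. h (1, x) = g x"
    using fg unfolding homotopic_with_def by blast
  have F: "rim_homotopy (\<lambda>l d. h (l, d))"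
    unfolding rim_homotopy_def rim_eq
  proof (intro conjI ballI impI)
    show "continuous_on ({0..1} \<times> cube_rim n) (\<lambda>(l, d). h (l, d))" using h(1) by simp
    show "h (l, d) \<in> nsph n" if "l \<in> {0..1}" "d \<in> cube_rim n" for l d
      using continuous_map_image_subset_topspace[OF h(1)] that by (simp add: image_subset_iff)
  qed simp_all
  have "(\<lambda>d. h (0, d)) = f" "(\<lambda>d. h (1, d)) = g" using h(2,3) by auto
  then have "attached Z0 j0 i0 (\<lambda>d. h (0, d))" "attached Z1 j1 i1 (\<lambda>d. h (1, d))"
    using att by simp_all
  from attached_ptd_equiv[where F = "\<lambda>l d. h (l, d)", OF this F] show ?thesis .
qed

lemma collapse_signs:
  assumes w: "\<And>i. i \<in> {1..n} \<Longrightarrow> w i = \<sigma> i * d i" and s: "\<And>i. i \<in> {1..n} \<Longrightarrow> \<bar>\<sigma> i\<bar> = 1"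
  shows "collapse n w 0 = collapse n d 0" "i \<in> {1..n} \<Longrightarrow> collapse n w i = \<sigma> i * collapse n d i"
proof -
  have a: "\<bar>w i\<bar> = \<bar>d i\<bar>" if "i \<in> {1..n}" for i using w[OF that] s[OF that] by (simp add: abs_mult)
  have M: "maxabs {1..n} w = maxabs {1..n} d"
    unfolding maxabs_def using a by (intro arg_cong[where f = Max] image_cong) auto
  have Q: "(\<Sum>i=1..n. (w i)\<^sup>2) = (\<Sum>i=1..n. (d i)\<^sup>2)"
    by (rule sum.cong) (use a power2_abs in metis)+
  show "collapse n w 0 = collapse n d 0" "i \<in> {1..n} \<Longrightarrow> collapse n w i = \<sigma> i * collapse n d i"
    using w[of i] unfolding collapse_def cden_def M Q by auto
qed

text \<open>The slice \<open>z 0 = - 1\<close> modulo its boundary is an \<open>n\<close>-sphere: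
  \<open>card U\<close> circle directions and the suspension. The cube is one cell on it. Its face
  \<open>z 0 = - 1\<close> is the slice itself, and the face \<open>z 0 = 1\<close> is glued to the
  slice by conjugation, which negates coordinates 2 to \<open>n\<close> but not the suspension
  coordinate 1.\<close>

lemma attached_smash:
  assumes U: "finite U" "U \<subseteq> {2..}" "U \<noteq> {}" "n = card U + 1"
  obtains j i where "attached (Zsp U {}) j i (flipped n {2..n})" "i e0 = Zbase U {}"
proof -
  note [simp del] = One_nat_def
  let ?C = "fcube (Suc n)"
  obtain q where q: "quotient_map (top_of_set ?C) (Zsp U {}) q"
    and qq: "\<And>z z'. z \<in> ?C \<Longrightarrow> z' \<in> ?C \<Longrightarrow> q z = q z' \<longleftrightarrow> same {2..<Suc n} {} z z'"
    and qb: "\<And>z. z \<in> ?C \<Longrightarrow> q z = Zbase U {} \<longleftrightarrow> based {2..<Suc n} {} z"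
    using cube_model[OF U(1,2), of "Suc n"] U(4) by auto
  have n2: "2 \<le> n" using U by (simp add: card_gt_0_iff Suc_le_eq)
  have bas: "based {2..<Suc n} {} z \<longleftrightarrow> maxabs {1..n} z = 1" if "z \<in> ?C" for z
  proof -
    have "based {2..<Suc n} {} z \<longleftrightarrow> (\<exists>i\<in>{1..n}. \<bar>z i\<bar> = 1)"
    proof -
      have "{1..n} = insert 1 {2..<Suc n}" using n2 by auto
      then show ?thesis using n2 by (simp add: based_def)
    qed
    also have "\<dots> \<longleftrightarrow> maxabs {1..n} z = 1"
    proof
      assume "\<exists>i\<in>{1..n}. \<bar>z i\<bar> = 1"
      then show "maxabs {1..n} z = 1" using abs_le_maxabs[of "{1..n}" _ z] fcube_maxabs_tail[OF that] by force
    next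
      assume "maxabs {1..n} z = 1"
      then show "\<exists>i\<in>{1..n}. \<bar>z i\<bar> = 1" using maxabs_attained[OF fin_ne[OF n], of z] by metis
    qed
    finally show ?thesis .
  qed
  define b where "b z = z(0 := - 1)" for z :: "nat \<Rightarrow> real"
  have bC: "b z \<in> ?C" if "z \<in> ?C" for z using that by (simp add: b_def fcube_def)
  have bM: "maxabs {1..n} (b z) = maxabs {1..n} z" for z
    unfolding maxabs_def b_def by (intro arg_cong[where f = Max] image_cong) auto
  have c: "quotient_map (top_of_set ?C) (top_of_set (nsph n)) (collapse n)"
    by (rule quotient_map_collapse[OF n]) simp
  have qb_cont: "continuous_map (top_of_set ?C) (Zsp U {}) (\<lambda>z. q (b z))"
    by (rule continuous_map_comp_on[OF quotient_imp_continuous_map[OF q]])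
       (use bC in \<open>auto simp: b_def intro!: continuous_on_fun_upd continuous_on_id continuous_on_const\<close>)
  have ker: "q (b z) = q (b w) \<longleftrightarrow> collapse n z = collapse n w" if z: "z \<in> ?C" "w \<in> ?C" for z w
  proof -
    let ?M = "maxabs {1..n} z = 1 \<and> maxabs {1..n} w = 1"
    have 1: "q (b z) = q (b w) \<longleftrightarrow> ?M \<or> glued {2..<Suc n} (b z) (b w)"
      using qq[OF bC[OF z(1)] bC[OF z(2)]] bas[OF bC[OF z(1)]] bas[OF bC[OF z(2)]] bM by (simp add: same_def)
    have 2: "glued {2..<Suc n} (b z) (b w) \<longleftrightarrow> z 1 = w 1 \<and> (\<forall>i\<in>{2..<Suc n}. circ (z i) (w i))"
      by (auto simp: glued_def b_def)
    have "{1..n} = insert 1 {2..<Suc n}" using n2 by auto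
    then have 3: "collapse n z = collapse n w \<longleftrightarrow> ?M \<or> z 1 = w 1 \<and> (\<forall>i\<in>{2..<Suc n}. z i = w i)"
      using collapse_eq_iff[OF n fcube_maxabs_tail[OF z(1)] fcube_maxabs_tail[OF z(2)]] by simp
    \<comment> \<open>\<open>circ\<close> differs from equality only at end points of smashed
      circles, and those points are based anyway.\<close>
    have 4: "?M" if "\<bar>z i\<bar> = 1" "\<bar>w i\<bar> = 1" "i \<in> {2..<Suc n}" for i
      using bas[OF z(1)] bas[OF z(2)] that unfolding based_def by blast
    then have "?M \<or> (\<forall>i\<in>{2..<Suc n}. circ (z i) (w i)) \<longleftrightarrow> ?M \<or> (\<forall>i\<in>{2..<Suc n}. z i = w i)"
      unfolding circ_def by blast
    then show ?thesis unfolding 1 2 3 by blast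
  qed
  obtain i where i: "continuous_map (top_of_set (nsph n)) (Zsp U {}) i" "\<And>z. z \<in> ?C \<Longrightarrow> i (collapse n z) = q (b z)"
    using quotient_map_lift_exists[OF c qb_cont] ker by (metis topspace_euclidean_subtopology)
  have csurj: "\<exists>z\<in>?C. x = collapse n z" if "x \<in> nsph n" for x
    using collapse_fcube_surj[OF n _ that, of "Suc n"] by auto
  have inner: "\<not> based {2..<Suc n} {} z" "\<bar>z 0\<bar> < 1" "\<And>k. k \<le> n \<Longrightarrow> \<bar>z k\<bar> < 1" if "z \<in> ?C" "\<mu> z < 1" for z
    using bas[OF that(1)] that(2) maxabs_less_iff[of "{..n}" z 1] maxabs_atMost[OF n, of z] by auto
  have "attached (Zsp U {}) q i (flipped n {2..n})"
    unfolding attached_def rim_eq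
  proof (intro conjI ballI impI)
    show "final_maps (Zsp U {}) UNIV (\<lambda>k. if k then top_of_set ?C else top_of_set (nsph n)) (\<lambda>k. if k then q else i)"
      by (rule final_maps_quotient[OF q i(1)])
    fix d assume d: "d \<in> cube_rim n"
    show "flipped n {2..n} d \<in> nsph n" using flipped_nsph[OF d] by simp
    have dC: "d \<in> ?C" using d by (simp add: cube_rim_def)
    show "q d = i (flipped n {2..n} d)"
      using d
    proof (cases rule: cube_rim_cases)
      case 1
      \<comment> \<open>The conjugate of \<open>d\<close>: moved to the slice it is glued to
        \<open>d\<close>, and collapsing it gives the flipped image of \<open>d\<close>.\<close>
      define w where "w k = (if k \<in> {2..n} then - d k else d k)" for k
      have wC: "w \<in> ?C" using dC by (auto simp: w_def fcube_def)
      have w: "w k = (if k \<in> {2..n} then - 1 else 1) * d k" for k by (simp add: w_def)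
      have "flipped n {2..n} d = collapse n w"
      proof
        fix k
        consider "k = 0" | "k \<in> {1..n}" | "k > n" by fastforce
        then show "flipped n {2..n} d k = collapse n w k"
        proof cases
          case 1
          then show ?thesis using collapse_signs(1)[OF w] by (simp add: flipped_def)
        next
          case 2
          then show ?thesis using collapse_signs(2)[OF w _ 2] \<open>d 0 = 1\<close> by (simp add: flipped_def)
        next
          case 3
          then show ?thesis by (simp add: flipped_def collapse_def)
        qed
      qed
      moreover have "glued {2..<Suc n} d (b w)"
        using 1 by (auto simp: glued_def b_def w_def)
      ultimately show ?thesis using i(2)[OF wC] qq[OF dC bC[OF wC]] by (simp add: same_def)
    next
      case 2
      then have "b d = d" by (auto simp: b_def)
      moreover have "flipped n {2..n} d = collapse n d" using 2 by (auto simp: flipped_def)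
      ultimately show ?thesis using i(2)[OF dC] by simp
    next
      case 3
      then have M: "maxabs {1..n} d = 1" using collapse_e0_iff[OF n] by blast
      have "flipped n {2..n} d = collapse n d" using 3 by (auto simp: flipped_def e0_def)
      then have "i (flipped n {2..n} d) = q (b d)" using i(2)[OF dC] by simp
      also have "\<dots> = q d" using qb[OF dC] qb[OF bC[OF dC]] bas[OF dC] bas[OF bC[OF dC]] bM M by simp
      finally show ?thesis by simp
    qed
  next
    fix x y assume "x \<in> nsph n" "y \<in> nsph n"
    then obtain z w where "z \<in> ?C" "w \<in> ?C" "x = collapse n z" "y = collapse n w" using csurj by metis
    then show "i x = i y \<longleftrightarrow> x = y" using i(2) ker by simp
  next
    fix z w assume z: "z \<in> ?C" "w \<in> ?C" "\<mu> z < 1" "\<mu> w < 1"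
    have "z = w" if "glued {2..<Suc n} z w"
    proof
      fix k
      have in1: "\<bar>z k\<bar> < 1" if "k \<le> n" using inner(3)[OF z(1,3) that] .
      have g: "z 0 = w 0" "z 1 = w 1" "\<forall>i\<in>{2..<Suc n}. circ (z i) (w i)"
        using that inner(2)[OF z(1,3)] unfolding glued_def by simp_all
      consider "k = 0" | "k = 1" | "k \<in> {2..<Suc n}" | "k > n" by fastforce
      then show "z k = w k"
      proof cases
        case 3
        then have "circ (z k) (w k)" "\<bar>z k\<bar> \<noteq> 1" using g(3) in1 by auto
        then show ?thesis by (simp add: circ_def)
      qed (use g z in \<open>simp_all add: fcube_def\<close>)
    qed
    then show "q z = q w \<longleftrightarrow> z = w \<or> z \<in> {} \<and> w \<in> {}"
      using qq[OF z(1,2)] inner(1)[OF z(1,3)] by (auto simp: same_def glued_refl)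
  next
    fix z x assume z: "z \<in> ?C" "x \<in> nsph n" "\<mu> z < 1"
    then obtain w where w: "w \<in> ?C" "x = collapse n w" using csurj by metis
    have "\<not> glued {2..<Suc n} z (b w)" using inner(2)[OF z(1,3)] by (auto simp: glued_def b_def)
    then show "q z = i x \<longleftrightarrow> z \<in> {} \<and> x = e0"
      using qq[OF z(1) bC[OF w(1)]] inner(1)[OF z(1,3)] i(2)[OF w(1)] w(2) by (simp add: same_def)
  qed
  moreover have "i e0 = Zbase U {}"
  proof -
    obtain w where w: "w \<in> ?C" "e0 = collapse n w" using csurj[OF e0_nsph[OF n]] by metis
    then have "maxabs {1..n} w = 1" using collapse_e0_iff[OF n] by metis
    then show ?thesis using qb[OF bC[OF w(1)]] bas[OF bC[OF w(1)]] bM i(2)[OF w(1)] w(2) by simp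
  qed
  ultimately show thesis by (rule that)
qed

end

subsection \<open>The wedge summands\<close>

definition shift :: "(nat \<Rightarrow> real) \<Rightarrow> nat \<Rightarrow> real" where
  "shift z i = (if i = 0 then 0 else z (i - 1))"

text \<open>Collapses the whole boundary of the cube with coordinates 0 to \<open>n\<close>, whereas
  \<open>collapse\<close> reads coordinates from 1 on; hence the shift and the sphere of dimension
  \<open>Suc n\<close>.\<close>

definition cell :: "nat \<Rightarrow> (nat \<Rightarrow> real) \<Rightarrow> nat \<Rightarrow> real" where
  "cell n z = collapse (Suc n) (shift z)"

lemma maxabs_shift: "maxabs {1..Suc n} (shift z) = maxabs {..n} z"
proof -
  have "{1..Suc n} = Suc ` {..n}" by (simp add: image_Suc_atMost)
  then show ?thesis by (simp add: maxabs_def shift_def image_image)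
qed

lemma cell_e0_iff: "cell n z = e0 \<longleftrightarrow> maxabs {..n} z = 1"
  unfolding cell_def using collapse_e0_iff[of "Suc n" "shift z"] maxabs_shift by simp

lemma cell_eq_iff:
  assumes "z \<in> fcube (Suc n)" "w \<in> fcube (Suc n)"
  shows "cell n z = cell n w \<longleftrightarrow> maxabs {..n} z = 1 \<and> maxabs {..n} w = 1 \<or> z = w"
proof -
  have m: "maxabs {..n} z \<le> 1" "maxabs {..n} w \<le> 1"
    using assms by (auto intro!: fcube_maxabs)
  have "(\<forall>i\<in>{1..Suc n}. shift z i = shift w i) \<longleftrightarrow> (\<forall>i\<le>n. z i = w i)"
  proof -
    have "{1..Suc n} = Suc ` {..n}" by (simp add: image_Suc_atMost)
    then have e: "(\<forall>i\<in>{1..Suc n}. shift z i = shift w i) \<longleftrightarrow> (\<forall>i\<in>{..n}. z i = w i)"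
      by (simp add: shift_def)
    show ?thesis unfolding e by auto
  qed
  also have "\<dots> \<longleftrightarrow> z = w"
  proof
    assume "\<forall>i\<le>n. z i = w i"
    moreover have "z i = w i" if "i > n" for i using assms that by (simp add: fcube_def)
    ultimately show "z = w" by (metis ext not_le)
  qed simp
  finally show ?thesis
    unfolding cell_def using collapse_eq_iff[of "Suc n" "shift z" "shift w"] maxabs_shift m by simp
qed

lemma continuous_on_cell: "continuous_on X (cell n)"
proof -
  have "continuous_on X shift"
  proof (rule continuous_on_coordinatewise_then_product)
    fix i show "continuous_on X (\<lambda>z. shift z i)"
      by (cases "i = 0") (simp_all add: shift_def continuous_on_eval)
  qed
  then show ?thesis unfolding cell_def by (intro continuous_on_collapse) auto
qed

lemma quotient_map_cell: "quotient_map (top_of_set (fcube (Suc n))) (top_of_set (nsph (Suc n))) (cell n)"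
proof (rule quotient_map_compact[OF compact_fcube continuous_on_cell])
  have "x \<in> cell n ` fcube (Suc n)" if x: "x \<in> nsph (Suc n)" for x
  proof -
    obtain z where z: "z \<in> fcube (Suc (Suc n))" "x = collapse (Suc n) z"
      using collapse_fcube_surj[OF _ _ x, of "Suc (Suc n)"] by auto
    have "collapse (Suc n) (shift (\<lambda>i. z (Suc i))) = collapse (Suc n) z"
      by (rule collapse_cong) (auto simp: shift_def)
    then have "cell n (\<lambda>i. z (Suc i)) = x" using z by (simp add: cell_def)
    moreover have "(\<lambda>i. z (Suc i)) \<in> fcube (Suc n)" using z(1) by (simp add: fcube_def)
    ultimately show ?thesis by blast
  qed
  then show "cell n ` fcube (Suc n) = nsph (Suc n)"
    using collapse_nsph[of "Suc n"] by (auto simp: cell_def)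
qed

lemma quotient_map_Sph: "quotient_map (top_of_set (nsph p)) (Sph p) (Pair False)"
  unfolding Sph_def nsphere_nsph by (rule quotient_map_quotient_top)

lemma Sph_base: "p \<ge> 1 \<Longrightarrow> (False, e0) \<in> topspace (Sph p)"
  using quotient_imp_surjective_map[OF quotient_map_Sph[of p]] e0_nsph[of p] by auto

text \<open>No circle is left. The gluing of \<open>z 0 = 1\<close> with \<open>z 0 = - 1\<close>
  now falls inside the class of the base point, so the square loses its entire boundary and becomes
  a 2-sphere.\<close>

lemma smash_empty:
  "ptd_equiv (Zsp {} {}) (Zbase {} {}) (wedge {(0, 0, 0)} RHS_space RHS_base) None"
proof -
  note [simp del] = One_nat_def
  let ?C = "fcube (Suc 1)"
  obtain q where q: "quotient_map (top_of_set ?C) (Zsp {} {}) q"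
    and qq: "\<And>z z'. z \<in> ?C \<Longrightarrow> z' \<in> ?C \<Longrightarrow> q z = q z' \<longleftrightarrow> same {2..<Suc 1} {} z z'"
    and qb: "\<And>z. z \<in> ?C \<Longrightarrow> q z = Zbase {} {} \<longleftrightarrow> based {2..<Suc 1} {} z"
    using cube_model[of "{}" "Suc 1"] by auto
  have e: "{2..<Suc 1} = {}" by simp
  have m: "maxabs {..1} z = 1 \<longleftrightarrow> based {} {} z" if "z \<in> ?C" for z
  proof -
    have "{..1} = {0, 1::nat}" by auto
    then have "maxabs {..1} z = max \<bar>z 0\<bar> \<bar>z 1\<bar>" using maxabs_insert[of "{1}" 0 z] by (simp add: maxabs_def)
    moreover have "\<bar>z 0\<bar> \<le> 1" "\<bar>z 1\<bar> \<le> 1" using that by (simp_all add: fcube_def)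
    ultimately show ?thesis by (auto simp: based_def max_def)
  qed
  have q': "quotient_map (top_of_set ?C) (Sph 2) (\<lambda>z. (False, cell 1 z))"
    using quotient_map_compose[OF quotient_map_cell[of 1] quotient_map_Sph] by (simp add: o_def numeral_2_eq_2 One_nat_def)
  let ?b = "\<lambda>i. if i < Suc 1 then 1 else 0 :: real"
  have b: "?b \<in> ?C" by (simp add: fcube_def)
  have bb: "based {} {} ?b" by (simp add: based_def)
  have "ptd_equiv (Zsp {} {}) (q ?b) (Sph 2) (False, cell 1 ?b)"
  proof (rule quotient_maps_same_kernel_ptd_equiv[OF q q'])
    show "?b \<in> topspace (top_of_set ?C)" using b by simp
    fix z w assume "z \<in> topspace (top_of_set ?C)" "w \<in> topspace (top_of_set ?C)"
    then have z: "z \<in> ?C" "w \<in> ?C" by simp_all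
    have "z = w" if "glued {} z w" "\<not> based {} {} z"
    proof
      fix i
      consider "i = 0" | "i = 1" | "i \<ge> Suc 1" by linarith
      then show "z i = w i" by cases (use that z in \<open>auto simp: glued_def based_def fcube_def\<close>)
    qed
    then show "q z = q w \<longleftrightarrow> (False, cell 1 z) = (False, cell 1 w)"
      using qq[OF z] m[OF z(1)] m[OF z(2)] cell_eq_iff[OF z] based_glued[of "{}" "{}" z w] glued_refl[of "{}" w]
      unfolding e same_def by auto
  qed
  moreover have "q ?b = Zbase {} {}" using qb[OF b] bb e by simp
  moreover have "cell 1 ?b = e0" using cell_e0_iff[of 1 ?b] m[OF b] bb by simp
  ultimately have "ptd_equiv (Zsp {} {}) (Zbase {} {}) (Sph 2) (False, e0)" by simp
  moreover have "ptd_equiv (Sph 2) (False, e0) (wedge {(0, 0, 0)} RHS_space RHS_base) None"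
    using ptd_equiv_wedge_singleton[of RHS_base "(0, 0, 0)" RHS_space] Sph_base[of 2]
    by (simp add: RHS_space_def RHS_base_def)
  ultimately show ?thesis by (rule ptd_equiv_trans)
qed

text \<open>A null attaching map splits the cell off: the sphere of dimension
  \<open>card U + 1\<close> is kind 1, and the cell with collapsed rim is kind 2.\<close>

lemma smash_even:
  assumes U: "finite U" "U \<subseteq> {2..}" "U \<noteq> {}" "even (card U)"
  shows "ptd_equiv (Zsp U {}) (Zbase U {}) (wedge {(1, card U, j), (2, card U, j)} RHS_space RHS_base) None"
proof -
  define n where "n = card U + 1"
  have n: "1 \<le> n" by (simp add: n_def)
  interpret cubes "fcube (Suc n)" "nsph n" "{..n}" "(=)" "(=)" "{}" e0
    by (rule cubes_sphere[OF n])
  obtain j0 i0 where att0: "attached (Zsp U {}) j0 i0 (flipped n {2..n})" and b0: "i0 e0 = Zbase U {}"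
    using attached_smash[OF n U(1-3) n_def] .
  let ?k1 = "(1, card U, j) :: nat \<times> nat \<times> nat" and ?k2 = "(2, card U, j) :: nat \<times> nat \<times> nat"
  have att1: "attached (wedge {?k1, ?k2} RHS_space RHS_base) (\<lambda>z. wtag RHS_base ?k2 (False, cell n z))
    (\<lambda>x. wtag RHS_base ?k1 (False, x)) (\<lambda>_. e0)"
  proof (rule attached_wedge)
    show "quotient_map (top_of_set (nsph n)) (RHS_space ?k1) (Pair False)"
      using quotient_map_Sph[of n] by (simp add: RHS_space_def n_def)
    show "quotient_map (top_of_set (fcube (Suc n))) (RHS_space ?k2) (\<lambda>z. (False, cell n z))"
      using quotient_map_compose[OF quotient_map_cell[of n] quotient_map_Sph]
      by (simp add: RHS_space_def n_def o_def)
    show "(False, cell n z) = RHS_base ?k2" if "z \<in> rim" for z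
      using that by (simp add: RHS_base_def cell_e0_iff rim_def)
    show "e0 \<in> nsph n \<and> e0 = e0" using e0_nsph[OF n] by simp
    show "(False, cell n z) = (False, cell n z') \<longleftrightarrow> z = z' \<or> z \<in> {} \<and> z' \<in> {}"
      if "z \<in> fcube (Suc n)" "z' \<in> fcube (Suc n)" "\<mu> z < 1" for z z'
      using cell_eq_iff[OF that(1,2)] that(3) by simp
    show "(False, cell n z) = RHS_base ?k2 \<longleftrightarrow> z \<in> {}" if "\<mu> z < 1" for z
      using that by (simp add: RHS_base_def cell_e0_iff)
  qed (auto simp: RHS_base_def)
  \<comment> \<open>One flip for each smashed circle.\<close>
  have "even (card {2..n})" using U(4) by (simp add: n_def)
  then have "homotopic_with_canon (\<lambda>_. True) (cube_rim n) (nsph n) (flipped n {2..n}) (\<lambda>_. e0)"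
    using homotopic_with_trans[OF flipped_parity[OF n, of "{2..n}"]] flipped_null[OF n] by simp
  from attached_sphere_ptd_equiv[OF n this att0 att1] show ?thesis
    by (simp add: b0 RHS_base_def wtag_def)
qed

subsection \<open>Moore spaces\<close>

definition nrm :: "nat \<Rightarrow> (nat \<Rightarrow> real) \<Rightarrow> real" where
  "nrm n x = sqrt (\<Sum>i\<le>n. (x i)\<^sup>2)"

text \<open>A quarter turn that aligns the doubling of angles with \<open>collapse\<close>:
  afterwards \<open>deg2\<close> sends the centres of the faces \<open>z 0 = \<plusminus> 1\<close>
  to the antipode of \<open>e0\<close> and those of \<open>z 1 = \<plusminus> 1\<close> to
  \<open>e0\<close>.\<close>

definition twist :: "(nat \<Rightarrow> real) \<Rightarrow> nat \<Rightarrow> real" where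
  "twist z i = (if i = 0 then z 1 else if i = 1 then - z 0 else z i)"

text \<open>A homeomorphism from the cube to the round ball; the denominator makes it continuous at the centre.\<close>

definition ball_map :: "nat \<Rightarrow> (nat \<Rightarrow> real) \<Rightarrow> nat \<Rightarrow> real" where
  "ball_map n z i = twist z i / (nrm n z + 1 - maxabs {..n} z)"

definition ndsk :: "nat \<Rightarrow> (nat \<Rightarrow> real) set" where
  "ndsk n = {x. (\<Sum>i\<le>n. (x i)\<^sup>2) \<le> 1 \<and> (\<forall>i>n. x i = 0)}"

lemma ndisk_ndsk: "ndisk n = top_of_set (ndsk n)"
  by (simp add: ndisk_def Euclidean_space_def subtopology_subtopology ndsk_def euclidean_product_topology
      Suc_le_eq Collect_conj_eq Int_commute)

lemma nrm_nonneg: "0 \<le> nrm n x"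
  by (simp add: nrm_def sum_nonneg)

lemma nrm_sq: "(nrm n x)\<^sup>2 = (\<Sum>i\<le>n. (x i)\<^sup>2)"
  by (simp add: nrm_def sum_nonneg)

lemma maxabs_le_nrm: "maxabs {..n} x \<le> nrm n x"
proof -
  have "\<bar>x i\<bar> \<le> nrm n x" if "i \<le> n" for i
  proof (rule power2_le_imp_le[OF _ nrm_nonneg])
    show "\<bar>x i\<bar>\<^sup>2 \<le> (nrm n x)\<^sup>2"
      unfolding nrm_sq using member_le_sum[of i "{..n}" "\<lambda>i. (x i)\<^sup>2"] that by simp
  qed
  then show ?thesis by (subst maxabs_le_iff) auto
qed

lemma nrm_div: "0 < k \<Longrightarrow> nrm n (\<lambda>i. x i / k) = nrm n x / k"
  by (simp add: nrm_def power_divide real_sqrt_divide flip: sum_divide_distrib)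

lemma maxabs_div: 
  assumes "0 < k"
  shows "maxabs {..n} (\<lambda>i. x i / k) = maxabs {..n} x / k"
proof -
  have "maxabs {..n} (\<lambda>i. x i / k) = maxabs {..n} (dilate {..n} (1 / k) x)"
    unfolding maxabs_def by (intro arg_cong[where f = Max] image_cong) (auto simp: dilate_def)
  also have "\<dots> = maxabs {..n} x / k" using maxabs_dilate[of "{..n}" "1 / k" x] assms by simp
  finally show ?thesis .
qed

lemma ball_den: "1 \<le> nrm n z + 1 - maxabs {..n} z"
  using maxabs_le_nrm[of n z] by simp

section \<open>The degree 2 map of the sphere\<close>

lemma deg2_apply:
  "deg2 x 0 = ((x 0)\<^sup>2 - (x 1)\<^sup>2) / sqrt ((x 0)\<^sup>2 + (x 1)\<^sup>2)"
  "deg2 x 1 = 2 * x 0 * x 1 / sqrt ((x 0)\<^sup>2 + (x 1)\<^sup>2)"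
  "i \<noteq> 0 \<Longrightarrow> i \<noteq> 1 \<Longrightarrow> deg2 x i = x i"
  by (simp_all add: deg2_def Let_def)

lemma deg2_sq: "(deg2 x 0)\<^sup>2 + (deg2 x 1)\<^sup>2 = (x 0)\<^sup>2 + (x 1)\<^sup>2"
proof -
  define s where "s = (x 0)\<^sup>2 + (x 1)\<^sup>2"
  have s: "s \<ge> 0" by (simp add: s_def)
  have "(deg2 x 0)\<^sup>2 + (deg2 x 1)\<^sup>2 = (((x 0)\<^sup>2 - (x 1)\<^sup>2)\<^sup>2 + (2 * x 0 * x 1)\<^sup>2) / s"
    unfolding deg2_apply s_def[symmetric] power_divide real_sqrt_pow2[OF s] by (simp only: add_divide_distrib)
  also have "((x 0)\<^sup>2 - (x 1)\<^sup>2)\<^sup>2 + (2 * x 0 * x 1)\<^sup>2 = s\<^sup>2"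
    by (simp add: s_def power2_eq_square algebra_simps)
  also have "s\<^sup>2 / s = s" by (simp add: power2_eq_square)
  finally show ?thesis by (simp add: s_def)
qed

text \<open>Where \<open>r\<close> vanishes, the bound \<open>\<bar>f / r\<bar> \<le> r\<close>
  forces the limit 0, which is also the value of the quotient by the convention on division by zero.
  \<open>deg2\<close> needs this where coordinates 0 and 1 both vanish.\<close>

lemma continuous_on_quotient_bounded:
  fixes f r :: "'a::metric_space \<Rightarrow> real"
  assumes f: "continuous_on UNIV f" and r: "continuous_on UNIV r" and fr: "\<And>y. \<bar>f y\<bar> \<le> (r y)\<^sup>2" and r0: "\<And>y. 0 \<le> r y"
  shows "continuous_on UNIV (\<lambda>y. f y / r y)"
proof (rule continuous_at_imp_continuous_on, rule ballI)
  fix x :: "'a"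
  have fx: "isCont f x" using continuous_on_eq_continuous_at[OF open_UNIV, of f] f by simp
  have rx: "isCont r x" using continuous_on_eq_continuous_at[OF open_UNIV, of r] r by simp
  show "isCont (\<lambda>y. f y / r y) x"
  proof (cases "r x = 0")
    case False
    then show ?thesis using fx rx unfolding isCont_def by (intro tendsto_divide)
  next
    case True
    have lim: "(r \<longlongrightarrow> 0) (at x)" using rx True by (simp add: isCont_def)
    have le: "norm (f y / r y) \<le> r y" for y
    proof (cases "r y = 0")
      case False
      then have "0 < r y" using r0[of y] by simp
      then show ?thesis using fr[of y] by (simp add: abs_divide divide_le_eq power2_eq_square)
    next
      case True
      then show ?thesis by simp
    qed
    have "\<forall>\<^sub>F y in at x. norm (f y / r y) \<le> r y" using le by simp
    then have "((\<lambda>y. f y / r y) \<longlongrightarrow> 0) (at x)" using lim by (rule Lim_null_comparison)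
    then show ?thesis using True by (simp add: isCont_def)
  qed
qed

lemma continuous_on_deg2: "continuous_on X deg2"
proof -
  let ?r = "\<lambda>x :: nat \<Rightarrow> real. sqrt ((x 0)\<^sup>2 + (x 1)\<^sup>2)"
  have r: "continuous_on UNIV ?r"
    by (intro continuous_on_real_sqrt continuous_on_add continuous_on_power continuous_on_eval)
  have r2: "(?r x)\<^sup>2 = (x 0)\<^sup>2 + (x 1)\<^sup>2" for x by simp
  have 0: "continuous_on UNIV (\<lambda>x :: nat \<Rightarrow> real. ((x 0)\<^sup>2 - (x 1)\<^sup>2) / ?r x)"
  proof (rule continuous_on_quotient_bounded[OF _ r])
    show "continuous_on UNIV (\<lambda>x :: nat \<Rightarrow> real. (x 0)\<^sup>2 - (x 1)\<^sup>2)"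
      by (intro continuous_on_diff continuous_on_power continuous_on_eval)
    show "\<bar>(x 0)\<^sup>2 - (x 1)\<^sup>2\<bar> \<le> (?r x)\<^sup>2" for x :: "nat \<Rightarrow> real"
      unfolding r2 by (simp add: abs_le_iff)
  qed simp
  have 1: "continuous_on UNIV (\<lambda>x :: nat \<Rightarrow> real. 2 * x 0 * x 1 / ?r x)"
  proof (rule continuous_on_quotient_bounded[OF _ r])
    show "continuous_on UNIV (\<lambda>x :: nat \<Rightarrow> real. 2 * x 0 * x 1)"
      by (intro continuous_on_mult continuous_on_const continuous_on_eval)
    show "\<bar>2 * x 0 * x 1\<bar> \<le> (?r x)\<^sup>2" for x :: "nat \<Rightarrow> real"
      unfolding r2 using sum_squares_bound[of "x 0" "x 1"] sum_squares_bound[of "x 0" "- x 1"]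
      by (simp add: abs_le_iff)
  qed simp
  have "continuous_on UNIV (\<lambda>x. deg2 x i)" for i
  proof -
    consider "i = 0" | "i = 1" | "i \<noteq> 0" "i \<noteq> 1" by blast
    then show ?thesis
    proof cases
      case 1
      then show ?thesis using 0 by (simp only: deg2_apply)
    next
      case 2
      then show ?thesis using \<open>continuous_on UNIV (\<lambda>x. 2 * x 0 * x 1 / ?r x)\<close> by (simp only: deg2_apply)
    next
      case 3
      then show ?thesis by (simp only: deg2_apply(3) continuous_on_eval simp_thms)
    qed
  qed
  then have "continuous_on UNIV deg2" by (rule continuous_on_coordinatewise_then_product)
  then show ?thesis by (rule continuous_on_subset) simp
qed

context
  fixes n :: nat
  assumes n: "1 \<le> n"
begin

lemma sum_split01: "(\<Sum>i\<le>n. g i :: real) = g 0 + g 1 + sum g ({..n} - {0, 1})"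
  by (rule sum_remove2) (use n in auto)

lemma nrm_twist: "nrm n (twist z) = nrm n z"
proof -
  have "(\<Sum>i\<le>n. (twist z i)\<^sup>2) = (z 1)\<^sup>2 + (z 0)\<^sup>2 + (\<Sum>i\<in>{..n}-{0,1}. (z i)\<^sup>2)"
    unfolding sum_split01 by (intro arg_cong2[where f = "(+)"] sum.cong) (auto simp: twist_def)
  then show ?thesis unfolding nrm_def sum_split01[of "\<lambda>i. (z i)\<^sup>2"] by simp
qed

lemma maxabs_twist: "maxabs {..n} (twist z) = maxabs {..n} z"
proof -
  have "maxabs {..n} (twist z) \<le> c \<longleftrightarrow> maxabs {..n} z \<le> c" for c
  proof -
    have "{..n} = insert 0 (insert 1 ({..n} - {0, 1}))" using n by auto
    then have "(\<forall>i\<in>{..n}. Q i) \<longleftrightarrow> Q 0 \<and> Q 1 \<and> (\<forall>i\<in>{..n} - {0, 1}. Q i)" for Q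
      by (metis insert_iff)
    note e = this
    have "(\<forall>i\<in>{..n}. \<bar>twist z i\<bar> \<le> c) \<longleftrightarrow> (\<forall>i\<in>{..n}. \<bar>z i\<bar> \<le> c)"
      unfolding e[of "\<lambda>i. \<bar>twist z i\<bar> \<le> c"] e[of "\<lambda>i. \<bar>z i\<bar> \<le> c"] by (auto simp: twist_def)
    then show ?thesis by (simp add: maxabs_le_iff[of "{..n}"])
  qed
  then show ?thesis by (metis order_antisym order_refl)
qed

lemma ball_map_eq: "ball_map n z = (\<lambda>i. twist z i / (nrm n z + 1 - maxabs {..n} z))"
  by (simp add: ball_map_def fun_eq_iff)

lemma nrm_ball_map: "nrm n (ball_map n z) = nrm n z / (nrm n z + 1 - maxabs {..n} z)"
  unfolding ball_map_eq using nrm_div[of _ n "twist z"] ball_den[of n z] nrm_twist by simp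

lemma maxabs_ball_map: "maxabs {..n} (ball_map n z) = maxabs {..n} z / (nrm n z + 1 - maxabs {..n} z)"
  unfolding ball_map_eq using maxabs_div[of _ n "twist z"] ball_den[of n z] maxabs_twist by simp

text \<open>The image determines the denominator by which it was scaled; injectivity and the
  preimage of a given point both come from this.\<close>

lemma ball_map_inverse:
  "1 - nrm n (ball_map n z) + maxabs {..n} (ball_map n z) = 1 / (nrm n z + 1 - maxabs {..n} z)"
  unfolding nrm_ball_map maxabs_ball_map using ball_den[of n z] by (simp add: field_simps)

lemma ball_map_inj:
  assumes z: "z \<in> fcube (Suc n)" "w \<in> fcube (Suc n)" and eq: "ball_map n z = ball_map n w"
  shows "z = w"
proof -
  have k: "nrm n z + 1 - maxabs {..n} z = nrm n w + 1 - maxabs {..n} w"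
    using ball_map_inverse[of z] ball_map_inverse[of w] eq by simp
  have k0: "nrm n w + 1 - maxabs {..n} w \<noteq> 0" using ball_den[of n w] by linarith
  have t: "twist z i = twist w i" for i
    using fun_cong[OF eq, of i] k0 unfolding ball_map_def k by (simp only: divide_cancel_right) blast
  show ?thesis
  proof
    fix i :: nat
    consider "i = 0" | "i = 1" | "i \<noteq> 0" "i \<noteq> 1" by blast
    then show "z i = w i"
      by cases (use t[of 0] t[of 1] t[of i] in \<open>simp_all add: twist_def\<close>)
  qed
qed

lemma ball_map_sphere_iff:
  assumes "z \<in> fcube (Suc n)"
  shows "(\<Sum>i\<le>n. (ball_map n z i)\<^sup>2) \<le> 1" "(\<Sum>i\<le>n. (ball_map n z i)\<^sup>2) = 1 \<longleftrightarrow> maxabs {..n} z = 1"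
proof -
  have m: "maxabs {..n} z \<le> 1" using assms by (intro fcube_maxabs) auto
  have d: "nrm n (ball_map n z) \<le> 1" "nrm n (ball_map n z) = 1 \<longleftrightarrow> maxabs {..n} z = 1"
    unfolding nrm_ball_map using ball_den[of n z] m by (auto simp: field_simps)
  show "(\<Sum>i\<le>n. (ball_map n z i)\<^sup>2) \<le> 1" "(\<Sum>i\<le>n. (ball_map n z i)\<^sup>2) = 1 \<longleftrightarrow> maxabs {..n} z = 1"
    using d nrm_nonneg[of n "ball_map n z"] by (simp_all add: nrm_def)
qed

lemma ball_map_outside: "z \<in> fcube (Suc n) \<Longrightarrow> i > n \<Longrightarrow> ball_map n z i = 0"
  using n by (simp add: ball_map_def twist_def fcube_def)

lemma ball_map_surj:
  assumes x: "x \<in> ndsk n"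
  shows "x \<in> ball_map n ` fcube (Suc n)"
proof -
  \<comment> \<open>The reciprocal of the denominator, as \<open>ball_map_inverse\<close>
    predicts.\<close>
  define t where "t = 1 - nrm n x + maxabs {..n} x"
  have n1: "nrm n x \<le> 1" using x by (simp add: nrm_def ndsk_def)
  have m0: "0 \<le> maxabs {..n} x" by (rule maxabs_nonneg) auto
  have t: "0 < t"
  proof (rule ccontr)
    assume "\<not> 0 < t"
    then have "nrm n x = 1" "maxabs {..n} x = 0" using n1 m0 by (simp_all add: t_def)
    then have "\<forall>i\<in>{..n}. \<bar>x i\<bar> \<le> 0" using maxabs_le_iff[of "{..n}" x 0] by simp
    then have "nrm n x = 0" by (simp add: nrm_def)
    then show False using \<open>nrm n x = 1\<close> by simp
  qed
  define y where "y = (\<lambda>i. x i / t)"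
  define z where "z i = (if i = 0 then - y 1 else if i = 1 then y 0 else y i)" for i
  have tw: "twist z = y" by (auto simp: twist_def z_def)
  have N: "nrm n z = nrm n x / t" using nrm_twist[of z] nrm_div[OF t] by (simp add: tw y_def)
  have M: "maxabs {..n} z = maxabs {..n} x / t" using maxabs_twist[of z] maxabs_div[OF t] by (simp add: tw y_def)
  have "maxabs {..n} z \<le> 1" unfolding M using t n1 by (simp add: t_def)
  then have zb: "\<forall>i\<in>{..n}. \<bar>z i\<bar> \<le> 1" using maxabs_le_iff[of "{..n}" z 1] by simp
  have "z \<in> fcube (Suc n)"
    unfolding fcube_def
  proof (intro CollectI conjI allI impI)
    show "\<bar>z i\<bar> \<le> 1" if "i < Suc n" for i using zb that by simp
    show "z i = 0" if "Suc n \<le> i" for i using that n x by (simp add: z_def y_def ndsk_def)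
  qed
  moreover have "nrm n z + 1 - maxabs {..n} z = 1 / t" unfolding N M using t by (simp add: t_def field_simps)
  then have "ball_map n z = x" unfolding ball_map_eq tw using t by (simp add: y_def)
  ultimately show ?thesis by blast
qed

lemma continuous_on_ball_map: "continuous_on X (ball_map n)"
proof (rule continuous_on_coordinatewise_then_product)
  fix i
  have t: "continuous_on X (\<lambda>z. twist z i)"
    unfolding twist_def by (cases "i = 0"; cases "i = 1") (auto intro!: continuous_on_eval continuous_on_minus)
  have N: "continuous_on X (nrm n)"
    unfolding nrm_def by (intro continuous_on_real_sqrt continuous_on_sum continuous_on_power continuous_on_eval)
  have M: "continuous_on X (maxabs {..n})" by (rule continuous_on_maxabs[where f = "\<lambda>x. x"]) auto
  have "nrm n z + 1 - maxabs {..n} z \<noteq> 0" for z using ball_den[of n z] by linarith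
  then show "continuous_on X (\<lambda>z. ball_map n z i)"
    unfolding ball_map_def
    by (intro continuous_on_divide continuous_on_add continuous_on_diff continuous_on_const t N M) auto
qed

lemma quotient_map_ball_map: "quotient_map (top_of_set (fcube (Suc n))) (top_of_set (ndsk n)) (ball_map n)"
proof (rule quotient_map_compact[OF compact_fcube continuous_on_ball_map])
  have "ball_map n z \<in> ndsk n" if "z \<in> fcube (Suc n)" for z
    using ball_map_sphere_iff[OF that] ball_map_outside[OF that] by (simp add: ndsk_def)
  then show "ball_map n ` fcube (Suc n) = ndsk n" using ball_map_surj by blast
qed

lemma deg2_nsph: "x \<in> nsph n \<Longrightarrow> deg2 x \<in> nsph n"
proof -
  assume x: "x \<in> nsph n"
  have "(\<Sum>i\<in>{..n}-{0,1}. (deg2 x i)\<^sup>2) = (\<Sum>i\<in>{..n}-{0,1}. (x i)\<^sup>2)"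
    by (rule sum.cong) (auto simp: deg2_apply(3))
  then have "(\<Sum>i\<le>n. (deg2 x i)\<^sup>2) = (\<Sum>i\<le>n. (x i)\<^sup>2)"
    unfolding sum_split01 using deg2_sq[of x] by simp
  moreover have "deg2 x i = 0" if "i > n" for i
    using that x n deg2_apply(3)[of i x] by (simp add: nsph_def)
  ultimately show ?thesis using x by (simp add: nsph_def)
qed

text \<open>\<open>deg2\<close> squares the complex number formed by coordinates 0 and 1 and divides
  by its modulus, so a preimage comes from a complex square root. Surjectivity makes
  \<open>deg2\<close> a quotient map, through which the continuity of the sphere's inclusion into
  the Moore space is checked.\<close>

lemma deg2_surj:
  assumes y: "y \<in> nsph n"
  shows "y \<in> deg2 ` nsph n"
proof (cases "y 0 = 0 \<and> y 1 = 0")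
  case True
  have "deg2 y i = y i" for i
    using deg2_apply(1,2)[of y] deg2_apply(3)[of i y] True by (cases "i = 0"; cases "i = 1") auto
  then have "deg2 y = y" by auto
  then show ?thesis using y by (metis imageI)
next
  case False
  define w where "w = csqrt (Complex (y 0) (y 1))"
  define r where "r = sqrt ((y 0)\<^sup>2 + (y 1)\<^sup>2)"
  have r: "r > 0" using False by (simp add: r_def sum_power2_gt_zero_iff)
  have w2: "w\<^sup>2 = Complex (y 0) (y 1)" by (simp add: w_def)
  have re: "(Re w)\<^sup>2 - (Im w)\<^sup>2 = y 0" using arg_cong[OF w2, of Re] by (simp add: power2_eq_square)
  have im: "2 * Re w * Im w = y 1" using arg_cong[OF w2, of Im] by (simp add: power2_eq_square mult_ac)
  have "(cmod w)\<^sup>2 = cmod (w\<^sup>2)" by (simp add: norm_power)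
  then have nw: "(Re w)\<^sup>2 + (Im w)\<^sup>2 = r" unfolding w2 by (simp add: cmod_power2 cmod_def r_def)
  \<comment> \<open>The factor \<open>sqrt r\<close> restores the modulus \<open>r\<close>: the
    square is then \<open>r\<close> times the wanted number, and dividing by \<open>r\<close> gives
    it.\<close>
  define x where "x = y(0 := Re w * sqrt r, 1 := Im w * sqrt r)"
  have x01: "(x 0)\<^sup>2 = (Re w)\<^sup>2 * r" "(x 1)\<^sup>2 = (Im w)\<^sup>2 * r" "x 0 * x 1 = Re w * Im w * r"
    using r by (simp_all add: x_def power_mult_distrib)
  have s: "(x 0)\<^sup>2 + (x 1)\<^sup>2 = r\<^sup>2" unfolding x01 using nw by (simp add: power2_eq_square flip: distrib_right)
  then have sq: "sqrt ((x 0)\<^sup>2 + (x 1)\<^sup>2) = r" using r by simp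
  have d0: "deg2 x 0 = y 0" unfolding deg2_apply sq unfolding x01 using re r by (simp flip: left_diff_distrib)
  have "2 * x 0 * x 1 = 2 * (x 0 * x 1)" by simp
  also have "\<dots> = (2 * Re w * Im w) * r" unfolding x01(3) by simp
  finally have "2 * x 0 * x 1 = y 1 * r" unfolding im .
  then have d1: "deg2 x 1 = y 1" unfolding deg2_apply sq using r by simp
  have di: "x i = y i" if "i \<noteq> 0" "i \<noteq> 1" for i using that by (simp add: x_def)
  have "deg2 x i = y i" for i
    using d0 d1 di[of i] deg2_apply(3)[of i x] by (cases "i = 0"; cases "i = 1") auto
  then have dx: "deg2 x = y" by auto
  have "(\<Sum>i\<in>{..n}-{0,1}. (x i)\<^sup>2) = (\<Sum>i\<in>{..n}-{0,1}. (y i)\<^sup>2)"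
    by (rule sum.cong) (auto simp: di)
  moreover have "(y 0)\<^sup>2 + (y 1)\<^sup>2 = r\<^sup>2" by (simp add: r_def)
  ultimately have "(\<Sum>i\<le>n. (x i)\<^sup>2) = (\<Sum>i\<le>n. (y i)\<^sup>2)" unfolding sum_split01 using s by simp
  then have "x \<in> nsph n" using y n di by (simp add: nsph_def)
  then show ?thesis using dx by blast
qed

text \<open>Normalize the segment from \<open>f d\<close> to \<open>g d\<close>. Comparing norms, it
  can pass through the origin only at its midpoint, and then the two points are antipodal.\<close>

lemma homotopic_not_antipodal:
  assumes f: "continuous_on (cube_rim n) f" "\<And>d. d \<in> cube_rim n \<Longrightarrow> f d \<in> nsph n"
    and g: "continuous_on (cube_rim n) g" "\<And>d. d \<in> cube_rim n \<Longrightarrow> g d \<in> nsph n"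
    and ap: "\<And>d. d \<in> cube_rim n \<Longrightarrow> \<exists>i\<le>n. f d i \<noteq> - g d i"
  shows "homotopic_with_canon (\<lambda>_. True) (cube_rim n) (nsph n) f g"
proof -
  define v where "v l d i = (1 - l) * f d i + l * g d i" for l :: real and d i
  have v0: "nrm n (v l d) \<noteq> 0" if "d \<in> cube_rim n" for l d
  proof
    assume "nrm n (v l d) = 0"
    then have "(\<Sum>i\<le>n. (v l d i)\<^sup>2) = 0" by (simp add: nrm_def)
    then have z: "v l d i = 0" if "i \<le> n" for i using that by (simp add: sum_nonneg_eq_0_iff)
    have "(\<Sum>i\<le>n. (1 - l)\<^sup>2 * (f d i)\<^sup>2) = (\<Sum>i\<le>n. l\<^sup>2 * (g d i)\<^sup>2)"
    proof (rule sum.cong)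
      fix i assume "i \<in> {..n}"
      then have "(1 - l) * f d i = - (l * g d i)" using z[of i] by (simp add: v_def)
      then have "((1 - l) * f d i)\<^sup>2 = (l * g d i)\<^sup>2" by simp
      then show "(1 - l)\<^sup>2 * (f d i)\<^sup>2 = l\<^sup>2 * (g d i)\<^sup>2" by (simp only: power_mult_distrib)
    qed simp
    then have "(1 - l)\<^sup>2 = l\<^sup>2"
      using f(2)[OF that] g(2)[OF that] by (simp add: nsph_def flip: sum_distrib_left)
    then have "l = 1/2" by (simp add: power2_eq_square algebra_simps)
    then have "f d i = - g d i" if "i \<le> n" for i
      using z[OF that] unfolding v_def \<open>l = 1/2\<close> by simp
    then show False using ap[OF that] by blast
  qed
  have vc: "continuous_on ({0..1} \<times> cube_rim n) (\<lambda>p. v (fst p) (snd p) i)" for i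
  proof -
    have s: "continuous_on ({0..1::real} \<times> cube_rim n) snd" by (rule continuous_on_snd[OF continuous_on_id])
    have fs: "continuous_on ({0..1::real} \<times> cube_rim n) (\<lambda>p. f (snd p))"
      by (rule continuous_on_compose2[OF f(1) s]) auto
    have gs: "continuous_on ({0..1::real} \<times> cube_rim n) (\<lambda>p. g (snd p))"
      by (rule continuous_on_compose2[OF g(1) s]) auto
    show ?thesis
      unfolding v_def
      by (intro continuous_on_add continuous_on_mult continuous_on_diff continuous_on_const continuous_on_fst
          continuous_on_id continuous_on_coord[OF fs] continuous_on_coord[OF gs])
  qed
  show ?thesis
  proof (rule homotopic_rimI[OF n, where F = "\<lambda>l d i. v l d i / nrm n (v l d)"])
    have "continuous_on ({0..1} \<times> cube_rim n) (\<lambda>p i. v (fst p) (snd p) i / nrm n (v (fst p) (snd p)))"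
    proof (rule continuous_on_coordinatewise_then_product)
      fix i
      have "continuous_on ({0..1} \<times> cube_rim n) (\<lambda>p. nrm n (v (fst p) (snd p)))"
        unfolding nrm_def by (intro continuous_on_real_sqrt continuous_on_sum continuous_on_power vc)
      then show "continuous_on ({0..1} \<times> cube_rim n) (\<lambda>p. v (fst p) (snd p) i / nrm n (v (fst p) (snd p)))"
        by (intro continuous_on_divide vc) (use v0 in auto)
    qed
    then show "continuous_on ({0..1} \<times> cube_rim n) (\<lambda>(l, d) i. v l d i / nrm n (v l d))"
      by (simp add: case_prod_unfold)
  next
    fix l :: real and d assume d: "d \<in> cube_rim n"
    have "nrm n (v l d) > 0" using v0[OF d, of l] nrm_nonneg[of n "v l d"] by linarith
    then have "(\<Sum>i\<le>n. (v l d i / nrm n (v l d))\<^sup>2) = 1"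
      by (simp add: power_divide nrm_sq flip: sum_divide_distrib) (simp add: nrm_def)
    then show "(\<lambda>i. v l d i / nrm n (v l d)) \<in> nsph n"
      using f(2)[OF d] g(2)[OF d] by (simp add: nsph_def v_def)
  next
    fix d assume d: "d \<in> cube_rim n"
    have "nrm n (f d) = 1" "nrm n (g d) = 1" using f(2)[OF d] g(2)[OF d] by (simp_all add: nrm_def nsph_def)
    moreover have "v 0 d = f d" "v 1 d = g d" by (auto simp: v_def)
    ultimately show "(\<lambda>i. v 0 d i / nrm n (v 0 d)) = f d" "(\<lambda>i. v 1 d i / nrm n (v 1 d)) = g d" by simp_all
  qed
qed

lemma ball_map_rim_nsph: "d \<in> cube_rim n \<Longrightarrow> ball_map n d \<in> nsph n"
  using ball_map_sphere_iff[of d] ball_map_outside[of d] by (simp add: cube_rim_def nsph_def)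

text \<open>Corresponding coordinates of the two maps never have opposite signs. For index 2 and
  above both are nonnegative multiples of \<open>d i\<close>; at index 1 both are nonpositive
  multiples of \<open>d 0 * d 1\<close>. If the maps were antipodal all these would vanish, and then
  coordinate 0 of the two maps does not change sign either, although it is nonzero for one of
  them.\<close>

lemma flipped_deg2:
  "homotopic_with_canon (\<lambda>_. True) (cube_rim n) (nsph n) (flipped n {1}) (\<lambda>d. deg2 (ball_map n d))"
proof (rule homotopic_not_antipodal)
  note [simp del] = One_nat_def
  show "continuous_on (cube_rim n) (flipped n {1})"
    using continuous_on_flipped[OF n continuous_on_id] by simp
  show "flipped n {1} d \<in> nsph n" if "d \<in> cube_rim n" for d
    using flipped_nsph[OF n that, of "{1}"] n by simp
  show "continuous_on (cube_rim n) (\<lambda>d. deg2 (ball_map n d))"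
    by (rule continuous_on_compose2[OF continuous_on_deg2[of UNIV] continuous_on_ball_map]) simp
  show "deg2 (ball_map n d) \<in> nsph n" if "d \<in> cube_rim n" for d
    using deg2_nsph ball_map_rim_nsph that by blast
  fix d assume d: "d \<in> cube_rim n"
  show "\<exists>i\<le>n. flipped n {1} d i \<noteq> - deg2 (ball_map n d) i"
  proof (rule ccontr)
    assume "\<not> ?thesis"
    then have eq: "flipped n {1} d i = - deg2 (ball_map n d) i" if "i \<le> n" for i using that by blast
    define b k m D where "b = ball_map n d" and "k = nrm n d + 1 - maxabs {..n} d"
      and "m = 1 - maxabs {1..n} d" and "D = cden n d"
    have k: "k > 0" using ball_den[of n d] by (simp add: k_def)
    have D: "D > 0" using cden_pos[OF n] by (simp add: D_def)
    have m: "m \<ge> 0" using fcube_maxabs_tail[OF n, of d] d by (simp add: m_def cube_rim_def)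
    have bi: "b i = twist d i / k" for i by (simp add: b_def ball_map_def k_def)
    have b01: "b 0 = d 1 / k" "b 1 = - d 0 / k" by (simp_all add: bi twist_def)
    have ci: "collapse n d i = 2 * m / D * d i" if "i \<in> {1..n}" for i
      using that by (auto simp: collapse_def m_def D_def)
    have d0: "d i = 0" if i: "i \<in> {2..n}" for i
    proof -
      have "2 * m / D * d i = - (d i / k)"
        using eq[of i] i ci[of i] deg2_apply(3)[of i b] bi[of i] by (simp add: flipped_def b_def[symmetric] twist_def)
      then have "d i * (2 * m / D + 1 / k) = 0" by (simp add: algebra_simps)
      moreover have "2 * m / D + 1 / k > 0" using m D k by (intro add_nonneg_pos) simp_all
      ultimately show ?thesis by simp
    qed
    \<comment> \<open>A point of the rim has some coordinate of modulus 1, and those from 2 on are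
      zero.\<close>
    have at: "\<bar>d 0\<bar> = 1 \<or> \<bar>d 1\<bar> = 1"
    proof -
      obtain i where i: "i \<in> {..n}" "\<bar>d i\<bar> = 1"
        using maxabs_attained[of "{..n}" d] d by (force simp: cube_rim_def)
      then have "i \<notin> {2..n}" using d0 by fastforce
      then have "i = 0 \<or> i = 1" using i(1) by auto
      then show ?thesis using i(2) by blast
    qed
    define r where "r = sqrt ((b 0)\<^sup>2 + (b 1)\<^sup>2)"
    have r: "r > 0" using at k by (auto simp: r_def b01 sum_power2_gt_zero_iff)
    \<comment> \<open>The quarter turn gives \<open>b 0 * b 1\<close> the sign of
      \<open>- (d 0 * d 1)\<close>, matching the sign of the flipped coordinate.\<close>
    have "- d 0 * (2 * m / D * d 1) = - (2 * b 0 * b 1 / r)"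
      using eq[of 1] n ci[of 1] deg2_apply(2)[of b] by (simp add: flipped_def b_def[symmetric] r_def)
    then have "d 0 * d 1 * (2 * m / D + 2 / (k * k * r)) = 0"
      unfolding b01 by (simp add: algebra_simps)
    moreover have "2 * m / D + 2 / (k * k * r) > 0" using m D k r by (intro add_nonneg_pos) simp_all
    ultimately have "d 0 = 0 \<or> d 1 = 0" by simp
    moreover have e0: "collapse n d 0 = - (((b 0)\<^sup>2 - (b 1)\<^sup>2) / r)"
      using eq[of 0] deg2_apply(1)[of b] by (simp add: flipped_def b_def[symmetric] r_def)
    ultimately show False
    proof (elim disjE)
      assume d00: "d 0 = 0"
      then have d1: "\<bar>d 1\<bar> = 1" using at by simp
      then have "maxabs {1..n} d = 1"
        using abs_le_maxabs[of "{1..n}" 1 d] n m by (simp add: m_def)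
      then have "collapse n d 0 = 1" using collapse_e0_iff[OF n, of d] by (simp add: e0_def)
      moreover have "((b 0)\<^sup>2 - (b 1)\<^sup>2) / r \<ge> 0" using d00 r by (simp add: b01)
      ultimately show False using e0 by simp
    next
      assume d10: "d 1 = 0"
      have all0: "d i = 0" if "i \<in> {1..n}" for i using d0[of i] d10 that by (cases "i = 1") auto
      have "maxabs {1..n} d = 0"
        using maxabs_le_iff[of "{1..n}" d 0] all0 n maxabs_nonneg[of "{1..n}" d] by force
      then have "collapse n d 0 = - 1" using all0 by (simp add: collapse_def cden_def)
      moreover have "((b 0)\<^sup>2 - (b 1)\<^sup>2) / r \<le> 0" using d10 r by (simp add: b01 divide_nonpos_pos)
      ultimately show False using e0 by simp
    qed
  qed
qed

end

text \<open>Seen through \<open>ball_map\<close>, \<open>Moore2\<close> is the cell attached to the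
  sphere along \<open>deg2\<close>, which is homotopic to the attaching map for an odd number of
  flips.\<close>

lemma smash_odd:
  assumes U: "finite U" "U \<subseteq> {2..}" "odd (card U)"
  shows "ptd_equiv (Zsp U {}) (Zbase U {}) (wedge {(3, card U, j)} RHS_space RHS_base) None"
proof -
  define n where "n = card U + 1"
  have n: "1 \<le> n" by (simp add: n_def)
  have Une: "U \<noteq> {}" using U(3) by auto
  interpret cubes "fcube (Suc n)" "nsph n" "{..n}" "(=)" "(=)" "{}" e0
    by (rule cubes_sphere[OF n])
  obtain j0 i0 where att0: "attached (Zsp U {}) j0 i0 (flipped n {2..n})" and b0: "i0 e0 = Zbase U {}"
    using attached_smash[OF n U(1,2) Une n_def] .
  let ?M = "Moore2 (Suc n)"
  define mq where "mq x = (if (\<Sum>i\<le>n. (x i)\<^sup>2) = 1 then (True, deg2 x) else (False, x))" for x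
  have mq: "quotient_map (top_of_set (ndsk n)) ?M mq"
    using quotient_map_quotient_top[of "top_of_set (ndsk n)" mq]
    unfolding Moore2_def mq_def by (simp add: ndisk_ndsk)
  have q: "quotient_map (top_of_set (fcube (Suc n))) ?M (\<lambda>z. mq (ball_map n z))"
    using quotient_map_compose[OF quotient_map_ball_map[OF n] mq] by (simp add: o_def)
  have d2: "quotient_map (top_of_set (nsph n)) (top_of_set (nsph n)) deg2"
  proof (rule quotient_map_compact)
    have "collapse n ` fcube (Suc n) = nsph n"
      using quotient_imp_surjective_map[OF quotient_map_collapse[OF n, of "Suc n"]] by simp
    moreover have "continuous_on (fcube (Suc n)) (collapse n)"
      using continuous_on_collapse[OF n continuous_on_id] by simp
    ultimately show "compact (nsph n)"
      using compact_continuous_image[OF _ compact_fcube] by metis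
    show "deg2 ` nsph n = nsph n" using deg2_nsph[OF n] deg2_surj[OF n] by blast
  qed (rule continuous_on_deg2)
  \<comment> \<open>Composed with the quotient map \<open>deg2\<close>, the inclusion becomes the
    restriction of \<open>mq\<close> to the boundary sphere.\<close>
  have i1: "continuous_map (top_of_set (nsph n)) ?M (Pair True)"
  proof (rule continuous_compose_quotient_map[OF d2])
    have "continuous_map (top_of_set (nsph n)) ?M mq"
      using continuous_map_comp_on[OF quotient_imp_continuous_map[OF mq] continuous_on_id, of "nsph n"]
      by (auto simp: nsph_def ndsk_def)
    then show "continuous_map (top_of_set (nsph n)) ?M (Pair True \<circ> deg2)"
      by (rule continuous_map_eq) (simp add: mq_def nsph_def)
  qed
  have inner: "mq (ball_map n z) = (False, ball_map n z)" if "z \<in> fcube (Suc n)" "\<mu> z < 1" for z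
    using ball_map_sphere_iff(2)[OF n that(1)] that(2) by (simp add: mq_def)
  have att1: "attached ?M (\<lambda>z. mq (ball_map n z)) (Pair True) (\<lambda>d. deg2 (ball_map n d))"
    unfolding attached_def rim_eq[OF n]
  proof (intro conjI ballI impI)
    show "final_maps ?M UNIV (\<lambda>k. if k then top_of_set (fcube (Suc n)) else top_of_set (nsph n))
      (\<lambda>k. if k then \<lambda>z. mq (ball_map n z) else Pair True)"
      by (rule final_maps_quotient[OF q i1])
    fix d assume d: "d \<in> cube_rim n"
    note b = ball_map_rim_nsph[OF n d]
    show "deg2 (ball_map n d) \<in> nsph n" by (rule deg2_nsph[OF n b])
    show "mq (ball_map n d) = (True, deg2 (ball_map n d))" using b by (simp add: mq_def nsph_def)
  next
    fix z w assume z: "z \<in> fcube (Suc n)" "w \<in> fcube (Suc n)" "\<mu> z < 1" "\<mu> w < 1"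
    show "mq (ball_map n z) = mq (ball_map n w) \<longleftrightarrow> z = w \<or> z \<in> {} \<and> w \<in> {}"
      unfolding inner[OF z(1,3)] inner[OF z(2,4)] using ball_map_inj[OF n z(1,2)] by auto
  next
    fix z x assume z: "z \<in> fcube (Suc n)" "\<mu> z < 1"
    show "mq (ball_map n z) = (True, x) \<longleftrightarrow> z \<in> {} \<and> x = e0"
      unfolding inner[OF z] by simp
  qed simp
  have "odd (card {2..n})" using U(3) by (simp add: n_def)
  then have h: "homotopic_with_canon (\<lambda>_. True) (cube_rim n) (nsph n) (flipped n {2..n}) (\<lambda>d. deg2 (ball_map n d))"
    using homotopic_with_trans[OF flipped_parity[OF n, of "{2..n}"]] flipped_deg2[OF n] by simp
  have "ptd_equiv (Zsp U {}) (Zbase U {}) ?M (True, e0)"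
    using attached_sphere_ptd_equiv[OF n h att0 att1] by (simp add: b0)
  then have "ptd_equiv (Zsp U {}) (Zbase U {}) (RHS_space (3, card U, j)) (RHS_base (3, card U, j))"
    by (simp add: RHS_space_def RHS_base_def n_def)
  then show ?thesis
    by (rule ptd_equiv_trans) (rule ptd_equiv_wedge_singleton, use \<open>ptd_equiv _ _ (RHS_space _) _\<close> in \<open>simp add: ptd_equiv_def\<close>)
qed

subsection \<open>The suspended Klein bottles\<close>

text \<open>\<open>E\<close> covers at least one point of each orbit of the involution. The preimage
  of a set in \<open>X\<close> is \<open>W\<close> together with its preimage under
  \<open>\<kappa>\<close>, where \<open>W\<close> is closed as a compact subset of a Hausdorff
  space.\<close>

lemma quotient_map_fundamental_domain:
  assumes Q: "quotient_map X Y Q" and E: "continuous_map C X E" and C: "compact_space C" and X: "Hausdorff_space X"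
    and k: "continuous_map X X \<kappa>" "\<And>x. x \<in> topspace X \<Longrightarrow> \<kappa> (\<kappa> x) = x" "\<And>x. x \<in> topspace X \<Longrightarrow> Q (\<kappa> x) = Q x"
    and dom: "\<And>x. x \<in> topspace X \<Longrightarrow> x \<in> E ` topspace C \<or> \<kappa> x \<in> E ` topspace C"
  shows "quotient_map C Y (Q \<circ> E)"
  unfolding quotient_map_closedin
proof (intro conjI allI impI)
  have Qs: "Q ` topspace X = topspace Y" using quotient_imp_surjective_map[OF Q] .
  have EX: "E c \<in> topspace X" if "c \<in> topspace C" for c
    using continuous_map_image_subset_topspace[OF E] that by blast
  have kX: "\<kappa> x \<in> topspace X" if "x \<in> topspace X" for x
    using continuous_map_image_subset_topspace[OF k(1)] that by blast
  have cont: "continuous_map C Y (Q \<circ> E)"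
    by (rule continuous_map_compose[OF E quotient_imp_continuous_map[OF Q]])
  show "(Q \<circ> E) ` topspace C = topspace Y"
  proof
    show "(Q \<circ> E) ` topspace C \<subseteq> topspace Y" by (rule continuous_map_image_subset_topspace[OF cont])
    show "topspace Y \<subseteq> (Q \<circ> E) ` topspace C"
    proof
      fix y assume "y \<in> topspace Y"
      then obtain x where x: "x \<in> topspace X" "y = Q x" using Qs by blast
      from dom[OF x(1)] show "y \<in> (Q \<circ> E) ` topspace C"
      proof
        assume "x \<in> E ` topspace C"
        then show ?thesis using x by auto
      next
        assume "\<kappa> x \<in> E ` topspace C"
        then obtain c where "c \<in> topspace C" "\<kappa> x = E c" by blast
        then have "y = (Q \<circ> E) c" using x k(3)[OF x(1)] by simp
        then show ?thesis using \<open>c \<in> topspace C\<close> by blast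
      qed
    qed
  qed
  fix U assume U: "U \<subseteq> topspace Y"
  show "closedin C {c \<in> topspace C. (Q \<circ> E) c \<in> U} \<longleftrightarrow> closedin Y U"
  proof
    assume "closedin Y U"
    then show "closedin C {c \<in> topspace C. (Q \<circ> E) c \<in> U}"
      by (rule closedin_continuous_map_preimage[OF cont])
  next
    assume cl: "closedin C {c \<in> topspace C. (Q \<circ> E) c \<in> U}"
    define W where "W = E ` {c \<in> topspace C. (Q \<circ> E) c \<in> U}"
    have "closedin X W"
      unfolding W_def by (rule compactin_imp_closedin[OF X image_compactin[OF closedin_compact_space[OF C cl] E]])
    then have "closedin X (W \<union> {x \<in> topspace X. \<kappa> x \<in> W})"
      by (intro closedin_Un closedin_continuous_map_preimage[OF k(1)])
    moreover have "{x \<in> topspace X. Q x \<in> U} = W \<union> {x \<in> topspace X. \<kappa> x \<in> W}"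
    proof (intro equalityI subsetI)
      fix x assume "x \<in> {x \<in> topspace X. Q x \<in> U}"
      then have x: "x \<in> topspace X" "Q x \<in> U" by simp_all
      from dom[OF x(1)] show "x \<in> W \<union> {x \<in> topspace X. \<kappa> x \<in> W}"
      proof
        assume "x \<in> E ` topspace C"
        then have "x \<in> W" using x by (auto simp: W_def)
        then show ?thesis ..
      next
        assume "\<kappa> x \<in> E ` topspace C"
        then obtain c where "c \<in> topspace C" "\<kappa> x = E c" by blast
        moreover then have "(Q \<circ> E) c \<in> U" using x k(3)[OF x(1)] by simp
        ultimately have "\<kappa> x \<in> W" by (auto simp: W_def)
        then show ?thesis using x by simp
      qed
    next
      fix x assume "x \<in> W \<union> {x \<in> topspace X. \<kappa> x \<in> W}"
      then show "x \<in> {x \<in> topspace X. Q x \<in> U}"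
      proof
        assume "x \<in> W"
        then show ?thesis using EX by (auto simp: W_def)
      next
        assume "x \<in> {x \<in> topspace X. \<kappa> x \<in> W}"
        then have x: "x \<in> topspace X" and "\<kappa> x \<in> W" by simp_all
        then have "Q (\<kappa> x) \<in> U" by (auto simp: W_def)
        then show ?thesis using x k(3)[OF x] by simp
      qed
    qed
    ultimately have "closedin X {x \<in> topspace X. Q x \<in> U}" by simp
    then show "closedin Y U" using Q U unfolding quotient_map_closedin by blast
  qed
qed

section \<open>Angle coordinates on the circle and the half circle\<close>

lemma cis_eq_iff_circ:
  assumes "\<bar>x\<bar> \<le> 1" "\<bar>y\<bar> \<le> 1"
  shows "cis (pi * x) = cis (pi * y) \<longleftrightarrow> circ x y"
proof
  assume "cis (pi * x) = cis (pi * y)"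
  then have "sin (pi * x) = sin (pi * y) \<and> cos (pi * x) = cos (pi * y)" by (simp add: complex_eq_iff)
  then obtain k :: int where "pi * x = pi * y + 2 * pi * k" using sin_cos_eq_iff by blast
  then have "pi * x = pi * (y + 2 * k)" by (simp add: algebra_simps)
  then have k: "x = y + 2 * k" by simp
  have "\<bar>2 * real_of_int k\<bar> \<le> 2" using k assms by linarith
  then have "k = 0 \<or> k = 1 \<or> k = - 1" by linarith
  then show "circ x y" using k assms by (auto simp: circ_def)
next
  assume "circ x y"
  then show "cis (pi * x) = cis (pi * y)" by (auto simp: circ_def abs_if complex_eq_iff split: if_splits)
qed

lemma cis_half_eq:
  assumes "\<bar>x\<bar> \<le> 1" "\<bar>y\<bar> \<le> 1"
  shows "cis (pi * (x / 2)) = cis (pi * (y / 2)) \<longleftrightarrow> x = y"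
  using cis_eq_iff_circ[of "x / 2" "y / 2"] assms by (auto simp: circ_def)

text \<open>Both points have nonnegative real part, so they are opposite only when both real parts
  vanish, at the two ends of the half circle.\<close>

lemma cis_half_neg:
  assumes "\<bar>x\<bar> \<le> 1" "\<bar>y\<bar> \<le> 1"
  shows "cis (pi * (x / 2)) = - cis (pi * (y / 2)) \<longleftrightarrow> \<bar>x\<bar> = 1 \<and> y = - x"
proof
  assume eq: "cis (pi * (x / 2)) = - cis (pi * (y / 2))"
  have ge: "cos (pi * (u / 2)) \<ge> 0" if "\<bar>u\<bar> \<le> 1" for u
  proof (rule cos_ge_zero)
    show "- (pi / 2) \<le> pi * (u / 2)" "pi * (u / 2) \<le> pi / 2"
      using that mult_left_mono[of "-1" u "pi / 2"] mult_left_mono[of u 1 "pi / 2"] by (simp_all add: abs_le_iff)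
  qed
  have "cos (pi * (x / 2)) = - cos (pi * (y / 2))" using arg_cong[OF eq, of Re] by simp
  then have z: "cos (pi * (y / 2)) = 0" using ge[OF assms(1)] ge[OF assms(2)] by linarith
  then have "- cis (pi * (y / 2)) = cis (pi * (- y / 2))" by (simp add: complex_eq_iff)
  then have xy: "x = - y" using eq cis_half_eq[of x "- y"] assms by simp
  have "\<bar>y\<bar> = 1"
  proof (rule ccontr)
    assume "\<bar>y\<bar> \<noteq> 1"
    then have "- 1 < y" "y < 1" using assms(2) by auto
    then have "cos (pi * (y / 2)) > 0"
      using mult_strict_left_mono[of "-1" y "pi / 2"] mult_strict_left_mono[of y 1 "pi / 2"]
      by (intro cos_gt_zero_pi) simp_all
    then show False using z by simp
  qed
  then show "\<bar>x\<bar> = 1 \<and> y = - x" using xy by simp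
next
  assume "\<bar>x\<bar> = 1 \<and> y = - x"
  then show "cis (pi * (x / 2)) = - cis (pi * (y / 2))"
    by (auto simp: abs_if complex_eq_iff split: if_splits)
qed

lemma sphere_cis:
  assumes "v \<in> sphere (0::complex) 1"
  obtains x where "\<bar>x\<bar> \<le> 1" "v = - cis (pi * x)"
proof
  have v: "norm v = 1" using assms by simp
  then have v0: "v \<noteq> 0" by force
  show "\<bar>Arg (- v) / pi\<bar> \<le> 1" using Arg_bounded[of "- v"] by (simp add: abs_le_iff field_simps)
  show "v = - cis (pi * (Arg (- v) / pi))" using v v0 cis_Arg[of "- v"] by (simp add: sgn_div_norm)
qed

lemma half_sphere_cis:
  assumes "v \<in> sphere (0::complex) 1" "Im v \<ge> 0"
  obtains x where "\<bar>x\<bar> \<le> 1" "v = \<i> * cis (pi * (x / 2))"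
proof
  let ?w = "- \<i> * v"
  have w: "norm ?w = 1" "Re ?w \<ge> 0" using assms by (simp_all add: norm_mult)
  then have "\<bar>Arg ?w\<bar> \<le> pi / 2" using Arg_Re_nonneg by blast
  then show "\<bar>2 * Arg ?w / pi\<bar> \<le> 1" by (simp add: abs_mult field_simps)
  have "?w \<noteq> 0" using w(1) by force
  then have "cis (Arg ?w) = ?w" using w(1) cis_Arg[of ?w] by (simp add: sgn_div_norm)
  then have "\<i> * cis (Arg ?w) = v" by simp
  then show "v = \<i> * cis (pi * (2 * Arg ?w / pi / 2))" by simp
qed

lemma Kinv_Kinv: "Kinv n (Kinv n z) = z"
  by (auto simp: Kinv_def)

lemma topspace_torus: "topspace (torus n) = PiE {..<n} (\<lambda>_. sphere 0 1)"
  by (simp add: torus_def)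

lemma Kinv_torus: "1 \<le> n \<Longrightarrow> z \<in> topspace (torus n) \<Longrightarrow> Kinv n z \<in> topspace (torus n)"
  unfolding topspace_torus by (auto simp: Kinv_def PiE_iff extensional_def)

lemma continuous_map_into_torus:
  assumes "\<And>x. x \<in> topspace X \<Longrightarrow> f x \<in> topspace (torus n)"
    and "\<And>k. k < n \<Longrightarrow> continuous_map X euclidean (\<lambda>x. f x k)"
  shows "continuous_map X (torus n) f"
  unfolding torus_def continuous_map_componentwise
proof (intro conjI ballI)
  show "f ` topspace X \<subseteq> extensional {..<n}"
    using assms(1) by (auto simp: topspace_torus PiE_iff)
  fix k assume k: "k \<in> {..<n}"
  have "f x k \<in> sphere 0 1" if "x \<in> topspace X" for x
    using assms(1)[OF that] k unfolding topspace_torus by (rule PiE_mem)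
  then show "continuous_map X (top_of_set (sphere 0 1)) (\<lambda>x. f x k)"
    using assms(2) k by (simp add: continuous_map_in_subtopology Pi_iff)
qed

lemma continuous_map_torus_coord: "k < n \<Longrightarrow> continuous_map (torus n) euclidean (\<lambda>z. z k)"
  unfolding torus_def
  using continuous_map_product_projection[of k "{..<n}" "\<lambda>_. top_of_set (sphere (0::complex) 1)"]
  by (simp add: continuous_map_in_subtopology)

lemma continuous_map_Kinv:
  assumes n: "1 \<le> n"
  shows "continuous_map (torus n) (torus n) (Kinv n)"
proof (rule continuous_map_into_torus[OF Kinv_torus[OF n]])
  fix k assume k: "k < n"
  have c: "continuous_map (torus n) euclidean (\<lambda>z. z k)" by (rule continuous_map_torus_coord[OF k])
  have a: "continuous_map euclidean euclidean cnj" "continuous_map euclidean euclidean (uminus :: complex \<Rightarrow> complex)"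
    by (simp_all add: continuous_on_cnj continuous_on_minus continuous_on_id)
  show "continuous_map (torus n) euclidean (\<lambda>z. Kinv n z k)"
  proof (cases "k < n - 1")
    case True
    then show ?thesis using continuous_map_compose[OF c a(1)] by (simp add: o_def Kinv_def)
  next
    case False
    then have "k = n - 1" using k by linarith
    then show ?thesis using continuous_map_compose[OF c a(2)] by (simp add: o_def Kinv_def)
  qed
qed

text \<open>Fibre circles are shifted by 2 past the half circle and suspension coordinates. The last
  coordinate covers only the part of the circle with nonnegative imaginary part, from 1 at
  \<open>z 0 = - 1\<close> to -1 at \<open>z 0 = 1\<close>.\<close>

definition Kcoord :: "nat \<Rightarrow> (nat \<Rightarrow> real) \<Rightarrow> nat \<Rightarrow> complex" where
  "Kcoord n z = restrict (\<lambda>i. if i < n - 1 then - cis (pi * z (i + 2)) else \<i> * cis (pi * (z 0 / 2))) {..<n}"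

lemma Kcoord_torus: "Kcoord n z \<in> topspace (torus n)"
  unfolding topspace_torus by (auto simp: Kcoord_def norm_mult)

lemma Kcoord_surj:
  assumes n: "1 \<le> n" and v: "v \<in> topspace (torus n)" "Im (v (n - 1)) \<ge> 0" and t: "\<bar>t\<bar> \<le> 1"
  obtains z where "z \<in> hcube" "z 1 = t" "v = Kcoord n z"
proof -
  have vs: "v i \<in> sphere 0 1" if "i < n" for i
    using PiE_mem[of v "{..<n}" "\<lambda>_. sphere 0 1" i] v(1) that by (simp add: topspace_torus)
  have "\<exists>x. \<bar>x\<bar> \<le> 1 \<and> v i = - cis (pi * x)" if "i < n" for i
    using sphere_cis[OF vs[OF that]] by metis
  then obtain x where x: "\<And>i. i < n \<Longrightarrow> \<bar>x i\<bar> \<le> 1 \<and> v i = - cis (pi * x i)" by metis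
  obtain s where s: "\<bar>s\<bar> \<le> 1" "v (n - 1) = \<i> * cis (pi * (s / 2))"
    using half_sphere_cis[OF vs[of "n - 1"] v(2)] n by (metis diff_less less_le_trans zero_less_one)
  define z where "z i = (if i = 0 then s else if i = 1 then t else if i - 2 < n then x (i - 2) else 0)" for i
  show thesis
  proof
    show "z \<in> hcube" using s t x by (auto simp: hcube_def z_def)
    show "z 1 = t" by (simp add: z_def)
    show "v = Kcoord n z"
    proof
      fix i
      consider "i < n - 1" | "i = n - 1" | "i \<ge> n" using n by linarith
      then show "v i = Kcoord n z i"
      proof cases
        case 1
        then have "i < n" by linarith
        then show ?thesis using 1 x[of i] by (simp add: Kcoord_def z_def)
      next
        case 2
        then show ?thesis using s n by (simp add: Kcoord_def z_def)
      next
        case 3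
        then show ?thesis using v(1) by (auto simp: topspace_torus Kcoord_def PiE_iff extensional_def)
      qed
    qed
  qed
qed

lemma Kcoord_eq:
  assumes n: "1 \<le> n" and z: "z \<in> hcube" "w \<in> hcube"
  shows "Kcoord n z = Kcoord n w \<longleftrightarrow> z 0 = w 0 \<and> (\<forall>i\<in>{2..<n+1}. circ (z i) (w i))"
    and "Kcoord n z = Kinv n (Kcoord n w) \<longleftrightarrow> \<bar>z 0\<bar> = 1 \<and> w 0 = - z 0 \<and> (\<forall>i\<in>{2..<n+1}. circ (z i) (- w i))"
proof -
  note [simp del] = One_nat_def
  have le: "\<bar>z i\<bar> \<le> 1" "\<bar>w i\<bar> \<le> 1" for i using z by (simp_all add: hcube_def)
  have idx: "(\<forall>i<n. Q i) \<longleftrightarrow> Q (n - 1) \<and> (\<forall>i<n - 1. Q i)" for Q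
  proof -
    have "i < n \<longleftrightarrow> i = n - 1 \<or> i < n - 1" for i using n by linarith
    then show ?thesis by auto
  qed
  have sh: "(\<forall>i\<in>{2..<n+1}. Q i) \<longleftrightarrow> (\<forall>i<n - 1. Q (i + 2))" for Q
  proof
    assume "\<forall>i\<in>{2..<n+1}. Q i"
    then show "\<forall>i<n - 1. Q (i + 2)" by simp
  next
    assume r: "\<forall>i<n - 1. Q (i + 2)"
    show "\<forall>i\<in>{2..<n+1}. Q i"
    proof
      fix i assume "i \<in> {2..<n+1}"
      then have i: "2 \<le> i" "i < n + 1" by simp_all
      have e: "i - 2 + 2 = i" using i by simp
      have "i - 2 < n - 1" using i by linarith
      then have "Q (i - 2 + 2)" using r by blast
      then show "Q i" unfolding e .
    qed
  qed
  have ext: "u = v \<longleftrightarrow> (\<forall>i<n. u i = v i)" if "u \<in> topspace (torus n)" "v \<in> topspace (torus n)" for u v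
    using that unfolding topspace_torus
    by (metis PiE_ext lessThan_iff)
  have 1: "Kcoord n z i = - cis (pi * z (i + 2))" if "i < n - 1" for z i
  proof -
    have "i < n" using that by linarith
    then show ?thesis using that by (simp add: Kcoord_def)
  qed
  have 2: "Kcoord n z (n - 1) = \<i> * cis (pi * (z 0 / 2))" for z using n by (simp add: Kcoord_def)
  have "Kcoord n z = Kcoord n w \<longleftrightarrow> cis (pi * (z 0 / 2)) = cis (pi * (w 0 / 2)) \<and>
      (\<forall>i<n - 1. cis (pi * z (i + 2)) = cis (pi * w (i + 2)))"
    unfolding ext[OF Kcoord_torus Kcoord_torus] idx using 1 2 by simp
  then show "Kcoord n z = Kcoord n w \<longleftrightarrow> z 0 = w 0 \<and> (\<forall>i\<in>{2..<n+1}. circ (z i) (w i))"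
    unfolding sh by (simp only: cis_half_eq[OF le] cis_eq_iff_circ[OF le])
  have 3: "Kinv n (Kcoord n w) i = - cis (pi * (- w (i + 2)))" if "i < n - 1" for i
    using that by (simp add: Kinv_def 1 cis_cnj)
  have 4: "Kinv n (Kcoord n w) (n - 1) = \<i> * - cis (pi * (w 0 / 2))" by (simp add: Kinv_def 2)
  have 5: "(\<forall>i<n - 1. Kcoord n z i = Kinv n (Kcoord n w) i) \<longleftrightarrow>
      (\<forall>i<n - 1. cis (pi * z (i + 2)) = cis (pi * (- w (i + 2))))"
    by (rule all_cong1, rule imp_cong[OF refl]) (simp only: 1 3 neg_equal_iff_equal)
  have 6: "\<i> * cis (pi * (z 0 / 2)) = \<i> * - cis (pi * (w 0 / 2)) \<longleftrightarrow> cis (pi * (z 0 / 2)) = - cis (pi * (w 0 / 2))"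
    by (simp only: mult_cancel_left complex_i_not_zero simp_thms)
  have 7: "cis (pi * z i) = cis (pi * (- w j)) \<longleftrightarrow> circ (z i) (- w j)" for i j
    using cis_eq_iff_circ[OF le(1)[of i], of "- w j"] le(2)[of j] by (simp only: abs_minus_cancel)
  show "Kcoord n z = Kinv n (Kcoord n w) \<longleftrightarrow> \<bar>z 0\<bar> = 1 \<and> w 0 = - z 0 \<and> (\<forall>i\<in>{2..<n+1}. circ (z i) (- w i))"
    unfolding ext[OF Kcoord_torus Kinv_torus[OF n Kcoord_torus]] idx 2 4 5 6 7 sh
      cis_half_neg[OF le(1)[of 0] le(2)[of 0]] by (rule conj_assoc)
qed

text \<open>Both spaces are quotients of the Hilbert cube: the suspension through the fundamental
  domain of the involution, the model by definition. It remains to match their kernels.\<close>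

lemma suspended_Klein:
  assumes n: "1 \<le> n"
  shows "ptd_equiv (reduced_suspension (Kspace n) (Kbase n)) None (Zsp {} {2..<n+1}) (Zbase {} {2..<n+1})"
proof -
  note [simp del] = One_nat_def
  let ?I = "top_of_set {0..1::real}" and ?P = "{2..<n+1}"
  let ?X = "prod_topology (torus n) ?I" and ?Y = "reduced_suspension (Kspace n) (Kbase n)"
  define qK where "qK z = {z, Kinv n z}" for z
  have qK: "quotient_map (torus n) (Kspace n) qK"
    unfolding Kspace_def qK_def by (rule quotient_map_quotient_top)
  have qK_eq: "qK u = qK v \<longleftrightarrow> u = v \<or> u = Kinv n v" for u v
    unfolding qK_def doubleton_eq_iff using Kinv_Kinv by metis
  have qK_inv: "qK (Kinv n u) = qK u" for u by (simp add: qK_eq)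
  define rs where "rs = (\<lambda>(x, t). if t = 0 \<or> t = 1 \<or> x = Kbase n then None else Some (x, t :: real))"
  have rs: "quotient_map (prod_topology (Kspace n) ?I) ?Y rs"
    unfolding reduced_suspension_def rs_def by (rule quotient_map_quotient_top)
  have hI: "Hausdorff_space ?I" by (simp add: Hausdorff_space_subtopology)
  have lI: "locally_compact_space ?I"
    by (intro compact_imp_locally_compact_space disjI1) (simp_all add: compact_space_subtopology)
  \<comment> \<open>The product of a quotient map with the interval is a quotient map because the
    interval is locally compact.\<close>
  have qI: "quotient_map ?X (prod_topology (Kspace n) ?I) (\<lambda>(x, y). (qK x, y))"
    using quotient_map_prod_left[OF lI _ qK] hI by blast
  define Q where "Q = rs \<circ> (\<lambda>(x, y). (qK x, y))"
  have Q: "quotient_map ?X ?Y Q" unfolding Q_def by (rule quotient_map_compose[OF qI rs])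
  define E where "E z = (Kcoord n z, (z 1 + 1) / 2)" for z
  define \<kappa> where "\<kappa> = (\<lambda>(z, t :: real). (Kinv n z, t))"
  have Ih: "0 \<le> (z 1 + 1) / 2" "(z 1 + 1) / 2 \<le> 1" if "z \<in> hcube" for z
  proof -
    have "\<bar>z 1\<bar> \<le> 1" using that by (simp add: hcube_def)
    then show "0 \<le> (z 1 + 1) / 2" "(z 1 + 1) / 2 \<le> 1" by (simp_all add: abs_le_iff)
  qed
  have q: "quotient_map (top_of_set hcube) ?Y (Q \<circ> E)"
  proof (rule quotient_map_fundamental_domain[OF Q, of _ _ \<kappa>])
    have "continuous_map (top_of_set hcube) (torus n) (Kcoord n)"
    proof (rule continuous_map_into_torus[OF Kcoord_torus])
      fix k assume "k < n"
      then show "continuous_map (top_of_set hcube) euclidean (\<lambda>z. Kcoord n z k)"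
        by (cases "k < n - 1")
           (auto simp: Kcoord_def intro!: continuous_on_minus continuous_on_mult continuous_on_cis
             continuous_on_const continuous_on_divide continuous_on_eval)
    qed
    moreover have "continuous_map (top_of_set hcube) ?I (\<lambda>z. (z 1 + 1) / 2)"
      using Ih by (auto intro!: continuous_on_divide continuous_on_add continuous_on_const continuous_on_eval)
    ultimately show "continuous_map (top_of_set hcube) ?X E"
      unfolding E_def by (simp only: continuous_map_pairedI)
    show "compact_space (top_of_set hcube)" using compact_hcube by (simp add: compact_space_subtopology)
    have "Hausdorff_space (torus n)"
      unfolding torus_def Hausdorff_space_product_topology by (simp add: Hausdorff_space_subtopology)
    then show "Hausdorff_space ?X" using hI by (simp add: Hausdorff_space_prod_topology)
    show "continuous_map ?X ?X \<kappa>"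
      unfolding \<kappa>_def case_prod_unfold
      by (intro continuous_map_pairedI continuous_map_snd continuous_map_compose[OF continuous_map_fst continuous_map_Kinv[OF n], unfolded o_def])
    fix x assume x: "x \<in> topspace ?X"
    obtain v t where v: "x = (v, t)" "v \<in> topspace (torus n)" "0 \<le> t" "t \<le> 1" using x by auto
    show "\<kappa> (\<kappa> x) = x" by (simp add: v \<kappa>_def Kinv_Kinv)
    show "Q (\<kappa> x) = Q x" by (simp add: v Q_def \<kappa>_def qK_inv)
    have t': "\<bar>2 * t - 1\<bar> \<le> 1" using v by (simp add: abs_le_iff)
    have img: "(u, t) \<in> E ` hcube" if u: "u \<in> topspace (torus n)" "Im (u (n - 1)) \<ge> 0" for u
    proof -
      obtain z where "z \<in> hcube" "z 1 = 2 * t - 1" "u = Kcoord n z" using Kcoord_surj[OF n u t'] .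
      then have "E z = (u, t)" by (simp add: E_def)
      then show ?thesis using \<open>z \<in> hcube\<close> by (metis imageI)
    qed
    show "x \<in> E ` topspace (top_of_set hcube) \<or> \<kappa> x \<in> E ` topspace (top_of_set hcube)"
    proof (cases "Im (v (n - 1)) \<ge> 0")
      case True
      then show ?thesis using img v by simp
    next
      case False
      then have "Im (Kinv n v (n - 1)) \<ge> 0" by (simp add: Kinv_def)
      then show ?thesis using img Kinv_torus[OF n] v by (simp add: \<kappa>_def)
    qed
  qed
  \<comment> \<open>The base point of the torus has its last coordinate at the lower end of the half
    circle.\<close>
  have one: "restrict (\<lambda>i. 1) {..<n} = Kcoord n (\<lambda>i. if i = 0 then - 1 else 1)"
  proof -
    have "\<i> * cis (pi * (- 1 / 2)) = 1" by (simp add: complex_eq_iff)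
    moreover have "- cis pi = 1" by simp
    ultimately show ?thesis by (auto simp: Kcoord_def fun_eq_iff)
  qed
  \<comment> \<open>This is the clause of \<open>based\<close> for an empty smash set. Both ends of
    the half circle occur, since the involution sends the base point of the torus to the other
    end.\<close>
  have kb: "qK (Kcoord n z) = Kbase n \<longleftrightarrow> \<bar>z 0\<bar> = 1 \<and> (\<forall>i\<in>?P. \<bar>z i\<bar> = 1)" if z: "z \<in> hcube" for z
  proof -
    let ?o = "\<lambda>i::nat. if i = 0 then - 1 else 1 :: real"
    have o: "?o \<in> hcube" by (simp add: hcube_def)
    have c: "circ a 1 \<longleftrightarrow> \<bar>a\<bar> = 1" "circ a (- 1) \<longleftrightarrow> \<bar>a\<bar> = 1" for a by (auto simp: circ_def)
    have K: "Kbase n = qK (Kcoord n ?o)" by (simp add: Kbase_def qK_def one)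
    have "qK (Kcoord n z) = Kbase n \<longleftrightarrow> z 0 = - 1 \<and> (\<forall>i\<in>?P. \<bar>z i\<bar> = 1) \<or> \<bar>z 0\<bar> = 1 \<and> - 1 = - z 0 \<and> (\<forall>i\<in>?P. \<bar>z i\<bar> = 1)"
      unfolding K qK_eq using Kcoord_eq[OF n z o] by (simp add: c)
    then show ?thesis by auto
  qed
  have QE: "(Q \<circ> E) z = (if based {} ?P z then None else Some (qK (Kcoord n z), (z 1 + 1) / 2))" if z: "z \<in> hcube" for z
  proof -
    have "(z 1 + 1) / 2 = 0 \<or> (z 1 + 1) / 2 = 1 \<longleftrightarrow> \<bar>z 1\<bar> = 1" by (auto simp: abs_if)
    then show ?thesis using kb[OF z] by (auto simp: Q_def E_def rs_def based_def)
  qed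
  have "ptd_equiv ?Y ((Q \<circ> E) (\<lambda>_. 1)) (Zsp {} ?P) (pt {} ?P (\<lambda>_. 1))"
  proof (rule quotient_maps_same_kernel_ptd_equiv[OF q quotient_map_pt])
    show "(\<lambda>_. 1) \<in> topspace (top_of_set hcube)" using one_hcube by simp
    fix z w assume "z \<in> topspace (top_of_set hcube)" "w \<in> topspace (top_of_set hcube)"
    then have z: "z \<in> hcube" "w \<in> hcube" by simp_all
    have g: "qK (Kcoord n z) = qK (Kcoord n w) \<and> z 1 = w 1 \<longleftrightarrow> glued ?P z w"
      unfolding qK_eq Kcoord_eq[OF n z] glued_def by blast
    have "(Q \<circ> E) z = (Q \<circ> E) w \<longleftrightarrow> based {} ?P z \<and> based {} ?P w \<or>
        \<not> based {} ?P z \<and> \<not> based {} ?P w \<and> glued ?P z w"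
      unfolding QE[OF z(1)] QE[OF z(2)] g[symmetric] by simp
    also have "\<dots> \<longleftrightarrow> same {} ?P z w"
      using based_glued[of "{}" ?P z w] by (simp add: same_def) blast
    finally show "(Q \<circ> E) z = (Q \<circ> E) w \<longleftrightarrow> pt {} ?P z = pt {} ?P w"
      using pt_eq_iff[OF z(2)] by simp
  qed
  then show ?thesis
    unfolding QE[OF one_hcube] pt_based[OF based_one] using based_one by simp
qed

subsection \<open>Assembling the wedge\<close>

lemma smash_summands:
  assumes n: "1 \<le> n"
  shows "ptd_equiv (wedge (Pow {2..<n+1}) (\<lambda>U. Zsp U {}) (\<lambda>U. Zbase U {})) None
    (wedge (RHS_index n) RHS_space RHS_base) None"
proof -
  let ?P = "{2..<n+1}"
  have cP: "card ?P = n - 1" by simp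
  define F where "F i = {U. U \<subseteq> ?P \<and> card U = i}" for i
  have fF: "finite (F i)" for i by (rule finite_subset[of _ "Pow ?P"]) (auto simp: F_def)
  have cF: "card (F i) = (n - 1) choose i" for i
    unfolding F_def using n_subsets[of ?P i] cP by simp
  \<comment> \<open>Numbering the sets of \<open>i\<close> circles turns them into the copies
    counted by the binomial coefficient.\<close>
  have "\<exists>h. bij_betw h (F i) {0..<(n - 1) choose i}" for i
    using ex_bij_betw_finite_nat[OF fF[of i]] cF by metis
  then obtain \<beta> where \<beta>: "\<And>i. bij_betw (\<beta> i) (F i) {0..<(n - 1) choose i}" by metis
  define j where "j U = \<beta> (card U) U" for U
  have UF: "U \<in> F (card U)" if "U \<in> Pow ?P" for U using that by (simp add: F_def)
  have j_less: "j U < (n - 1) choose (card U)" if "U \<in> Pow ?P" for U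
  proof -
    have "j U \<in> {0..<(n - 1) choose (card U)}"
      unfolding j_def by (rule bij_betw_apply[OF \<beta> UF[OF that]])
    then show ?thesis by simp
  qed
  have j_inj: "U = V" if "U \<in> Pow ?P" "V \<in> Pow ?P" "card U = card V" "j U = j V" for U V
    using bij_betw_imp_inj_on[OF \<beta>[of "card U"]] UF[OF that(1)] UF[OF that(2)] that(3,4)
    unfolding j_def inj_on_def by simp
  have j_surj: "\<exists>U\<in>Pow ?P. card U = i \<and> j U = m" if "m < (n - 1) choose i" for i m
  proof -
    have "m \<in> \<beta> i ` F i" using bij_betw_imp_surj_on[OF \<beta>[of i]] that by simp
    then obtain U where "U \<in> F i" "m = \<beta> i U" by blast
    then show ?thesis by (intro bexI[of _ U]) (auto simp: F_def j_def)
  qed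
  \<comment> \<open>The summands on the right-hand side contributed by the set \<open>U\<close> of
    smashed circles.\<close>
  define J where "J U = (if U = {} then {(0, 0, 0)} else if even (card U)
    then {(1, card U, j U), (2, card U, j U)} else {(3, card U, j U)} :: (nat \<times> nat \<times> nat) set)" for U
  have fin: "finite U" if "U \<in> Pow ?P" for U using that finite_subset by auto
  show ?thesis
  proof (rule wedge_of_wedges[where J = J])
    show "Pow ?P \<noteq> {}" by blast
    fix U assume U: "U \<in> Pow ?P"
    have U2: "U \<subseteq> {2..}" using U by auto
    show "ptd_equiv (Zsp U {}) (Zbase U {}) (wedge (J U) RHS_space RHS_base) None"
    proof (cases "U = {}")
      case True
      then show ?thesis using smash_empty by (simp add: J_def)
    next
      case False
      then show ?thesis
        using smash_even[OF fin[OF U] U2 False] smash_odd[OF fin[OF U] U2] by (simp add: J_def)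
    qed
  next
    fix U V k assume U: "U \<in> Pow ?P" "V \<in> Pow ?P" and k: "k \<in> J U" "k \<in> J V"
    show "U = V"
    proof (cases "U = {} \<or> V = {}")
      case True
      then show ?thesis using k by (auto simp: J_def split: if_splits)
    next
      case False
      then have "fst (snd k) = card U" "snd (snd k) = j U" "fst (snd k) = card V" "snd (snd k) = j V"
        using k by (auto simp: J_def split: if_splits)
      then show ?thesis using j_inj[OF U] by simp
    qed
  next
    show "RHS_index n = (\<Union>U\<in>Pow ?P. J U)"
    proof (intro equalityI subsetI)
      fix k assume "k \<in> RHS_index n"
      then consider "k = (0, 0, 0)"
        | i m where "k = (1, i, m) \<or> k = (2, i, m)" "even i" "i > 0" "m < (n - 1) choose i"
        | i m where "k = (3, i, m)" "odd i" "m < (n - 1) choose i"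
        by (auto simp: RHS_index_def)
      then show "k \<in> (\<Union>U\<in>Pow ?P. J U)"
      proof cases
        case 1
        then have "k \<in> J {}" by (simp add: J_def)
        then show ?thesis by blast
      next
        case (2 i m)
        then obtain U where U: "U \<in> Pow ?P" "card U = i" "j U = m" using j_surj by blast
        then have "k \<in> J U" using 2 by (auto simp: J_def)
        then show ?thesis using U(1) by blast
      next
        case (3 i m)
        then obtain U where U: "U \<in> Pow ?P" "card U = i" "j U = m" using j_surj by blast
        then have "k \<in> J U" using 3 by (auto simp: J_def)
        then show ?thesis using U(1) by blast
      qed
    next
      fix k assume "k \<in> (\<Union>U\<in>Pow ?P. J U)"
      then obtain U where U: "U \<in> Pow ?P" "k \<in> J U" by blast
      show "k \<in> RHS_index n"
      proof (cases "U = {}")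
        case True
        then show ?thesis using U(2) by (simp add: J_def RHS_index_def)
      next
        case False
        then have "card U > 0" using fin[OF U(1)] by (simp add: card_gt_0_iff)
        then show ?thesis using U(2) False j_less[OF U(1)] by (auto simp: J_def RHS_index_def split: if_splits)
      qed
    qed
  qed
qed

theorem mainTheorem16:
  fixes n :: nat
  assumes "n \<ge> 1"
  shows "(reduced_suspension (Kspace n) (Kbase n))
           homotopy_equivalent_space (wedge (RHS_index n) RHS_space RHS_base)"
proof -
  have "{2..<n+1} \<subseteq> {2..}" by auto
  then have "ptd_equiv (Zsp {} {2..<n+1}) (Zbase {} {2..<n+1})
      (wedge (Pow {2..<n+1}) (\<lambda>U. Zsp U {}) (\<lambda>U. Zbase U {})) None"
    using smash_decomposition[of "{2..<n+1}" "{}"] by simp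
  then have "ptd_equiv (Zsp {} {2..<n+1}) (Zbase {} {2..<n+1}) (wedge (RHS_index n) RHS_space RHS_base) None"
    using smash_summands[OF assms] by (rule ptd_equiv_trans)
  with suspended_Klein[OF assms]
  have "ptd_equiv (reduced_suspension (Kspace n) (Kbase n)) None (wedge (RHS_index n) RHS_space RHS_base) None"
    by (rule ptd_equiv_trans)
  then show ?thesis by (rule ptd_equiv_imp_homotopy_equivalent_space)
qed

end
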